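(* Let $n\ge3$, $\mu_1,\mu_2,\beta>0$, $p=2q+1$ with $\frac{n}{n-2}<p<\frac{n+2}{n-2}$. (1) If $n\ge4$, system (S) has no positive semi-singular solution at $0$. (2) Suppose $n\ge4$, or $n=3$ and (S) has no positive semi-singular solution at $0$. Then for every positive solution $(u,v)$ of (S) there exist constants $0<C_1\le C_2$ such that $$C_1|x|^{-\frac{2}{p-1}}\le u(x),\,v(x)\le C_2|x|^{-\frac{2}{p-1}}\quad\text{for } x\in B_1\setminus\{0\}.$$
   Context: System (S): $-\Delta u=\mu_1u^{2q+1}+\beta u^qv^{q+1}$, $-\Delta v=\mu_2v^{2q+1}+\beta v^qu^{q+1}$ in $\mathbb{R}^n\setminus\{0\}$; a positive solution is a pair $u,v\in C^2(\mathbb{R}^n\setminus\{0\})$, $u,v>0$, solving (S). For positive solutions, the limits $\lim_{|x|\to0}u(x)$ and $\lim_{|x|\to0}v(x)$ exist in $(0,+\infty]$. A positive solution is semi-singular at $0$ if one of these limits is finite and the other equals $+\infty$. $B_1=\{|x|<1\}$. *)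

theory Defs
  imports "HOL-Analysis.Analysis"
begin

definition partial_deriv :: "'n \<Rightarrow> (real^'n \<Rightarrow> real) \<Rightarrow> real^'n \<Rightarrow> real" where
  "partial_deriv i f x = deriv (\<lambda>t. f (x + t *\<^sub>R axis i 1)) 0"

definition has_partial_at :: "'n \<Rightarrow> (real^'n \<Rightarrow> real) \<Rightarrow> real^'n \<Rightarrow> bool" where
  "has_partial_at i f x \<longleftrightarrow> (\<lambda>t. f (x + t *\<^sub>R axis i 1)) differentiable (at 0)"

definition C2_on :: "(real^'n) set \<Rightarrow> (real^'n \<Rightarrow> real) \<Rightarrow> bool" where
  "C2_on S f \<longleftrightarrow>
     continuous_on S f \<and>
     (\<forall>i. \<forall>x\<in>S. has_partial_at i f x) \<and>
     (\<forall>i. continuous_on S (partial_deriv i f)) \<and>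
     (\<forall>i j. \<forall>x\<in>S. has_partial_at j (partial_deriv i f) x) \<and>
     (\<forall>i j. continuous_on S (partial_deriv j (partial_deriv i f)))"

definition laplacian :: "(real^'n \<Rightarrow> real) \<Rightarrow> real^'n \<Rightarrow> real" where
  "laplacian f x = (\<Sum>i\<in>UNIV. partial_deriv i (partial_deriv i f) x)"

definition positive_solution ::
  "real \<Rightarrow> real \<Rightarrow> real \<Rightarrow> real \<Rightarrow> (real^'n \<Rightarrow> real) \<Rightarrow> (real^'n \<Rightarrow> real) \<Rightarrow> bool" where
  "positive_solution \<mu>1 \<mu>2 \<beta> q u v \<longleftrightarrow>
     C2_on (UNIV - {0}) u \<and> C2_on (UNIV - {0}) v \<and>
     (\<forall>x. x \<noteq> 0 \<longrightarrow> u x > 0 \<and> v x > 0) \<and>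
     (\<forall>x. x \<noteq> 0 \<longrightarrow>
        - laplacian u x = \<mu>1 * u x powr (2*q+1) + \<beta> * u x powr q * v x powr (q+1)) \<and>
     (\<forall>x. x \<noteq> 0 \<longrightarrow>
        - laplacian v x = \<mu>2 * v x powr (2*q+1) + \<beta> * v x powr q * u x powr (q+1))"

definition semi_singular :: "(real^'n \<Rightarrow> real) \<Rightarrow> (real^'n \<Rightarrow> real) \<Rightarrow> bool" where
  "semi_singular u v \<longleftrightarrow>
     ((\<exists>L. (u \<longlongrightarrow> L) (at 0)) \<and> filterlim v at_top (at 0)) \<or>
     ((\<exists>L. (v \<longlongrightarrow> L) (at 0)) \<and> filterlim u at_top (at 0))"

end

theory Submission
  imports Defs "HOL-Real_Asymp.Real_Asymp"
begin

text \<open>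
  The method of moving spheres, with an arbitrary centre \<open>x\<^sub>0 \<noteq> 0\<close> and every radius \<open>l < norm x\<^sub>0\<close>, never
  stops: the origin is an isolated singularity of a positive superharmonic function, so it does not
  affect the minimum principle in the exterior of the sphere, and subcriticality makes the difference
  of the solution and its Kelvin transform strictly superharmonic. Letting the spheres grow to
  hyperplanes shows that every positive solution, whether or not it is singular, is radial and
  nonincreasing.

  In the variable \<open>t = ln r\<close> the functions \<open>X t = r powr (1/q) * u\<close> and \<open>Y t = r powr (1/q) * v\<close> solve an
  autonomous system with an energy \<open>E\<close> that is nondecreasing (the exponent is below the critical one).
  Monotonicity of \<open>u\<close>, \<open>v\<close> bounds \<open>X\<close>, \<open>Y\<close>, and a Pohozaev-type functional gives \<open>E \<le> 0\<close>, with \<open>E < 0\<close> near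
  \<open>t = -\<infinity>\<close>; so \<open>X\<close> and \<open>Y\<close> cannot be small together. If \<open>X\<close> is small and \<open>Y\<close> is not, the coupling term acts
  on \<open>X\<close> like \<open>X powr q\<close>. For \<open>q < 1\<close>, which holds in dimension at least 4, this forces oscillation, which
  positivity excludes. For \<open>q > 1\<close>, that is in dimension 3, either \<open>X\<close> stays away from 0, or it decays
  so fast that \<open>u\<close> is bounded and the solution is semi-singular.
\<close>

text \<open>Only the pair can be moved: by \<open>\<beta> > 0\<close> the right-hand sides increase
  in both unknowns, so comparing \<open>u\<close> with its Kelvin transform needs the same
  comparison for \<open>v\<close>. A radius below \<open>norm x0\<close> keeps the origin outside
  the sphere, so the inversion never carries an exterior point to the singularity. Because
  superharmonicity is strict, one fact suffices for all comparisons: a Laplacian is nonnegative at a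
  local minimum. With \<open>s = n - 2\<close>, \<open>a = 1/q\<close> and
  \<open>\<kappa> = 2/q - s\<close>, the linear part of the equation for \<open>X\<close> has the
  characteristic roots \<open>a\<close> and \<open>\<kappa> - a\<close>. The upper bound on the
  exponent says \<open>\<kappa> > 0\<close>, which makes the energy monotone; the lower bound says
  \<open>\<kappa> < a\<close>, which makes the second root negative. A small bounded
  \<open>X\<close> thus follows the root \<open>a\<close>, that is, \<open>u\<close> stays bounded,
  unless the coupling term outweighs the linear part. That term is of order \<open>X powr q\<close>.
  Since \<open>1 < s*q < 2\<close>, the case \<open>s \<ge> 2\<close> forces \<open>q < 1\<close>
  and \<open>s = 1\<close> forces \<open>q > 1\<close>; the borderline \<open>q = 1\<close> never
  occurs.\<close>

section \<open>Second derivatives along lines\<close>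

text \<open>Meant for the restriction of a function of several variables to a line through the point of interest.\<close>

definition D2 :: "(real \<Rightarrow> real) \<Rightarrow> real \<Rightarrow> real \<Rightarrow> bool" where
  "D2 F a b \<longleftrightarrow> (\<exists>F'. (\<forall>\<^sub>F t in nhds 0. (F has_real_derivative F' t) (at t)) \<and>
     F' 0 = a \<and> (F' has_real_derivative b) (at 0))"

lemma D2_I:
  assumes "\<forall>\<^sub>F t in nhds 0. (F has_real_derivative F' t) (at t)"
    "F' 0 = a" "(F' has_real_derivative b) (at 0)"
  shows "D2 F a b"
  using assms unfolding D2_def by blast

lemma D2_eq_rhs: "D2 F a b \<Longrightarrow> a = a' \<Longrightarrow> b = b' \<Longrightarrow> D2 F a' b'"
  by simp

lemma D2_first:
  assumes "D2 F a b"
  shows "(F has_real_derivative a) (at 0)"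
  using assms unfolding D2_def by (metis eventually_nhds_x_imp_x)

lemma D2_const: "D2 (\<lambda>t. c) 0 0"
  by (rule D2_I[of _ "\<lambda>t. 0"]) auto

lemma D2_affine: "D2 (\<lambda>t. c + t * d) d 0"
  by (rule D2_I[of _ "\<lambda>t. d"]) (auto intro!: derivative_eq_intros always_eventually)

lemma D2_add:
  assumes "D2 F a b" "D2 G c d"
  shows "D2 (\<lambda>t. F t + G t) (a + c) (b + d)"
proof -
  obtain F' G' where *: "\<forall>\<^sub>F t in nhds 0. (F has_real_derivative F' t) (at t)" "F' 0 = a"
    "(F' has_real_derivative b) (at 0)" "\<forall>\<^sub>F t in nhds 0. (G has_real_derivative G' t) (at t)"
    "G' 0 = c" "(G' has_real_derivative d) (at 0)"
    using assms unfolding D2_def by blast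
  have "\<forall>\<^sub>F t in nhds 0. ((\<lambda>t. F t + G t) has_real_derivative F' t + G' t) (at t)"
    using *(1,4) by eventually_elim (auto intro!: derivative_eq_intros)
  then show ?thesis
    by (rule D2_I) (use * in \<open>auto intro!: derivative_eq_intros\<close>)
qed

lemma D2_mult:
  assumes "D2 F a b" "D2 G c d"
  shows "D2 (\<lambda>t. F t * G t) (a * G 0 + F 0 * c) (b * G 0 + 2 * a * c + F 0 * d)"
proof -
  obtain F' G' where *: "\<forall>\<^sub>F t in nhds 0. (F has_real_derivative F' t) (at t)" "F' 0 = a"
    "(F' has_real_derivative b) (at 0)" "\<forall>\<^sub>F t in nhds 0. (G has_real_derivative G' t) (at t)"
    "G' 0 = c" "(G' has_real_derivative d) (at 0)"
    using assms unfolding D2_def by blast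
  have "\<forall>\<^sub>F t in nhds 0. ((\<lambda>t. F t * G t) has_real_derivative F' t * G t + F t * G' t) (at t)"
    using *(1,4) by eventually_elim (auto intro!: derivative_eq_intros)
  then show ?thesis
    by (rule D2_I) (use * D2_first[OF assms(1)] D2_first[OF assms(2)] in
        \<open>auto intro!: derivative_eq_intros simp: algebra_simps\<close>)
qed

lemma D2_cmult:
  assumes "D2 F a b"
  shows "D2 (\<lambda>t. c * F t) (c * a) (c * b)"
  using D2_mult[OF D2_const[of c] assms] by simp

lemma D2_compose:
  assumes "D2 F a b" "\<forall>\<^sub>F x in nhds (F 0). (g has_real_derivative g1 x) (at x)"
    "(g1 has_real_derivative g2) (at (F 0))"
  shows "D2 (\<lambda>t. g (F t)) (g1 (F 0) * a) (g2 * a\<^sup>2 + g1 (F 0) * b)"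
proof -
  obtain F' where F': "\<forall>\<^sub>F t in nhds 0. (F has_real_derivative F' t) (at t)" "F' 0 = a"
    "(F' has_real_derivative b) (at 0)"
    using assms(1) unfolding D2_def by blast
  have "filterlim F (nhds (F 0)) (nhds 0)"
    using DERIV_isCont[OF D2_first[OF assms(1)]]
    unfolding isCont_def by (simp add: tendsto_at_iff_tendsto_nhds)
  then have "\<forall>\<^sub>F t in nhds 0. (g has_real_derivative g1 (F t)) (at (F t))"
    using assms(2) by (rule eventually_compose_filterlim[rotated])
  then have "\<forall>\<^sub>F t in nhds 0. ((\<lambda>t. g (F t)) has_real_derivative g1 (F t) * F' t) (at t)"
    using F'(1) by eventually_elim (rule DERIV_chain2)
  moreover have "((\<lambda>t. g1 (F t)) has_real_derivative g2 * a) (at 0)"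
    by (rule DERIV_chain2[OF assms(3) D2_first[OF assms(1)]])
  from DERIV_mult[OF this F'(3)]
  have "((\<lambda>t. g1 (F t) * F' t) has_real_derivative g2 * a\<^sup>2 + g1 (F 0) * b) (at 0)"
    by (simp add: F'(2) power2_eq_square algebra_simps)
  ultimately show ?thesis
    by (intro D2_I) (auto simp: F'(2))
qed

text \<open>If \<open>b < 0\<close>, then \<open>F'\<close>, which vanishes at 0, is negative just
  to the right of 0, and the mean value theorem pushes \<open>F\<close> below
  \<open>F 0\<close>.\<close>

lemma D2_local_min:
  assumes "D2 F a b" "\<forall>\<^sub>F t in nhds 0. F 0 \<le> F t"
  shows "b \<ge> 0"
proof (rule ccontr)
  assume "\<not> b \<ge> 0"
  obtain F' where F': "\<forall>\<^sub>F t in nhds 0. (F has_real_derivative F' t) (at t)" "F' 0 = a"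
    "(F' has_real_derivative b) (at 0)"
    using assms(1) unfolding D2_def by blast
  obtain e where e: "e > 0" "\<And>t. \<bar>t\<bar> < e \<Longrightarrow> (F has_real_derivative F' t) (at t) \<and> F 0 \<le> F t"
    using eventually_conj[OF F'(1) assms(2)] unfolding eventually_nhds_metric
    by (auto simp: dist_real_def)
  have "F' 0 = 0"
    by (rule DERIV_local_min[of F "F' 0" 0 e]) (use e in auto)
  obtain d where d: "d > 0" "\<And>h. 0 < h \<Longrightarrow> h < d \<Longrightarrow> F' h < 0"
    using DERIV_neg_dec_right[OF F'(3)] \<open>\<not> b \<ge> 0\<close> \<open>F' 0 = 0\<close> by auto
  define s where "s = min d e / 2"
  have s: "0 < s" "s < d" "s < e" using d e by (auto simp: s_def)
  obtain z where z: "0 < z" "z < s" "F s - F 0 = (s - 0) * F' z"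
    using MVT2[of 0 s F F'] s e by auto
  have "F' z < 0" using d z s by auto
  then have "F s < F 0" using z s mult_pos_neg[of s "F' z"] by simp
  then show False using e(2)[of s] s by auto
qed

text \<open>\<open>F' t\<close> is the partial derivative at the shifted base point, so the iterated
  \<open>deriv\<close> is the derivative of \<open>F'\<close> at 0. This is the way back from
  \<open>D2\<close> to \<open>laplacian\<close>.\<close>

lemma D2_partial_deriv:
  fixes f :: "real^'n \<Rightarrow> real"
  assumes "D2 (\<lambda>t. f (x + t *\<^sub>R axis j 1)) a b"
  shows "partial_deriv j (partial_deriv j f) x = b"
proof -
  let ?F = "\<lambda>t. f (x + t *\<^sub>R axis j 1)"
  obtain F' where F': "\<forall>\<^sub>F t in nhds 0. (?F has_real_derivative F' t) (at t)" "F' 0 = a"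
    "(F' has_real_derivative b) (at 0)"
    using assms(1) unfolding D2_def by blast
  have "\<forall>\<^sub>F t in nhds 0. partial_deriv j f (x + t *\<^sub>R axis j 1) = F' t"
    using F'(1)
  proof eventually_elim
    case (elim t)
    then have "((\<lambda>s. ?F (t + s)) has_real_derivative F' t) (at 0)"
      using DERIV_at_within_shift[of ?F "F' t" t 0 UNIV] by (simp add: image_add_0)
    then have "((\<lambda>s. f (x + t *\<^sub>R axis j 1 + s *\<^sub>R axis j 1)) has_real_derivative F' t) (at 0)"
      by (simp add: algebra_simps)
    then show ?case unfolding partial_deriv_def by (rule DERIV_imp_deriv)
  qed
  then have "((\<lambda>t. partial_deriv j f (x + t *\<^sub>R axis j 1)) has_real_derivative b) (at 0)"
    using F'(3) by (subst DERIV_cong_ev[OF refl _ refl]) auto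
  then show ?thesis by (metis DERIV_imp_deriv partial_deriv_def)
qed

section \<open>The chain rule for functions of class \<open>C\<^sup>2\<close>\<close>

lemma has_partial_at_DERIV:
  assumes "has_partial_at i f (x + t *\<^sub>R axis i 1)"
  shows "((\<lambda>s. f (x + s *\<^sub>R axis i 1)) has_real_derivative partial_deriv i f (x + t *\<^sub>R axis i 1)) (at t)"
proof -
  let ?F = "\<lambda>s. f (x + s *\<^sub>R axis i 1)"
  have "((\<lambda>s. ?F (s + t)) has_real_derivative partial_deriv i f (x + t *\<^sub>R axis i 1)) (at 0)"
    using assms unfolding has_partial_at_def partial_deriv_def
    by (simp add: algebra_simps DERIV_deriv_iff_real_differentiable)
  then show ?thesis
    using DERIV_at_within_shift[of ?F _ t 0 UNIV] by (simp add: add.commute)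
qed

text \<open>\<open>C2_on\<close> speaks of partial derivatives only; their continuity upgrades them
  to a Frechet derivative by changing one coordinate at a time.\<close>

lemma continuous_partials_has_derivative:
  fixes f :: "real^'n \<Rightarrow> real"
  assumes "open S" "x \<in> S" "\<And>i y. y \<in> S \<Longrightarrow> has_partial_at i f y"
    "\<And>i. continuous_on S (partial_deriv i f)"
  shows "(f has_derivative (\<lambda>h. \<Sum>i\<in>UNIV. h $ i * partial_deriv i f x)) (at x)"
  unfolding has_derivative_at_alt
proof (intro conjI allI impI)
  show "bounded_linear (\<lambda>h::real^'n. \<Sum>i\<in>UNIV. h $ i * partial_deriv i f x)"
    by (intro bounded_linear_sum bounded_linear_mult_left bounded_linear_compose
        [OF bounded_linear_mult_left bounded_linear_vec_nth])
next
  fix e0 :: real assume "e0 > 0"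
  define e where "e = e0 / real CARD('n)"
  have e: "e > 0" using \<open>e0 > 0\<close> by (simp add: e_def)
  have "\<forall>\<^sub>F y in nhds x. y \<in> S \<and> (\<forall>i. \<bar>partial_deriv i f y - partial_deriv i f x\<bar> < e)"
  proof (intro eventually_conj eventually_all_finite)
    show "\<forall>\<^sub>F y in nhds x. y \<in> S" using assms by (simp add: eventually_nhds_in_open)
    fix i
    have "isCont (partial_deriv i f) x"
      using assms by (simp add: continuous_on_eq_continuous_at)
    then have "filterlim (partial_deriv i f) (nhds (partial_deriv i f x)) (nhds x)"
      unfolding isCont_def by (simp add: tendsto_at_iff_tendsto_nhds)
    then show "\<forall>\<^sub>F y in nhds x. \<bar>partial_deriv i f y - partial_deriv i f x\<bar> < e"
      using e by (auto simp: tendsto_iff dist_real_def)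
  qed
  then obtain d where d: "d > 0"
    "\<And>y. dist y x < d \<Longrightarrow> y \<in> S \<and> (\<forall>i. \<bar>partial_deriv i f y - partial_deriv i f x\<bar> < e)"
    unfolding eventually_nhds_metric by blast
  \<comment> \<open>Induction on the set \<open>A\<close> of coordinates in which \<open>h\<close>
    may be nonzero; \<open>h'\<close> deletes one of them, and the mean value estimate runs along
    that axis without leaving the ball of radius \<open>d\<close>.\<close>
  have main: "\<And>h. (\<forall>i. i \<notin> A \<longrightarrow> h $ i = 0) \<Longrightarrow> norm h < d \<Longrightarrow>
     \<bar>f (x + h) - f x - (\<Sum>i\<in>A. h $ i * partial_deriv i f x)\<bar> \<le> e * (\<Sum>i\<in>A. \<bar>h $ i\<bar>)" for A
  proof (induction A rule: finite_induct[OF finite])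
    case 1
    then have "h = 0" by (simp add: vec_eq_iff)
    then show ?case by simp
  next
    case (2 i A)
    define h' where "h' = h - h $ i *\<^sub>R axis i 1"
    have h': "h' $ k = (if k = i then 0 else h $ k)" for k
      by (simp add: h'_def axis_def)
    have nb: "norm (h' + t *\<^sub>R axis i 1) < d" if "\<bar>t\<bar> \<le> \<bar>h $ i\<bar>" for t
    proof -
      have "norm (h' + t *\<^sub>R axis i 1) \<le> norm h"
        by (rule norm_le_componentwise_cart) (use that in \<open>auto simp: h' axis_def\<close>)
      then show ?thesis using 2 by simp
    qed
    let ?G = "\<lambda>t. f (x + h' + t *\<^sub>R axis i 1) - t * partial_deriv i f x"
    have "norm (?G (h $ i) - ?G 0) \<le> e * norm (h $ i - 0)"
    proof (rule field_differentiable_bound[of "closed_segment 0 (h $ i)" _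
          "\<lambda>t. partial_deriv i f (x + h' + t *\<^sub>R axis i 1) - partial_deriv i f x"])
      fix t assume "t \<in> closed_segment 0 (h $ i)"
      then have "\<bar>t\<bar> \<le> \<bar>h $ i\<bar>" by (auto simp: closed_segment_eq_real_ivl split: if_splits)
      then have *: "dist (x + h' + t *\<^sub>R axis i 1) x < d"
        using nb[of t] by (simp add: dist_norm algebra_simps)
      show "norm (partial_deriv i f (x + h' + t *\<^sub>R axis i 1) - partial_deriv i f x) \<le> e"
        using d(2)[OF *] by (auto intro: less_imp_le)
      have "((\<lambda>s. f (x + h' + s *\<^sub>R axis i 1)) has_real_derivative
          partial_deriv i f (x + h' + t *\<^sub>R axis i 1)) (at t)"
        by (rule has_partial_at_DERIV) (use d(2)[OF *] assms in auto)
      from DERIV_diff[OF this DERIV_cmult_right[OF DERIV_ident, of "partial_deriv i f x"]]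
      show "(?G has_field_derivative
          partial_deriv i f (x + h' + t *\<^sub>R axis i 1) - partial_deriv i f x)
         (at t within closed_segment 0 (h $ i))"
        by (simp add: has_field_derivative_at_within)
    qed auto
    then have 1: "\<bar>f (x + h) - f (x + h') - h $ i * partial_deriv i f x\<bar> \<le> e * \<bar>h $ i\<bar>"
      by (simp add: h'_def algebra_simps)
    have 2: "\<bar>f (x + h') - f x - (\<Sum>i\<in>A. h' $ i * partial_deriv i f x)\<bar> \<le> e * (\<Sum>i\<in>A. \<bar>h' $ i\<bar>)"
      by (rule 2) (use 2 nb[of 0] in \<open>auto simp: h'\<close>)
    have 3: "(\<Sum>k\<in>A. h' $ k * partial_deriv k f x) = (\<Sum>k\<in>A. h $ k * partial_deriv k f x)"
       "(\<Sum>k\<in>A. \<bar>h' $ k\<bar>) = (\<Sum>k\<in>A. \<bar>h $ k\<bar>)"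
      using \<open>i \<notin> A\<close> by (auto intro!: sum.cong simp: h')
    have 4: "(\<Sum>k\<in>insert i A. h $ k * partial_deriv k f x) =
        h $ i * partial_deriv i f x + (\<Sum>k\<in>A. h $ k * partial_deriv k f x)"
      "e * (\<Sum>k\<in>insert i A. \<bar>h $ k\<bar>) = e * \<bar>h $ i\<bar> + e * (\<Sum>k\<in>A. \<bar>h $ k\<bar>)"
      using \<open>i \<notin> A\<close> by (simp_all add: distrib_left)
    show ?case using 1 2 unfolding 3 4 by linarith
  qed
  show "\<exists>d>0. \<forall>y. norm (y - x) < d \<longrightarrow>
      norm (f y - f x - (\<Sum>i\<in>UNIV. (y - x) $ i * partial_deriv i f x)) \<le> e0 * norm (y - x)"
  proof (intro exI[of _ d] conjI allI impI d(1))
    fix y assume y: "norm (y - x) < d"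
    have "\<bar>f y - f x - (\<Sum>i\<in>UNIV. (y - x) $ i * partial_deriv i f x)\<bar> \<le> e * (\<Sum>i\<in>UNIV. \<bar>(y - x) $ i\<bar>)"
      using main[of UNIV "y - x"] y by simp
    also have "(\<Sum>i\<in>UNIV. \<bar>(y - x) $ i\<bar>) \<le> (\<Sum>i\<in>(UNIV::'n set). norm (y - x))"
      by (intro sum_mono component_le_norm_cart)
    also have "e * (\<Sum>i\<in>(UNIV::'n set). norm (y - x)) = e0 * norm (y - x)"
      by (simp add: e_def)
    finally show "norm (f y - f x - (\<Sum>i\<in>UNIV. (y - x) $ i * partial_deriv i f x)) \<le> e0 * norm (y - x)"
      using e by (simp add: mult_left_mono)
  qed
qed

lemma C2_on_has_derivative:
  fixes f :: "real^'n \<Rightarrow> real"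
  assumes "C2_on S f" "open S" "x \<in> S"
  shows "(f has_derivative (\<lambda>h. \<Sum>i\<in>UNIV. h $ i * partial_deriv i f x)) (at x)"
  using assms by (intro continuous_partials_has_derivative) (auto simp: C2_on_def)

lemma C2_on_partial_has_derivative:
  fixes f :: "real^'n \<Rightarrow> real"
  assumes "C2_on S f" "open S" "x \<in> S"
  shows "(partial_deriv k f has_derivative
     (\<lambda>h. \<Sum>i\<in>UNIV. h $ i * partial_deriv i (partial_deriv k f) x)) (at x)"
  using assms by (intro continuous_partials_has_derivative) (auto simp: C2_on_def)

lemma has_derivative_vec_componentwise:
  fixes \<gamma> :: "real \<Rightarrow> real^'n"
  assumes "\<And>k. ((\<lambda>t. \<gamma> t $ k) has_real_derivative d k) (at t)"
  shows "(\<gamma> has_derivative (\<lambda>s. \<chi> k. s * d k)) (at t)"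
proof (subst has_derivative_componentwise_within, intro ballI)
  fix b :: "real^'n" assume "b \<in> Basis"
  then obtain k where "b = axis k 1" by (auto simp: Basis_vec_def)
  then show "((\<lambda>x. \<gamma> x \<bullet> b) has_derivative (\<lambda>x. (\<chi> k. x * d k) \<bullet> b)) (at t)"
    using assms[of k] unfolding has_field_derivative_def
    by (simp add: inner_axis) (erule has_derivative_eq_rhs, simp add: fun_eq_iff)
qed

text \<open>Curves are needed because the inversion bends coordinate lines. The first-order chain
  rule holds for all \<open>t\<close> near 0, and the partial derivatives of \<open>f\<close> are
  themselves differentiable at \<open>\<gamma> 0\<close>.\<close>

lemma D2_C2_compose:
  fixes f :: "real^'n \<Rightarrow> real"
  assumes f: "C2_on S f" "open S" and x: "\<gamma> 0 \<in> S"
    and \<gamma>: "\<And>k. D2 (\<lambda>t. \<gamma> t $ k) (a k) (b k)"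
  shows "D2 (\<lambda>t. f (\<gamma> t)) (\<Sum>k\<in>UNIV. a k * partial_deriv k f (\<gamma> 0))
     (\<Sum>k\<in>UNIV. b k * partial_deriv k f (\<gamma> 0) +
        a k * (\<Sum>m\<in>UNIV. a m * partial_deriv m (partial_deriv k f) (\<gamma> 0)))"
proof -
  have "\<forall>k. \<exists>d. (\<forall>\<^sub>F t in nhds 0. ((\<lambda>t. \<gamma> t $ k) has_real_derivative d t) (at t)) \<and>
     d 0 = a k \<and> (d has_real_derivative b k) (at 0)"
    using \<gamma> unfolding D2_def by blast
  then obtain d where d: "\<And>k. \<forall>\<^sub>F t in nhds 0. ((\<lambda>t. \<gamma> t $ k) has_real_derivative d k t) (at t)"
     "\<And>k. d k 0 = a k" "\<And>k. (d k has_real_derivative b k) (at 0)"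
    by metis
  have d0: "(\<gamma> has_derivative (\<lambda>s. \<chi> k. s * a k)) (at 0)"
    by (rule has_derivative_vec_componentwise) (rule D2_first[OF \<gamma>])
  have "filterlim \<gamma> (nhds (\<gamma> 0)) (nhds 0)"
    using has_derivative_continuous[OF d0] 
    by (simp add: continuous_at tendsto_at_iff_tendsto_nhds)
  moreover have "\<forall>\<^sub>F y in nhds (\<gamma> 0). y \<in> S"
    using x f by (simp add: eventually_nhds_in_open)
  ultimately have "\<forall>\<^sub>F t in nhds 0. \<gamma> t \<in> S"
    by (rule eventually_compose_filterlim[rotated])
  moreover have "\<forall>\<^sub>F t in nhds 0. \<forall>k. ((\<lambda>t. \<gamma> t $ k) has_real_derivative d k t) (at t)"
    using d(1) by (rule eventually_all_finite)
  ultimately have 1: "\<forall>\<^sub>F t in nhds 0. ((\<lambda>t. f (\<gamma> t)) has_real_derivative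
      (\<Sum>k\<in>UNIV. d k t * partial_deriv k f (\<gamma> t))) (at t)"
  proof eventually_elim
    case (elim t)
    have "(\<gamma> has_derivative (\<lambda>s. \<chi> k. s * d k t)) (at t)"
      by (rule has_derivative_vec_componentwise) (use elim in auto)
    note has_derivative_compose[OF this C2_on_has_derivative[OF f elim(1)]]
    then show ?case unfolding has_field_derivative_def
      by (rule has_derivative_eq_rhs) (simp add: fun_eq_iff sum_distrib_left mult_ac)
  qed
  have g: "((\<lambda>t. partial_deriv k f (\<gamma> t)) has_real_derivative
      (\<Sum>m\<in>UNIV. a m * partial_deriv m (partial_deriv k f) (\<gamma> 0))) (at 0)" for k
    using has_derivative_compose[OF d0 C2_on_partial_has_derivative[OF f x]]
    unfolding has_field_derivative_def
    by (rule has_derivative_eq_rhs) (simp add: fun_eq_iff sum_distrib_left mult_ac)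
  show ?thesis
  proof (rule D2_I[OF 1])
    show "((\<lambda>t. \<Sum>k\<in>UNIV. d k t * partial_deriv k f (\<gamma> t)) has_real_derivative
     (\<Sum>k\<in>UNIV. b k * partial_deriv k f (\<gamma> 0) +
        a k * (\<Sum>m\<in>UNIV. a m * partial_deriv m (partial_deriv k f) (\<gamma> 0)))) (at 0)"
      by (rule DERIV_sum) (use DERIV_mult[OF d(3) g] in \<open>simp add: d mult_ac add_ac\<close>)
  qed (simp add: d)
qed

section \<open>Superharmonic functions and the Kelvin transform\<close>

text \<open>A relation, so that it carries the existence of the second derivatives. As only
  coordinate lines through \<open>x\<close> matter, differences, powers of the norm and Kelvin
  transforms need not be shown to be \<open>C2_on\<close>.\<close>

definition has_laplacian :: "(real^'n \<Rightarrow> real) \<Rightarrow> real^'n \<Rightarrow> real \<Rightarrow> bool" where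
  "has_laplacian f x L \<longleftrightarrow>
     (\<exists>a b. (\<forall>j. D2 (\<lambda>t. f (x + t *\<^sub>R axis j 1)) (a j) (b j)) \<and> (\<Sum>j\<in>UNIV. b j) = L)"

lemma has_laplacian_I:
  assumes "\<And>j. D2 (\<lambda>t. f (x + t *\<^sub>R axis j 1)) (a j) (b j)" "(\<Sum>j\<in>UNIV. b j) = L"
  shows "has_laplacian f x L"
  using assms unfolding has_laplacian_def by blast

lemma has_laplacian_C2:
  fixes f :: "real^'n \<Rightarrow> real"
  assumes "C2_on S f" "open S" "x \<in> S"
  shows "has_laplacian f x (laplacian f x)"
proof (rule has_laplacian_I)
  fix j
  have "D2 (\<lambda>t. (x + t *\<^sub>R axis j 1) $ k) (axis j 1 $ k) 0" for k
    using D2_affine[of "x $ k" "axis j 1 $ k"] by simp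
  from D2_C2_compose[OF assms(1,2) _ this] assms(3)
  show "D2 (\<lambda>t. f (x + t *\<^sub>R axis j 1)) (\<Sum>k\<in>UNIV. axis j 1 $ k * partial_deriv k f x)
      (partial_deriv j (partial_deriv j f) x)"
    by (simp add: axis_def if_distrib[of "\<lambda>c. c * _"] cong: if_cong)
qed (simp add: laplacian_def)

lemma has_laplacian_cmult:
  assumes "has_laplacian f x L"
  shows "has_laplacian (\<lambda>y. c * f y) x (c * L)"
proof -
  obtain a b where "\<And>j. D2 (\<lambda>t. f (x + t *\<^sub>R axis j 1)) (a j) (b j)" "(\<Sum>j\<in>UNIV. b j) = L"
    using assms unfolding has_laplacian_def by blast
  then show ?thesis
    by (intro has_laplacian_I[where a="\<lambda>j. c * a j" and b="\<lambda>j. c * b j"] D2_cmult)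
       (auto simp flip: sum_distrib_left)
qed

lemma has_laplacian_add:
  assumes "has_laplacian f x L" "has_laplacian g x M"
  shows "has_laplacian (\<lambda>y. f y + g y) x (L + M)"
proof -
  obtain a b where "\<And>j. D2 (\<lambda>t. f (x + t *\<^sub>R axis j 1)) (a j) (b j)" "(\<Sum>j\<in>UNIV. b j) = L"
    using assms unfolding has_laplacian_def by blast
  moreover obtain a' b' where "\<And>j. D2 (\<lambda>t. g (x + t *\<^sub>R axis j 1)) (a' j) (b' j)" "(\<Sum>j\<in>UNIV. b' j) = M"
    using assms unfolding has_laplacian_def by blast
  ultimately show ?thesis
    by (intro has_laplacian_I[where a="\<lambda>j. a j + a' j" and b="\<lambda>j. b j + b' j"] D2_add)
       (auto simp: sum.distrib)
qed

lemma has_laplacian_diff: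
  assumes "has_laplacian f x L" "has_laplacian g x M"
  shows "has_laplacian (\<lambda>y. f y - g y) x (L - M)"
  using has_laplacian_add[OF assms(1) has_laplacian_cmult[OF assms(2), of "-1"]] by simp

lemma has_laplacian_const: "has_laplacian (\<lambda>y. c) x 0"
  by (rule has_laplacian_I[where a="\<lambda>j. 0" and b="\<lambda>j. 0"]) (auto intro: D2_const)

lemma has_laplacian_local_min:
  fixes f :: "real^'n \<Rightarrow> real"
  assumes "has_laplacian f x L" "\<forall>\<^sub>F y in nhds x. f x \<le> f y"
  shows "L \<ge> 0"
proof -
  obtain a b where ab: "\<And>j. D2 (\<lambda>t. f (x + t *\<^sub>R axis j 1)) (a j) (b j)" "(\<Sum>j\<in>UNIV. b j) = L"
    using assms unfolding has_laplacian_def by blast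
  have "b j \<ge> 0" for j
  proof (rule D2_local_min[OF ab(1)])
    have "((\<lambda>t. x + t *\<^sub>R axis j (1::real)) \<longlongrightarrow> x + 0 *\<^sub>R axis j 1) (nhds 0)"
      by (intro tendsto_intros filterlim_ident)
    then have "filterlim (\<lambda>t. x + t *\<^sub>R axis j (1::real)) (nhds x) (nhds 0)" by simp
    from eventually_compose_filterlim[OF assms(2) this]
    show "\<forall>\<^sub>F t in nhds 0. f (x + 0 *\<^sub>R axis j 1) \<le> f (x + t *\<^sub>R axis j 1)" by simp
  qed
  then show ?thesis using ab(2) sum_nonneg[of UNIV b] by simp
qed

text \<open>At a negative minimum, which would lie in \<open>G\<close>, the Laplacian would be
  nonnegative, against strictness. \<open>K - G\<close> plays the part of the boundary.\<close>

lemma min_principle: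
  fixes f :: "real^'n \<Rightarrow> real"
  assumes "compact K" "continuous_on K f" "open G" "G \<subseteq> K"
    "\<And>y. y \<in> G \<Longrightarrow> \<exists>L<0. has_laplacian f y L" "\<And>y. y \<in> K - G \<Longrightarrow> f y \<ge> 0" "x \<in> K"
  shows "f x \<ge> 0"
proof (rule ccontr)
  assume "\<not> f x \<ge> 0"
  obtain y where y: "y \<in> K" "\<And>z. z \<in> K \<Longrightarrow> f y \<le> f z"
    using continuous_attains_inf[OF assms(1) _ assms(2)] assms(7) by blast
  then have "f y < 0" using assms(7) \<open>\<not> f x \<ge> 0\<close> by force
  then have "y \<in> G" using assms(6)[of y] y(1) by force
  obtain L where L: "L < 0" "has_laplacian f y L" using assms(5)[OF \<open>y \<in> G\<close>] by blast
  have "\<forall>\<^sub>F z in nhds y. z \<in> G" using assms(3) \<open>y \<in> G\<close> by (rule eventually_nhds_in_open)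
  then have "\<forall>\<^sub>F z in nhds y. f y \<le> f z"
    by eventually_elim (use y assms(4) in auto)
  from has_laplacian_local_min[OF L(2) this] L(1) show False by simp
qed

lemma D2_powr:
  assumes "D2 F a b" "F 0 > 0"
  shows "D2 (\<lambda>t. F t powr \<alpha>) (\<alpha> * F 0 powr (\<alpha> - 1) * a)
     (\<alpha> * (\<alpha> - 1) * F 0 powr (\<alpha> - 2) * a\<^sup>2 + \<alpha> * F 0 powr (\<alpha> - 1) * b)"
proof -
  have "\<forall>\<^sub>F x in nhds (F 0). x \<in> {0<..}"
    using assms(2) by (intro eventually_nhds_in_open) auto
  then have 1: "\<forall>\<^sub>F x in nhds (F 0). ((\<lambda>x. x powr \<alpha>) has_real_derivative \<alpha> * x powr (\<alpha> - 1)) (at x)"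
    by eventually_elim (auto intro!: has_real_derivative_powr)
  have 2: "((\<lambda>x. \<alpha> * x powr (\<alpha> - 1)) has_real_derivative \<alpha> * (\<alpha> - 1) * F 0 powr (\<alpha> - 2)) (at (F 0))"
    using DERIV_cmult[OF has_real_derivative_powr[OF assms(2), of "\<alpha> - 1"], of \<alpha>]
    by (simp add: mult.assoc)
  show ?thesis using D2_compose[OF assms(1) 1 2] by simp
qed

lemma norm_sq_vec: "(norm (z::real^'n))\<^sup>2 = (\<Sum>j\<in>UNIV. (z $ j)\<^sup>2)"
  by (simp add: norm_vec_def L2_set_def sum_nonneg)

lemma powr_half_sq: "(x::real) \<ge> 0 \<Longrightarrow> (x\<^sup>2) powr (b / 2) = x powr b"
  by (cases "x = 0") (simp_all add: powr_powr flip: powr_numeral)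

text \<open>Along a line the squared norm is a quadratic polynomial in \<open>t\<close>, so
  \<open>D2_powr\<close> applies to it with exponent \<open>b / 2\<close>.\<close>

lemma D2_norm_powr:
  fixes z :: "real^'n"
  assumes "z \<noteq> 0"
  shows "D2 (\<lambda>t. norm (z + t *\<^sub>R axis j 1) powr b) (b * norm z powr (b - 2) * z $ j)
    (b * (b - 2) * norm z powr (b - 4) * (z $ j)\<^sup>2 + b * norm z powr (b - 2))"
proof -
  have A: "axis j 1 \<bullet> axis j (1::real) = 1" "z \<bullet> axis j 1 = z $ j" "axis j 1 \<bullet> z = z $ j"
    by (simp_all add: inner_axis inner_axis' inner_axis_axis)
  have eq: "(norm (z + t *\<^sub>R axis j 1))\<^sup>2 = (norm z)\<^sup>2 + t * (2 * z $ j) + t\<^sup>2" for t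
    by (simp only: power2_norm_eq_inner inner_add_left inner_add_right inner_scaleR_left inner_scaleR_right A)
       (simp add: power2_eq_square algebra_simps)
  have "D2 (\<lambda>t. (norm (z + t *\<^sub>R axis j 1))\<^sup>2) (2 * z $ j) 2"
    unfolding eq
    by (rule D2_I[of _ "\<lambda>t. 2 * z $ j + 2 * t"]) (auto intro!: derivative_eq_intros always_eventually)
  from D2_powr[OF this, of "b/2"] assms
  have D: "D2 (\<lambda>t. ((norm (z + t *\<^sub>R axis j 1))\<^sup>2) powr (b / 2))
     (b / 2 * (norm z)\<^sup>2 powr (b / 2 - 1) * (2 * z $ j))
     (b / 2 * (b / 2 - 1) * (norm z)\<^sup>2 powr (b / 2 - 2) * (2 * z $ j)\<^sup>2 + b / 2 * (norm z)\<^sup>2 powr (b / 2 - 1) * 2)"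
    by simp
  have "D2 (\<lambda>t. ((norm (z + t *\<^sub>R axis j 1))\<^sup>2) powr (b / 2))
     (b * ((norm z)\<^sup>2 powr (b / 2 - 1)) * z $ j)
     (b * (b - 2) * (norm z)\<^sup>2 powr (b / 2 - 2) * (z $ j)\<^sup>2 + b * (norm z)\<^sup>2 powr (b / 2 - 1))"
    by (rule D2_eq_rhs[OF D]) (simp_all add: algebra_simps power2_eq_square)
  moreover have "(norm z)\<^sup>2 powr (b / 2 - 1) = norm z powr (b - 2)"
    "(norm z)\<^sup>2 powr (b / 2 - 2) = norm z powr (b - 4)"
    using powr_half_sq[of "norm z" "b - 2"] powr_half_sq[of "norm z" "b - 4"]
    by (simp_all add: diff_divide_distrib)
  ultimately show ?thesis by (simp add: powr_half_sq)
qed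

lemma norm_powr_minus:
  fixes z :: "real^'n" assumes "z \<noteq> 0"
  shows "norm z powr (b - 2) = norm z powr b * inverse ((norm z)\<^sup>2)"
    "norm z powr (b - 4) = norm z powr b * (inverse ((norm z)\<^sup>2))\<^sup>2"
  using assms by (simp_all add: powr_diff divide_inverse power_inverse flip: power_mult)

text \<open>The second derivatives of \<open>norm z powr b\<close> add up to
  \<open>b * (b - 2 + n) * norm z powr (b - 2)\<close>, which vanishes for
  \<open>b = 2 - n\<close>.\<close>

lemma has_laplacian_fundamental:
  fixes y z :: "real^'n"
  assumes "y \<noteq> z"
  shows "has_laplacian (\<lambda>y. norm (y - z) powr (2 - real CARD('n))) y 0"
proof (rule has_laplacian_I)
  let ?b = "2 - real CARD('n)" and ?z = "y - z"
  fix j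
  show "D2 (\<lambda>t. norm (y + t *\<^sub>R axis j 1 - z) powr ?b) (?b * norm ?z powr (?b - 2) * ?z $ j)
    (?b * (?b - 2) * norm ?z powr (?b - 4) * (?z $ j)\<^sup>2 + ?b * norm ?z powr (?b - 2))"
    using D2_norm_powr[of ?z j ?b] assms by (simp add: algebra_simps)
next
  let ?b = "2 - real CARD('n)" and ?z = "y - z"
  have "(\<Sum>j\<in>UNIV. ?b * (?b - 2) * norm ?z powr (?b - 4) * (?z $ j)\<^sup>2 + ?b * norm ?z powr (?b - 2))
     = ?b * (?b - 2) * norm ?z powr (?b - 4) * (norm ?z)\<^sup>2 + real CARD('n) * (?b * norm ?z powr (?b - 2))"
    by (simp only: norm_sq_vec sum.distrib sum_distrib_left sum_constant)
  also have "norm ?z powr (?b - 4) * (norm ?z)\<^sup>2 = norm ?z powr (?b - 2)"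
  proof -
    have "inverse ((norm ?z)\<^sup>2) * (norm ?z)\<^sup>2 = 1" using assms by simp
    then have "g * (inverse ((norm ?z)\<^sup>2))\<^sup>2 * (norm ?z)\<^sup>2 = g * inverse ((norm ?z)\<^sup>2)" for g
      by (simp only: power2_eq_square[of "inverse _"] mult.assoc mult_1_right)
    then show ?thesis
      using norm_powr_minus[of ?z ?b] assms by (simp only: right_minus_eq simp_thms not_False_eq_True)
  qed
  then have "?b * (?b - 2) * norm ?z powr (?b - 4) * (norm ?z)\<^sup>2 = ?b * (?b - 2) * norm ?z powr (?b - 2)"
    by (simp only: mult.assoc)
  finally show "(\<Sum>j\<in>UNIV. ?b * (?b - 2) * norm ?z powr (?b - 4) * (?z $ j)\<^sup>2 + ?b * norm ?z powr (?b - 2)) = 0"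
    by (simp add: algebra_simps)
qed

definition kelvin :: "real^'n \<Rightarrow> real \<Rightarrow> (real^'n \<Rightarrow> real) \<Rightarrow> real^'n \<Rightarrow> real" where
  "kelvin x0 l u y = (l / norm (y - x0)) powr (real CARD('n) - 2) *
     u (x0 + (l / norm (y - x0))\<^sup>2 *\<^sub>R (y - x0))"

text \<open>The product and chain rules leave three sums. \<open>S1\<close>: the weight
  \<open>norm z powr (2 - n)\<close> is harmonic. \<open>S2\<close>: the gradient of the weight
  cancels the Laplacian of the inversion. \<open>S3\<close>: the inversion is conformal, so the
  second-order part is a multiple of the Laplacian of \<open>u\<close>.\<close>

lemma kelvin_has_laplacian:
  fixes u :: "real^'n \<Rightarrow> real"
  assumes u: "C2_on S u" "open S" and y: "y \<noteq> x0" "x0 + (l / norm (y - x0))\<^sup>2 *\<^sub>R (y - x0) \<in> S"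
    and l: "l > 0"
  shows "has_laplacian (kelvin x0 l u) y ((l / norm (y - x0)) powr (real CARD('n) - 2) *
     (l / norm (y - x0))^4 * laplacian u (x0 + (l / norm (y - x0))\<^sup>2 *\<^sub>R (y - x0)))"
proof -
  let ?n = "real CARD('n)"
  define z where "z = y - x0"
  define i where "i = inverse ((norm z)\<^sup>2)"
  define \<beta> where "\<beta> = 2 - ?n"
  define g where "g = norm z powr \<beta>"
  define c where "c = l\<^sup>2"
  define P where "P = x0 + (l / norm (y - x0))\<^sup>2 *\<^sub>R (y - x0)"
  define d :: "'n \<Rightarrow> 'n \<Rightarrow> real" where "d j k = (if j = k then 1 else 0)" for j k
  \<comment> \<open>\<open>a j k\<close> and \<open>b j k\<close> are the first and second
    derivatives along axis \<open>j\<close> of component \<open>k\<close> of the inversion;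
    \<open>h1\<close>, \<open>h2\<close> belong in the same way to the weight, \<open>W1\<close>,
    \<open>W2\<close> to \<open>u\<close> after the inversion.\<close>
  define a where "a j k = c * (d j k * i - 2 * i\<^sup>2 * z $ j * z $ k)" for j k
  define b where "b j k = c * (- 4 * d j k * i\<^sup>2 * z $ j + 8 * i^3 * z $ k * (z $ j)\<^sup>2 - 2 * i\<^sup>2 * z $ k)" for j k
  define h1 where "h1 j = \<beta> * g * i * z $ j" for j
  define h2 where "h2 j = \<beta> * (\<beta> - 2) * g * i\<^sup>2 * (z $ j)\<^sup>2 + \<beta> * g * i" for j
  define W1 where "W1 j = (\<Sum>k\<in>UNIV. a j k * partial_deriv k u P)" for j
  define W2 where "W2 j = (\<Sum>k\<in>UNIV. b j k * partial_deriv k u P +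
        a j k * (\<Sum>m\<in>UNIV. a j m * partial_deriv m (partial_deriv k u) P))" for j
  have z: "z \<noteq> 0" using y by (simp add: z_def)
  have iN: "i * (norm z)\<^sup>2 = 1" using z by (simp add: i_def)
  then have zz: "i * (\<Sum>j\<in>UNIV. (z $ j)\<^sup>2) = 1" by (simp add: norm_sq_vec)
  have yz: "y + t *\<^sub>R axis j 1 - x0 = z + t *\<^sub>R axis j 1" for t :: real and j by (simp add: z_def)
  define \<gamma> where "\<gamma> j t = x0 + (l / norm (z + t *\<^sub>R axis j 1))\<^sup>2 *\<^sub>R (z + t *\<^sub>R axis j 1)" for j and t :: real
  have \<gamma>0: "\<gamma> j 0 = P" for j by (simp add: \<gamma>_def P_def z_def)
  have Dh: "D2 (\<lambda>t. norm (z + t *\<^sub>R axis j 1) powr \<beta>) (h1 j) (h2 j)" for j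
    using D2_norm_powr[OF z, of j \<beta>]
    by (simp add: h1_def h2_def g_def i_def norm_powr_minus[OF z] mult_ac)
  have D\<gamma>: "D2 (\<lambda>t. \<gamma> j t $ k) (a j k) (b j k)" for j k
  proof -
    have "norm z powr (-2) = i"
      using norm_powr_minus(1)[OF z, of 0] z by (simp add: i_def)
    moreover have "norm z powr (-4) = i\<^sup>2"
      using norm_powr_minus(2)[OF z, of 0] z by (simp add: i_def)
    moreover have "norm z powr (-6) = i^3"
      using norm_powr_minus(2)[OF z, of "-2"] calculation by (simp add: i_def power2_eq_square power3_eq_cube)
    ultimately have 1: "D2 (\<lambda>t. norm (z + t *\<^sub>R axis j 1) powr (-2)) (- 2 * i\<^sup>2 * z $ j)
        (8 * i^3 * (z $ j)\<^sup>2 - 2 * i\<^sup>2)"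
      using D2_norm_powr[OF z, of j "-2"] by simp
    have 2: "D2 (\<lambda>t. z $ k + t * d j k) (d j k) 0" by (rule D2_affine)
    have "D2 (\<lambda>t. x0 $ k + c * ((z $ k + t * d j k) * norm (z + t *\<^sub>R axis j 1) powr (-2)))
       (a j k) (b j k)"
      using D2_add[OF D2_const[of "x0 $ k"] D2_cmult[OF D2_mult[OF 2 1], of c]]
      by (simp add: \<open>norm z powr (-2) = i\<close> a_def b_def algebra_simps)
    moreover have "x0 $ k + c * ((z $ k + t * d j k) * norm (z + t *\<^sub>R axis j 1) powr (-2)) = \<gamma> j t $ k" for t
      by (simp add: \<gamma>_def c_def d_def axis_def powr_minus divide_inverse power_mult_distrib power_inverse)
    ultimately show ?thesis by simp
  qed
  have Du: "D2 (\<lambda>t. u (\<gamma> j t)) (W1 j) (W2 j)" for j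
    using D2_C2_compose[OF u, of "\<gamma> j" "a j" "b j"] D\<gamma>[of j] y(2)
    by (simp add: \<gamma>0 W1_def W2_def P_def)
  define B where "B j = h2 j * u P + 2 * h1 j * W1 j + g * W2 j" for j
  have DK: "D2 (\<lambda>t. kelvin x0 l u (y + t *\<^sub>R axis j 1))
     (l powr (?n - 2) * (h1 j * u P + g * W1 j)) (l powr (?n - 2) * B j)" for j
  proof -
    have "kelvin x0 l u (y + t *\<^sub>R axis j 1) =
        l powr (?n - 2) * (norm (z + t *\<^sub>R axis j 1) powr \<beta> * u (\<gamma> j t))" for t
      unfolding kelvin_def yz \<gamma>_def \<beta>_def
      using l by (simp add: powr_divide powr_diff field_simps)
    moreover have "D2 (\<lambda>t. l powr (?n - 2) * (norm (z + t *\<^sub>R axis j 1) powr \<beta> * u (\<gamma> j t)))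
       (l powr (?n - 2) * (h1 j * u P + g * W1 j)) (l powr (?n - 2) * B j)"
      using D2_cmult[OF D2_mult[OF Dh Du], of "l powr (?n - 2)" j] by (simp add: \<gamma>0 g_def B_def)
    ultimately show ?thesis by simp
  qed
  have dsum: "(\<Sum>j\<in>UNIV. d j k * F j) = F k" for k and F :: "'n \<Rightarrow> real"
    by (simp add: d_def if_distrib[of "\<lambda>c. c * _"] cong: if_cong)
  have S1: "(\<Sum>j\<in>UNIV. h2 j) = 0"
  proof -
    have "(\<Sum>j\<in>UNIV. h2 j) = \<beta> * (\<beta> - 2) * g * i * (i * (\<Sum>j\<in>UNIV. (z $ j)\<^sup>2)) + ?n * (\<beta> * g * i)"
      unfolding h2_def by (simp add: sum.distrib power2_eq_square sum_distrib_left mult_ac)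
    then show ?thesis unfolding zz by (simp add: \<beta>_def algebra_simps)
  qed
  have S2: "(\<Sum>j\<in>UNIV. 2 * h1 j * a j k + g * b j k) = 0" for k
  proof -
    have "2 * h1 j * a j k + g * b j k = d j k * ((2 * \<beta> - 4) * g * c * i\<^sup>2 * z $ j) 
        + (- 4 * \<beta> + 8) * g * c * i^3 * z $ k * (z $ j)\<^sup>2 - 2 * g * c * i\<^sup>2 * z $ k" for j
      unfolding h1_def a_def b_def by (simp add: power2_eq_square power3_eq_cube algebra_simps)
    then have "(\<Sum>j\<in>UNIV. 2 * h1 j * a j k + g * b j k) =
        (\<Sum>j\<in>UNIV. d j k * ((2 * \<beta> - 4) * g * c * i\<^sup>2 * z $ j))
        + (\<Sum>j\<in>UNIV. ((- 4 * \<beta> + 8) * g * c * i^3 * z $ k) * (z $ j)\<^sup>2) - (\<Sum>j\<in>(UNIV::'n set). 2 * g * c * i\<^sup>2 * z $ k)"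
      by (simp only: sum.distrib sum_subtractf)
    also have "\<dots> = (2 * \<beta> - 4) * g * c * i\<^sup>2 * z $ k
       + (- 4 * \<beta> + 8) * g * c * i\<^sup>2 * z $ k * (i * (\<Sum>j\<in>UNIV. (z $ j)\<^sup>2)) - ?n * (2 * g * c * i\<^sup>2 * z $ k)"
      unfolding dsum sum_distrib_left[symmetric] by (simp add: power2_eq_square power3_eq_cube)
    finally show ?thesis unfolding zz by (simp add: \<beta>_def algebra_simps)
  qed
  have S3: "(\<Sum>j\<in>UNIV. a j k * a j m) = d m k * (c\<^sup>2 * i\<^sup>2)" for k m
  proof -
    have "a j k * a j m = d j k * d j m * (c\<^sup>2 * i\<^sup>2) - d j k * (2 * c\<^sup>2 * i^3 * z $ j * z $ m)
       - d j m * (2 * c\<^sup>2 * i^3 * z $ j * z $ k) + 4 * c\<^sup>2 * i^4 * z $ k * z $ m * (z $ j)\<^sup>2" for j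
      unfolding a_def by (simp add: power2_eq_square power3_eq_cube power4_eq_xxxx algebra_simps)
    then have "(\<Sum>j\<in>UNIV. a j k * a j m) = (\<Sum>j\<in>UNIV. d j k * (d j m * (c\<^sup>2 * i\<^sup>2)))
       - (\<Sum>j\<in>UNIV. d j k * (2 * c\<^sup>2 * i^3 * z $ j * z $ m))
       - (\<Sum>j\<in>UNIV. d j m * (2 * c\<^sup>2 * i^3 * z $ j * z $ k)) + (\<Sum>j\<in>UNIV. (4 * c\<^sup>2 * i^4 * z $ k * z $ m) * (z $ j)\<^sup>2)"
      by (simp only: sum.distrib sum_subtractf mult.assoc)
    also have "\<dots> = d m k * (c\<^sup>2 * i\<^sup>2) - 4 * c\<^sup>2 * i^3 * z $ k * z $ m
        + 4 * c\<^sup>2 * i^3 * z $ k * z $ m * (i * (\<Sum>j\<in>UNIV. (z $ j)\<^sup>2))"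
      unfolding dsum sum_distrib_left[symmetric]
      by (simp add: d_def power2_eq_square power3_eq_cube power4_eq_xxxx)
    finally show ?thesis unfolding zz by simp
  qed
  have "(\<Sum>j\<in>UNIV. B j) = (\<Sum>j\<in>UNIV. h2 j) * u P
      + (\<Sum>j\<in>UNIV. \<Sum>k\<in>UNIV. (2 * h1 j * a j k + g * b j k) * partial_deriv k u P)
      + g * (\<Sum>j\<in>UNIV. \<Sum>k\<in>UNIV. \<Sum>m\<in>UNIV. a j k * a j m * partial_deriv m (partial_deriv k u) P)"
    unfolding B_def W1_def W2_def
    by (simp add: sum.distrib sum_distrib_left sum_distrib_right algebra_simps)
  also have "(\<Sum>j\<in>UNIV. \<Sum>k\<in>UNIV. (2 * h1 j * a j k + g * b j k) * partial_deriv k u P) =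
     (\<Sum>k\<in>UNIV. (\<Sum>j\<in>UNIV. 2 * h1 j * a j k + g * b j k) * partial_deriv k u P)"
    by (subst sum.swap) (simp add: sum_distrib_right)
  also have "(\<Sum>j\<in>UNIV. \<Sum>k\<in>UNIV. \<Sum>m\<in>UNIV. a j k * a j m * partial_deriv m (partial_deriv k u) P) =
     (\<Sum>k\<in>UNIV. \<Sum>m\<in>UNIV. (\<Sum>j\<in>UNIV. a j k * a j m) * partial_deriv m (partial_deriv k u) P)"
    by (subst sum.swap, rule sum.cong[OF refl], subst sum.swap) (simp add: sum_distrib_right)
  also have "\<dots> = c\<^sup>2 * i\<^sup>2 * laplacian u P"
    unfolding S3 laplacian_def
    by (simp add: d_def if_distrib[of "\<lambda>c. c * _"] sum_distrib_left cong: if_cong)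
  finally have "(\<Sum>j\<in>UNIV. B j) = g * (c\<^sup>2 * i\<^sup>2 * laplacian u P)"
    unfolding S1 S2 by simp
  then have "(\<Sum>j\<in>UNIV. l powr (?n - 2) * B j) = l powr (?n - 2) * (g * (c\<^sup>2 * i\<^sup>2 * laplacian u P))"
    by (simp flip: sum_distrib_left)
  also have "\<dots> = (l / norm z) powr (?n - 2) * (l / norm z)^4 * laplacian u P"
  proof -
    have "g * (norm z powr (?n - 2)) = 1" using z by (simp add: g_def \<beta>_def flip: powr_add)
    then have "(l / norm z) powr (?n - 2) = l powr (?n - 2) * g"
      using l z by (simp add: powr_divide field_simps)
    moreover have "c\<^sup>2 * i\<^sup>2 = (l / norm z)^4"
      by (simp add: c_def i_def divide_inverse power_mult_distrib power_inverse flip: power_mult)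
    ultimately show ?thesis by simp
  qed
  finally show ?thesis
    using has_laplacian_I[OF DK] unfolding z_def P_def by simp
qed

section \<open>Comparison with powers of the distance\<close>

lemma small_powr_large:
  fixes s A \<delta> :: real
  assumes "s > 0" "\<delta> > 0"
  obtains \<rho> where "0 < \<rho>" "\<rho> \<le> \<delta>" "\<rho> powr (-s) \<ge> A"
proof
  define \<rho> where "\<rho> = min \<delta> ((\<bar>A\<bar> + 1) powr (- 1 / s))"
  show "0 < \<rho>" "\<rho> \<le> \<delta>" using assms by (auto simp: \<rho>_def)
  have "A \<le> ((\<bar>A\<bar> + 1) powr (- 1 / s)) powr (-s)" using assms by (simp add: powr_powr)
  also have "\<dots> \<le> \<rho> powr (-s)"
    by (rule powr_mono2') (use assms in \<open>auto simp: \<rho>_def\<close>)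
  finally show "\<rho> powr (-s) \<ge> A" .
qed

lemma large_powr_small:
  fixes s C \<epsilon> :: real
  assumes "s > 0" "\<epsilon> > 0"
  obtains T where "T > 0" "\<And>t. t \<ge> T \<Longrightarrow> C * t powr (-s) \<le> \<epsilon>"
proof
  define T where "T = ((\<bar>C\<bar> + 1) / \<epsilon>) powr (1 / s)"
  show "T > 0" using assms by (simp add: T_def)
  fix t assume t: "t \<ge> T"
  have "t powr (-s) \<le> T powr (-s)"
    by (rule powr_mono2') (use assms t \<open>T > 0\<close> in auto)
  also have "\<dots> = \<epsilon> / (\<bar>C\<bar> + 1)" using assms by (simp add: T_def powr_powr powr_minus field_simps)
  finally have "\<bar>C\<bar> * t powr (-s) \<le> \<bar>C\<bar> * (\<epsilon> / (\<bar>C\<bar> + 1))" by (rule mult_left_mono) simp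
  also have "\<dots> \<le> \<epsilon>" using assms by (simp add: field_simps)
  finally show "C * t powr (-s) \<le> \<epsilon>"
    using mult_right_mono[of C "\<bar>C\<bar>" "t powr (-s)"] by (meson abs_ge_self order_trans powr_ge_zero)
qed

text \<open>The multiple of \<open>1 + norm y powr (2 - n)\<close> added in the proof absorbs both infinity and the puncture.\<close>

lemma exterior_barrier:
  fixes w :: "real^'n \<Rightarrow> real" and x0 :: "real^'n"
  assumes n3: "CARD('n) \<ge> 3" and r: "0 < r" "r < norm x0" and m: "m \<ge> 0"
    and cont: "continuous_on {y. r \<le> norm (y - x0) \<and> y \<noteq> 0} w"
    and nonneg: "\<And>y. r \<le> norm (y - x0) \<Longrightarrow> y \<noteq> 0 \<Longrightarrow> w y \<ge> 0"
    and super: "\<And>y. r < norm (y - x0) \<Longrightarrow> y \<noteq> 0 \<Longrightarrow> \<exists>L<0. has_laplacian w y L"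
    and bd: "\<And>y. norm (y - x0) = r \<Longrightarrow> w y \<ge> m"
    and y: "r \<le> norm (y - x0)" "y \<noteq> 0"
  shows "w y \<ge> m * (r / norm (y - x0)) powr (real CARD('n) - 2)"
proof -
  define s where "s = real CARD('n) - 2"
  have s: "s > 0" using n3 by (simp add: s_def)
  define C where "C = m * r powr s"
  have C: "C \<ge> 0" "C * r powr (-s) = m" using m r by (auto simp: C_def powr_minus)
  have main: "C * norm (y - x0) powr (-s) \<le> w y + \<epsilon> * (1 + norm y powr (-s))" if \<epsilon>: "\<epsilon> > 0" for \<epsilon>
  proof -
    \<comment> \<open>On the sphere of radius \<open>\<rho>\<close> the term
      \<open>\<epsilon> * norm z powr (-s)\<close> reaches \<open>m\<close>; from distance
      \<open>T\<close> to \<open>x0\<close> on, the subtracted term is at most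
      \<open>\<epsilon>\<close>. On these two boundary parts nothing is known of \<open>w\<close>
      beyond nonnegativity.\<close>
    obtain \<rho> where \<rho>: "0 < \<rho>" "\<rho> \<le> norm y" "\<rho> powr (-s) \<ge> m / \<epsilon>"
      using small_powr_large[OF s, of "norm y" "m / \<epsilon>"] y by auto
    obtain T where T: "T > 0" "\<And>t. t \<ge> T \<Longrightarrow> C * t powr (-s) \<le> \<epsilon>"
      using large_powr_small[OF s \<epsilon>] by blast
    define R where "R = max (norm y) (T + norm x0)"
    define K where "K = {z. r \<le> norm (z - x0) \<and> \<rho> \<le> norm z \<and> norm z \<le> R}"
    define G where "G = {z. r < norm (z - x0) \<and> \<rho> < norm z \<and> norm z < R}"
    define f where "f z = w z + (\<epsilon> + \<epsilon> * norm z powr (-s) - C * norm (z - x0) powr (-s))" for z :: "real^'n"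
    have "f y \<ge> 0"
    proof (rule min_principle[of K f G])
      have "closed K" unfolding K_def
        by (intro closed_Collect_conj closed_Collect_le continuous_intros)
      moreover have "bounded K" unfolding K_def by (intro boundedI[of _ R]) auto
      ultimately show "compact K" by (simp add: compact_eq_bounded_closed)
      have "continuous_on K w" by (rule continuous_on_subset[OF cont]) (use \<rho> in \<open>auto simp: K_def\<close>)
      then show "continuous_on K f" unfolding f_def using \<rho> r
        by (intro continuous_intros) (auto simp: K_def)
      show "open G" unfolding G_def by (intro open_Collect_conj open_Collect_less continuous_intros)
      show "G \<subseteq> K" by (auto simp: G_def K_def)
      show "y \<in> K" using y \<rho> by (auto simp: K_def R_def)
    next
      fix z assume "z \<in> G"
      then have z: "r < norm (z - x0)" "z \<noteq> 0" "z \<noteq> x0" using \<rho> r by (auto simp: G_def)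
      obtain L where L: "L < 0" "has_laplacian w z L" using super[OF z(1,2)] by blast
      have 1: "has_laplacian (\<lambda>y. norm y powr (-s)) z 0"
        using has_laplacian_fundamental[OF z(2)] by (simp add: s_def)
      have 2: "has_laplacian (\<lambda>y. norm (y - x0) powr (-s)) z 0"
        using has_laplacian_fundamental[OF z(3)] by (simp add: s_def)
      have "has_laplacian f z (L + (0 + \<epsilon> * 0 - C * 0))" unfolding f_def
        by (intro has_laplacian_add has_laplacian_diff has_laplacian_cmult has_laplacian_const L 1 2)
      then show "\<exists>L<0. has_laplacian f z L" using L by auto
    next
      fix z assume z: "z \<in> K - G"
      have z0: "z \<noteq> 0" "r \<le> norm (z - x0)" using z \<rho> by (auto simp: K_def)
      have le: "C * norm (z - x0) powr (-s) \<le> m"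
        using powr_mono2'[of "-s" r "norm (z - x0)"] s r z0 C mult_left_mono[of "norm (z - x0) powr (-s)" "r powr (-s)" C] by simp
      have p: "\<epsilon> * norm z powr (-s) \<ge> 0" using \<epsilon> by simp
      consider "norm (z - x0) = r" | "norm z = \<rho>" | "norm z = R"
        using z by (auto simp: K_def G_def)
      then show "f z \<ge> 0"
      proof cases
        case 1
        then show ?thesis using bd[of z] le p \<epsilon> unfolding f_def by linarith
      next
        case 2
        then have "\<epsilon> * norm z powr (-s) \<ge> m" using \<rho>(3) \<epsilon> by (simp add: field_simps)
        then show ?thesis using nonneg[OF z0(2,1)] le \<epsilon> unfolding f_def by linarith
      next
        case 3
        have "norm (z - x0) \<ge> T" using 3 norm_triangle_ineq2[of z x0] by (simp add: R_def)
        from T(2)[OF this] show ?thesis using nonneg[OF z0(2,1)] p unfolding f_def by linarith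
      qed
    qed
    then show ?thesis unfolding f_def by (simp add: algebra_simps)
  qed
  have "C * norm (y - x0) powr (-s) \<le> w y"
  proof (rule field_le_epsilon)
    fix e :: real assume "e > 0"
    then show "C * norm (y - x0) powr (-s) \<le> w y + e"
      using main[of "e / (1 + norm y powr (-s))"] by (simp add: add_pos_nonneg)
         (metis add_pos_nonneg less_irrefl main mult.commute nonzero_mult_div_cancel_left powr_ge_zero times_divide_eq_right zero_less_divide_iff zero_less_one)
  qed
  moreover have "C * norm (y - x0) powr (-s) = m * (r / norm (y - x0)) powr s"
    using r y by (simp add: C_def powr_divide powr_minus_divide)
  ultimately show ?thesis by (simp add: s_def)
qed

text \<open>\<open>c\<close> makes the harmonic comparison function, which is zero on the inner
  sphere, equal to \<open>m\<close> on the outer one. Its positive slope at the inner sphere is what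
  the Hopf argument uses.\<close>

lemma annulus_barrier:
  fixes w :: "real^'n \<Rightarrow> real" and x0 :: "real^'n"
  assumes n3: "CARD('n) \<ge> 3" and r: "0 < l" "l < R" and m: "m > 0"
    and cont: "continuous_on {y. l \<le> norm (y - x0) \<and> norm (y - x0) \<le> R} w"
    and super: "\<And>y. l < norm (y - x0) \<Longrightarrow> norm (y - x0) < R \<Longrightarrow> \<exists>L<0. has_laplacian w y L"
    and bd: "\<And>y. norm (y - x0) = l \<Longrightarrow> w y \<ge> 0" "\<And>y. norm (y - x0) = R \<Longrightarrow> w y \<ge> m"
  obtains c where "c > 0" "\<And>y. l \<le> norm (y - x0) \<Longrightarrow> norm (y - x0) \<le> R \<Longrightarrow>
     w y \<ge> c * (l powr (2 - real CARD('n)) - norm (y - x0) powr (2 - real CARD('n)))"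
proof
  define s where "s = 2 - real CARD('n)"
  have s: "s < 0" using n3 by (simp add: s_def)
  have "R powr s < l powr s"
    using powr_less_mono2_neg[of s l R] s r by simp
  then have d: "l powr s - R powr s > 0" by simp
  define c where "c = m / (l powr s - R powr s)"
  show c: "c > 0" using m d by (simp add: c_def)
  have cR: "c * (l powr s - R powr s) = m" using d by (simp add: c_def)
  define K where "K = {y. l \<le> norm (y - x0) \<and> norm (y - x0) \<le> R}"
  define G where "G = {y. l < norm (y - x0) \<and> norm (y - x0) < R}"
  define f where "f y = w y + (c * norm (y - x0) powr s - c * l powr s)" for y
  fix y assume y: "l \<le> norm (y - x0)" "norm (y - x0) \<le> R"
  have "f y \<ge> 0"
  proof (rule min_principle[of K f G])
    have "closed K" unfolding K_def
      by (intro closed_Collect_conj closed_Collect_le continuous_intros)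
    moreover have "bounded K"
    proof (rule boundedI)
      fix z assume "z \<in> K"
      then show "norm z \<le> R + norm x0" using norm_triangle_ineq2[of z x0] by (simp add: K_def)
    qed
    ultimately show "compact K" by (simp add: compact_eq_bounded_closed)
    have "continuous_on K w" using cont by (simp add: K_def)
    then show "continuous_on K f" unfolding f_def using r
      by (intro continuous_intros) (auto simp: K_def)
    show "open G" unfolding G_def by (intro open_Collect_conj open_Collect_less continuous_intros)
    show "G \<subseteq> K" by (auto simp: G_def K_def)
    show "y \<in> K" using y by (auto simp: K_def)
  next
    fix z assume z: "z \<in> G"
    then obtain L where L: "L < 0" "has_laplacian w z L" using super[of z] by (auto simp: G_def)
    have "z \<noteq> x0" using z r by (auto simp: G_def)
    from has_laplacian_fundamental[OF this]
    have 2: "has_laplacian (\<lambda>y. norm (y - x0) powr s) z 0" by (simp add: s_def)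
    have "has_laplacian f z (L + (c * 0 - 0))" unfolding f_def
      by (intro has_laplacian_add has_laplacian_diff has_laplacian_cmult has_laplacian_const L 2)
    then show "\<exists>L<0. has_laplacian f z L" using L by auto
  next
    fix z assume "z \<in> K - G"
    then consider "norm (z - x0) = l" | "norm (z - x0) = R" by (auto simp: K_def G_def)
    then show "f z \<ge> 0"
    proof cases
      case 1
      then show ?thesis using bd(1)[of z] by (simp add: f_def)
    next
      case 2
      then show ?thesis using bd(2)[of z] cR by (simp add: f_def algebra_simps)
    qed
  qed
  then show "w y \<ge> c * (l powr (2 - real CARD('n)) - norm (y - x0) powr (2 - real CARD('n)))"
    by (simp add: f_def s_def algebra_simps)
qed

text \<open>Subcriticality enters here: \<open>s * q < 2\<close> means
  \<open>s * (2*q+1) < s + 4\<close>, so for \<open>\<tau> < 1\<close> the Kelvin weight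
  \<open>\<tau> powr (s + 4)\<close> is smaller than the factor by which the nonlinearity,
  homogeneous of degree \<open>2*q+1\<close>, scales.\<close>

lemma nonlinearity_compare:
  fixes A B a b \<tau> \<mu> \<beta> q s :: real
  assumes "\<mu> > 0" "\<beta> > 0" "q > 0" "s * q < 2" "0 < \<tau>" "\<tau> < 1" "a > 0" "b > 0"
    "\<tau> powr s * a \<le> A" "\<tau> powr s * b \<le> B"
  shows "\<tau> powr s * \<tau>^4 * (\<mu> * a powr (2*q+1) + \<beta> * a powr q * b powr (q+1))
     < \<mu> * A powr (2*q+1) + \<beta> * A powr q * B powr (q+1)"
proof -
  define T where "T = \<tau> powr (s * (2*q+1))"
  have "\<tau> powr s * \<tau>^4 = \<tau> powr (s + 4)"
    using assms by (simp add: powr_add)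
  also have "\<dots> < T" unfolding T_def using assms
    by (intro powr_less_mono') (auto simp: algebra_simps)
  finally have 1: "\<tau> powr s * \<tau>^4 < T" .
  have pos: "\<tau> powr s * a > 0" "\<tau> powr s * b > 0" using assms by auto
  have "T * a powr (2*q+1) = (\<tau> powr s * a) powr (2*q+1)"
    using assms by (simp add: T_def powr_mult powr_powr)
  also have "\<dots> \<le> A powr (2*q+1)" using assms pos by (intro powr_mono2) auto
  finally have 2: "T * a powr (2*q+1) \<le> A powr (2*q+1)" .
  have "T * (a powr q * b powr (q+1)) = (\<tau> powr s * a) powr q * (\<tau> powr s * b) powr (q+1)"
    using assms by (simp add: T_def powr_mult powr_powr algebra_simps flip: powr_add)
  also have "\<dots> \<le> A powr q * B powr (q+1)" using assms pos
    by (intro mult_mono powr_mono2) auto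
  finally have 3: "T * (a powr q * b powr (q+1)) \<le> A powr q * B powr (q+1)" .
  have "\<tau> powr s * \<tau>^4 * (\<mu> * a powr (2*q+1) + \<beta> * a powr q * b powr (q+1))
     < T * (\<mu> * a powr (2*q+1) + \<beta> * a powr q * b powr (q+1))"
    by (rule mult_strict_right_mono[OF 1]) (use assms in \<open>auto intro!: add_pos_pos mult_pos_pos\<close>)
  also have "\<dots> = \<mu> * (T * a powr (2*q+1)) + \<beta> * (T * (a powr q * b powr (q+1)))"
    by (simp add: algebra_simps)
  also have "\<dots> \<le> \<mu> * A powr (2*q+1) + \<beta> * (A powr q * B powr (q+1))"
    using assms 2 3 by (intro add_mono mult_left_mono) auto
  finally show ?thesis by (simp add: mult.assoc)
qed

section \<open>Moving spheres\<close>

locale coupled_system =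
  fixes \<mu>1 \<mu>2 \<beta> q :: real and u v :: "real^'n \<Rightarrow> real"
  assumes n3: "CARD('n) \<ge> 3"
    and pos: "\<mu>1 > 0" "\<mu>2 > 0" "\<beta> > 0"
    and p_low: "real CARD('n) / (real CARD('n) - 2) < 2*q+1"
    and p_up: "2*q+1 < (real CARD('n) + 2) / (real CARD('n) - 2)"
    and sol: "positive_solution \<mu>1 \<mu>2 \<beta> q u v"
begin

definition s :: real where "s = real CARD('n) - 2"

text \<open>Both components at once: superharmonicity of the difference for \<open>u\<close> uses
  the comparison for \<open>v\<close>, and conversely.\<close>

definition good :: "real^'n \<Rightarrow> real \<Rightarrow> bool" where
  "good x0 l \<longleftrightarrow> (\<forall>y. l \<le> norm (y - x0) \<longrightarrow> y \<noteq> 0 \<longrightarrow> kelvin x0 l u y \<le> u y \<and> kelvin x0 l v y \<le> v y)"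

text \<open>\<open>Q\<close> is, up to a positive factor, the radial derivative of \<open>norm (y - x0) powr (s/2) * u y\<close>.
  Its positivity between two concentric spheres is what reflection in nearby spheres requires.\<close>

definition Q :: "real^'n \<Rightarrow> real^'n \<Rightarrow> real" where
  "Q x0 y = s / 2 * u y + (\<Sum>i\<in>UNIV. (y - x0) $ i * partial_deriv i u y)"

text \<open>The following facts are proved for \<open>u\<close> only; this symmetry transfers them
  to \<open>v\<close>.\<close>

lemma swap: "coupled_system \<mu>2 \<mu>1 \<beta> q v u"
  using n3 pos p_low p_up sol by unfold_locales (auto simp: positive_solution_def)

lemma s_pos: "s > 0" using n3 by (simp add: s_def)

lemma exponents: "q > 0" "1 < s * q" "s * q < 2"
proof -
  have "s + 2 < (2*q+1) * s" using p_low s_pos by (simp add: s_def pos_divide_less_eq)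
  then show 1: "1 < s * q" by (simp add: algebra_simps)
  have "(2*q+1) * s < s + 4" using p_up s_pos by (simp add: s_def pos_less_divide_eq)
  then show "s * q < 2" by (simp add: algebra_simps)
  show "q > 0" using 1 s_pos by (metis less_trans mult_less_cancel_left_pos mult_zero_right zero_less_one)
qed

lemma C2: "C2_on (UNIV - {0}) u" "C2_on (UNIV - {0}) v"
  using sol by (auto simp: positive_solution_def)

lemma uv_pos: "x \<noteq> 0 \<Longrightarrow> u x > 0" "x \<noteq> 0 \<Longrightarrow> v x > 0"
  using sol by (auto simp: positive_solution_def)

lemma eq_u: "x \<noteq> 0 \<Longrightarrow> laplacian u x = - (\<mu>1 * u x powr (2*q+1) + \<beta> * u x powr q * v x powr (q+1))"
  using sol unfolding positive_solution_def by (metis minus_minus)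

lemma cont_u: "continuous_on (UNIV - {0}) u"
  using C2 by (auto simp: C2_on_def)

lemma isCont_u: "x \<noteq> 0 \<Longrightarrow> isCont u x"
  using cont_u continuous_on_eq_continuous_at[of "UNIV - {0}" u] by (auto simp: open_Diff)

lemma inversion_norm:
  assumes "y \<noteq> x0"
  shows "norm ((l / norm (y - x0))\<^sup>2 *\<^sub>R (y - x0)) = l\<^sup>2 / norm (y - x0)"
  using assms by (simp add: power_divide power2_eq_square)

text \<open>The exterior of the sphere is mapped into the closed ball of radius \<open>l\<close>
  around \<open>x0\<close>, which misses the origin.\<close>

lemma inversion_nonzero:
  assumes "0 < l" "l < norm x0" "l \<le> norm (y - x0)"
  shows "x0 + (l / norm (y - x0))\<^sup>2 *\<^sub>R (y - x0) \<noteq> 0"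
proof
  assume *: "x0 + (l / norm (y - x0))\<^sup>2 *\<^sub>R (y - x0) = 0"
  then have "norm x0 = norm ((l / norm (y - x0))\<^sup>2 *\<^sub>R (y - x0))"
    by (metis add_eq_0_iff2 norm_minus_cancel)
  also have "\<dots> = l\<^sup>2 / norm (y - x0)" using assms by (intro inversion_norm) auto
  also have "\<dots> \<le> l" using assms by (simp add: divide_le_eq power2_eq_square mult_left_mono)
  finally show False using assms by simp
qed

lemma cont_kelvin:
  assumes "0 < l" "l < norm x0"
  shows "continuous_on {y. l \<le> norm (y - x0)} (kelvin x0 l u)"
  unfolding kelvin_def
  by (intro continuous_intros continuous_on_compose2[OF cont_u])
     (use assms inversion_nonzero in auto)

lemma cont_kelvin_radius:
  assumes "0 < l" "l < norm x0" "l \<le> norm (y - x0)"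
  shows "isCont (\<lambda>l. kelvin x0 l u y) l"
  unfolding kelvin_def
  by (intro continuous_intros isCont_o2[OF _ isCont_u]) (use assms inversion_nonzero in auto)

text \<open>The Kelvin transform solves the equation up to the weight
  \<open>\<tau> powr s * \<tau>^4\<close>; \<open>good\<close> compares the arguments of the
  nonlinearity, and subcriticality makes the inequality strict.\<close>

lemma good_superharmonic:
  assumes l: "0 < l" "l < norm x0" and g: "good x0 l" and y: "l < norm (y - x0)" "y \<noteq> 0"
  shows "\<exists>L<0. has_laplacian (\<lambda>y. u y - kelvin x0 l u y) y L"
proof -
  define \<tau> where "\<tau> = l / norm (y - x0)"
  define y' where "y' = x0 + \<tau>\<^sup>2 *\<^sub>R (y - x0)"
  have "y \<noteq> x0" using y l by auto
  have y': "y' \<noteq> 0" using inversion_nonzero[OF l, of y] y by (simp add: y'_def \<tau>_def)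
  have "has_laplacian u y (laplacian u y)"
    by (rule has_laplacian_C2[OF C2(1)]) (use y in \<open>auto simp: open_Diff\<close>)
  moreover have "has_laplacian (kelvin x0 l u) y (\<tau> powr s * \<tau>^4 * laplacian u y')"
    using kelvin_has_laplacian[OF C2(1) _ \<open>y \<noteq> x0\<close>, of l] y' y l
    by (auto simp: y'_def \<tau>_def s_def open_Diff)
  ultimately have "has_laplacian (\<lambda>y. u y - kelvin x0 l u y) y (laplacian u y - \<tau> powr s * \<tau>^4 * laplacian u y')"
    by (rule has_laplacian_diff)
  moreover have less: "\<tau> powr s * \<tau>^4 * (\<mu>1 * u y' powr (2*q+1) + \<beta> * u y' powr q * v y' powr (q+1))
     < \<mu>1 * u y powr (2*q+1) + \<beta> * u y powr q * v y powr (q+1)"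
  proof (rule nonlinearity_compare)
    have "norm (y - x0) > 0" using l y by linarith
    then show "0 < \<tau>" "\<tau> < 1" using l y by (simp_all add: \<tau>_def)
    have "kelvin x0 l u y \<le> u y" "kelvin x0 l v y \<le> v y" using g y by (auto simp: good_def)
    then show "\<tau> powr s * u y' \<le> u y" "\<tau> powr s * v y' \<le> v y"
      by (simp_all add: kelvin_def \<tau>_def y'_def s_def)
  qed (use pos exponents uv_pos y' in auto)
  moreover from less have "laplacian u y - \<tau> powr s * \<tau>^4 * laplacian u y' < 0"
    unfolding eq_u[OF y'] eq_u[OF y(2)] mult_minus_right by linarith
  ultimately show ?thesis by blast
qed

text \<open>A zero of the nonnegative difference would be a local minimum in an open set, where the
  Laplacian is negative.\<close>

lemma good_strict:
  assumes l: "0 < l" "l < norm x0" and g: "good x0 l" and y: "l < norm (y - x0)" "y \<noteq> 0"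
  shows "u y - kelvin x0 l u y > 0"
proof (rule ccontr)
  assume *: "\<not> u y - kelvin x0 l u y > 0"
  obtain L where L: "L < 0" "has_laplacian (\<lambda>y. u y - kelvin x0 l u y) y L"
    using good_superharmonic[OF assms] by blast
  have "open {z. l < norm (z - x0) \<and> z \<noteq> 0}"
    by (intro open_Collect_conj open_Collect_less open_Collect_neq continuous_intros)
  then have "\<forall>\<^sub>F z in nhds y. z \<in> {z. l < norm (z - x0) \<and> z \<noteq> 0}"
    by (rule eventually_nhds_in_open) (use y in auto)
  then have "\<forall>\<^sub>F z in nhds y. u y - kelvin x0 l u y \<le> u z - kelvin x0 l u z"
  proof eventually_elim
    case (elim z)
    then have "kelvin x0 l u z \<le> u z" using g by (simp add: good_def)
    then show ?case using * by linarith
  qed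
  from has_laplacian_local_min[OF L(2) this] L show False by simp
qed

lemma DERIV_radial:
  assumes "x0 + t *\<^sub>R \<theta> \<noteq> 0"
  shows "((\<lambda>t. u (x0 + t *\<^sub>R \<theta>)) has_real_derivative
     (\<Sum>i\<in>UNIV. \<theta> $ i * partial_deriv i u (x0 + t *\<^sub>R \<theta>))) (at t)"
proof -
  have "((\<lambda>t. x0 + t *\<^sub>R \<theta>) has_derivative (\<lambda>s. s *\<^sub>R \<theta>)) (at t)"
    by (auto intro!: derivative_eq_intros)
  from has_derivative_compose[OF this C2_on_has_derivative[OF C2(1)]] assms
  have "((\<lambda>t. u (x0 + t *\<^sub>R \<theta>)) has_derivative
      (\<lambda>s. \<Sum>i\<in>UNIV. (s *\<^sub>R \<theta>) $ i * partial_deriv i u (x0 + t *\<^sub>R \<theta>))) (at t)"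
    by (simp add: open_Diff)
  then show ?thesis unfolding has_field_derivative_def
    by (rule has_derivative_eq_rhs) (simp add: fun_eq_iff sum_distrib_left mult_ac)
qed

lemma Q_eq: "Q x0 (x0 + t *\<^sub>R \<theta>) = s / 2 * u (x0 + t *\<^sub>R \<theta>) +
    t * (\<Sum>i\<in>UNIV. \<theta> $ i * partial_deriv i u (x0 + t *\<^sub>R \<theta>))"
  by (simp add: Q_def sum_distrib_left mult_ac)

lemma cont_Q: "continuous_on (UNIV - {0}) (Q x0)"
  unfolding Q_def using C2 by (intro continuous_intros cont_u) (auto simp: C2_on_def)

text \<open>On the ray through \<open>y\<close> the inversion sends the radius \<open>\<rho>\<close>
  to \<open>l\<^sup>2 / \<rho>\<close>, and the claim is
  \<open>G (l\<^sup>2 / \<rho>) \<le> G \<rho>\<close> for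
  \<open>G t = t powr (s / 2) * u (x0 + t *\<^sub>R \<theta>)\<close>, whose derivative is a
  positive multiple of \<open>Q\<close>.\<close>

lemma kelvin_le_near:
  assumes l: "0 < l" "l \<le> norm (y - x0)"
    and Q: "\<And>z. l\<^sup>2 / norm (y - x0) \<le> norm (z - x0) \<Longrightarrow> norm (z - x0) \<le> norm (y - x0) \<Longrightarrow> z \<noteq> 0 \<and> Q x0 z > 0"
  shows "kelvin x0 l u y \<le> u y"
proof -
  define \<rho> where "\<rho> = norm (y - x0)"
  define \<theta> where "\<theta> = (1 / \<rho>) *\<^sub>R (y - x0)"
  define G where "G t = t powr (s / 2) * u (x0 + t *\<^sub>R \<theta>)" for t
  have \<rho>: "\<rho> > 0" "l \<le> \<rho>" using l by (auto simp: \<rho>_def)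
  have \<theta>: "norm \<theta> = 1" using \<rho> by (simp add: \<theta>_def) (simp add: \<rho>_def)
  have le: "l\<^sup>2 / \<rho> \<le> \<rho>" using l \<rho> by (simp add: divide_le_eq power2_eq_square mult_mono)
  have "G (l\<^sup>2 / \<rho>) \<le> G \<rho>"
  proof (rule DERIV_nonneg_imp_nondecreasing[OF le])
    fix t assume t: "l\<^sup>2 / \<rho> \<le> t" "t \<le> \<rho>"
    have "0 < l\<^sup>2 / \<rho>" using l \<rho> by simp
    then have t0: "t > 0" using t by linarith
    have z: "x0 + t *\<^sub>R \<theta> \<noteq> 0" "Q x0 (x0 + t *\<^sub>R \<theta>) > 0"
      using Q[of "x0 + t *\<^sub>R \<theta>"] t t0 \<theta> by (auto simp: \<rho>_def)
    have tp: "t powr (s / 2) = t * t powr (s / 2 - 1)" using t0 by (simp add: powr_diff)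
    have "(G has_real_derivative t powr (s / 2 - 1) * Q x0 (x0 + t *\<^sub>R \<theta>)) (at t)"
      unfolding G_def
      by (rule DERIV_cong[OF DERIV_mult[OF has_real_derivative_powr[OF t0] DERIV_radial[OF z(1)]]])
         (simp add: Q_eq tp algebra_simps)
    then show "\<exists>d. (G has_real_derivative d) (at t) \<and> 0 \<le> d"
      using z(2) by (intro exI conjI) (auto intro!: mult_nonneg_nonneg)
  qed
  moreover have "x0 + \<rho> *\<^sub>R \<theta> = y" using \<rho> by (simp add: \<theta>_def)
  moreover have "x0 + (l\<^sup>2 / \<rho>) *\<^sub>R \<theta> = x0 + (l / \<rho>)\<^sup>2 *\<^sub>R (y - x0)"
    by (simp add: \<theta>_def power2_eq_square)
  ultimately have "(l\<^sup>2 / \<rho>) powr (s/2) * u (x0 + (l / \<rho>)\<^sup>2 *\<^sub>R (y - x0)) \<le> \<rho> powr (s/2) * u y"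
    by (simp add: G_def)
  then have "(l\<^sup>2 / \<rho>) powr (s/2) / \<rho> powr (s/2) * u (x0 + (l / \<rho>)\<^sup>2 *\<^sub>R (y - x0)) \<le> u y"
    using \<rho> by (simp add: field_simps)
  moreover have "(l\<^sup>2 / \<rho>) powr (s/2) / \<rho> powr (s/2) = ((l / \<rho>)\<^sup>2) powr (s/2)"
    using \<rho> l by (simp add: power2_eq_square flip: powr_divide)
  moreover have "\<dots> = (l / \<rho>) powr s" using \<rho> l by (intro powr_half_sq) auto
  ultimately have "(l / \<rho>) powr s * u (x0 + (l / \<rho>)\<^sup>2 *\<^sub>R (y - x0)) \<le> u y"
    by (simp only:)
  then show ?thesis by (simp add: kelvin_def \<rho>_def s_def)
qed

lemma u_superharmonic: "y \<noteq> 0 \<Longrightarrow> \<exists>L<0. has_laplacian u y L"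
proof (intro exI conjI)
  assume y: "y \<noteq> 0"
  show "has_laplacian u y (laplacian u y)"
    by (rule has_laplacian_C2[OF C2(1)]) (use y in \<open>auto simp: open_Diff\<close>)
  have "\<mu>1 * u y powr (2*q+1) + \<beta> * u y powr q * v y powr (q+1) > 0"
    using uv_pos(1)[OF y] uv_pos(2)[OF y] pos by (intro add_pos_pos mult_pos_pos) auto
  then show "laplacian u y < 0" using eq_u[OF y] by simp
qed

lemma sphere_inf:
  fixes f :: "real^'n \<Rightarrow> real"
  assumes "continuous_on (sphere x0 r) f" "\<And>y. norm (y - x0) = r \<Longrightarrow> f y > 0"
  obtains m where "m > 0" "\<And>y. norm (y - x0) = r \<Longrightarrow> m \<le> f y"
proof (cases "sphere x0 r = {}")
  case True
  show ?thesis by (rule that[of 1]) (use True in \<open>auto simp: dist_norm norm_minus_commute\<close>)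
next
  case False
  obtain z where "z \<in> sphere x0 r" "\<And>y. y \<in> sphere x0 r \<Longrightarrow> f z \<le> f y"
    using continuous_attains_inf[OF compact_sphere False assms(1)] by blast
  then show ?thesis using assms(2)[of z]
    by (intro that[of "f z"]) (auto simp: dist_norm norm_minus_commute)
qed

text \<open>Inside a small ball \<open>Q\<close> is positive, since
  \<open>Q x0 x0 = s / 2 * u x0\<close>. Outside it, \<open>u\<close> has the lower bound of
  \<open>exterior_barrier\<close>, and the Kelvin transform carries the small factor
  \<open>l powr s\<close>.\<close>

lemma moving_spheres_start:
  assumes x0: "x0 \<noteq> 0"
  obtains l0 where "0 < l0" "l0 < norm x0"
    "\<And>l y. 0 < l \<Longrightarrow> l < l0 \<Longrightarrow> l \<le> norm (y - x0) \<Longrightarrow> y \<noteq> 0 \<Longrightarrow> kelvin x0 l u y \<le> u y"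
proof -
  have "isCont (Q x0) x0" using cont_Q[of x0] x0 by (simp add: continuous_on_eq_continuous_at open_Diff)
  moreover have "Q x0 x0 > 0" using uv_pos(1)[OF x0] s_pos by (simp add: Q_def)
  ultimately have "\<forall>\<^sub>F z in nhds x0. Q x0 z > 0"
    unfolding isCont_def tendsto_at_iff_tendsto_nhds by (rule order_tendstoD)
  then obtain d where d: "d > 0" "\<And>z. norm (z - x0) < d \<Longrightarrow> Q x0 z > 0"
    unfolding eventually_nhds_metric by (auto simp: dist_norm)
  define r where "r = min d (norm x0) / 2"
  have r: "0 < r" "r < d" "r < norm x0" using d x0 by (auto simp: r_def min_def)
  have ne: "z \<noteq> 0" if "norm (z - x0) \<le> r" for z using that r by auto
  have sub: "cball x0 r \<subseteq> UNIV - {0}" using r by (auto simp: dist_norm norm_minus_commute)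
  have "continuous_on (sphere x0 r) u"
    by (rule continuous_on_subset[OF cont_u]) (use sub sphere_cball in blast)
  moreover have "u y > 0" if "norm (y - x0) = r" for y using that ne uv_pos by auto
  ultimately obtain m where m: "m > 0" "\<And>y. norm (y - x0) = r \<Longrightarrow> m \<le> u y"
    using sphere_inf by blast
  have far: "m * (r / norm (y - x0)) powr s \<le> u y" if "r \<le> norm (y - x0)" "y \<noteq> 0" for y
    unfolding s_def
  proof (rule exterior_barrier[OF n3 r(1,3)])
    show "continuous_on {y. r \<le> norm (y - x0) \<and> y \<noteq> 0} u"
      by (rule continuous_on_subset[OF cont_u]) auto
    show "u y \<ge> 0" if "y \<noteq> 0" for y using uv_pos(1)[OF that] by simp
  qed (use m u_superharmonic that in auto)
  obtain x1 where x1: "x1 \<in> cball x0 r" "\<And>y. y \<in> cball x0 r \<Longrightarrow> u y \<le> u x1"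
    using continuous_attains_sup[OF compact_cball _ continuous_on_subset[OF cont_u sub]] r by auto
  define M where "M = u x1"
  have "x1 \<noteq> 0" using x1(1) sub by blast
  then have M: "M > 0" using uv_pos by (simp add: M_def)
  \<comment> \<open>Outside the ball the Kelvin transform is at most
    \<open>(l / norm (y - x0)) powr s * M\<close> and \<open>u\<close> is at least
    \<open>m * (r / norm (y - x0)) powr s\<close>; the second entry of the minimum makes these
    bounds meet.\<close>
  define l0 where "l0 = min r (r * (m / M) powr (1 / s))"
  have l0: "0 < l0" "l0 \<le> r" using r m M by (auto simp: l0_def)
  show ?thesis
  proof (rule that[of l0])
    show "0 < l0" "l0 < norm x0" using l0 r by auto
    fix l y assume l: "0 < l" "l < l0" "l \<le> norm (y - x0)" "y \<noteq> 0"
    show "kelvin x0 l u y \<le> u y"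
    proof (cases "norm (y - x0) \<le> r")
      case True
      show ?thesis by (rule kelvin_le_near) (use l True d r ne in auto)
    next
      case False
      define y' where "y' = x0 + (l / norm (y - x0))\<^sup>2 *\<^sub>R (y - x0)"
      have "norm (y' - x0) = l\<^sup>2 / norm (y - x0)" unfolding y'_def
        unfolding add_diff_cancel_left' by (rule inversion_norm) (use l in auto)
      also have "\<dots> \<le> l" using l by (simp add: divide_le_eq power2_eq_square mult_left_mono)
      also have "l \<le> r" using l l0 by simp
      finally have "u y' \<le> M" unfolding M_def by (intro x1) (simp add: dist_norm norm_minus_commute)
      then have "kelvin x0 l u y \<le> (l / norm (y - x0)) powr s * M"
        by (simp add: kelvin_def y'_def s_def mult_left_mono)
      also have "\<dots> \<le> (r * (m / M) powr (1 / s) / norm (y - x0)) powr s * M"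
        using l M s_pos by (intro mult_right_mono powr_mono2 divide_right_mono) (auto simp: l0_def)
      also have "\<dots> = m * (r / norm (y - x0)) powr s"
        using r m M s_pos False by (simp add: powr_divide powr_mult powr_powr)
      also have "\<dots> \<le> u y" using far False l by simp
      finally show ?thesis .
    qed
  qed
qed

text \<open>The Hopf lemma: the inversion makes the radial derivative of \<open>u - kelvin x0 l u\<close> on the sphere
  equal to \<open>2 / l * Q\<close>.\<close>

lemma hopf:
  assumes l: "0 < l" "l < norm x0" and g: "good x0 l" and z: "norm (z - x0) = l"
  shows "Q x0 z > 0"
proof -
  define w where "w y = u y - kelvin x0 l u y" for y
  define R where "R = (l + norm x0) / 2"
  have R: "l < R" "R < norm x0" "R > 0" using l by (auto simp: R_def)
  have ne: "y \<noteq> 0" if "norm (y - x0) \<le> R" for y using that R by auto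
  have contw: "continuous_on {y. l \<le> norm (y - x0) \<and> norm (y - x0) \<le> R} w"
    unfolding w_def
    by (intro continuous_intros continuous_on_subset[OF cont_u] continuous_on_subset[OF cont_kelvin[OF l]])
       (use R in auto)
  have "continuous_on (sphere x0 R) w"
    by (rule continuous_on_subset[OF contw]) (use R in \<open>auto simp: dist_norm norm_minus_commute\<close>)
  moreover have "w y > 0" if "norm (y - x0) = R" for y
    unfolding w_def by (rule good_strict[OF l g]) (use that R ne in auto)
  ultimately obtain m where m: "m > 0" "\<And>y. norm (y - x0) = R \<Longrightarrow> m \<le> w y"
    using sphere_inf by blast
  have w0: "w y = 0" if "norm (y - x0) = l" for y
    using that l by (simp add: w_def kelvin_def)
  obtain c where c: "c > 0" "\<And>y. l \<le> norm (y - x0) \<Longrightarrow> norm (y - x0) \<le> R \<Longrightarrow>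
     w y \<ge> c * (l powr (2 - real CARD('n)) - norm (y - x0) powr (2 - real CARD('n)))"
  proof (rule annulus_barrier[OF n3 l(1) R(1) m(1) contw])
    fix y assume "l < norm (y - x0)" "norm (y - x0) < R"
    then show "\<exists>L<0. has_laplacian w y L"
      unfolding w_def[abs_def] using good_superharmonic[OF l g, of y] ne by auto
  qed (use m w0 in auto)
  define \<theta> where "\<theta> = (1 / l) *\<^sub>R (z - x0)"
  have \<theta>: "norm \<theta> = 1" using z l by (simp add: \<theta>_def)
  have zl: "x0 + l *\<^sub>R \<theta> = z" using l by (simp add: \<theta>_def)
  have z0: "z \<noteq> 0" using z R ne[of z] by auto
  define D where "D = (\<Sum>i\<in>UNIV. \<theta> $ i * partial_deriv i u z)"
  \<comment> \<open>The difference on the ray minus the annulus barrier. It vanishes at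
    \<open>l\<close> and is nonnegative beyond, so its derivative at \<open>l\<close> cannot be
    negative; the slope of the barrier then gives strict positivity.\<close>
  define F where "F t = u (x0 + t *\<^sub>R \<theta>) - (l / t) powr s * u (x0 + (l\<^sup>2 / t) *\<^sub>R \<theta>)
     - c * (l powr (-s) - t powr (-s))" for t
  have Fnn: "F t \<ge> 0" if "l \<le> t" "t \<le> R" for t
  proof -
    have t: "t > 0" using that l by simp
    have nt: "norm ((x0 + t *\<^sub>R \<theta>) - x0) = t" using \<theta> t by simp
    have "(l / t)\<^sup>2 * t = l\<^sup>2 / t"
      using t by (simp add: power2_eq_square)
    then have "w (x0 + t *\<^sub>R \<theta>) = u (x0 + t *\<^sub>R \<theta>) - (l / t) powr s * u (x0 + (l\<^sup>2 / t) *\<^sub>R \<theta>)"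
      using nt by (simp add: w_def kelvin_def s_def)
    then show ?thesis using c(2)[of "x0 + t *\<^sub>R \<theta>"] nt that by (simp add: F_def s_def)
  qed
  have F0: "F l = 0" using l by (simp add: F_def power2_eq_square)
  have D1: "((\<lambda>t. u (x0 + t *\<^sub>R \<theta>)) has_real_derivative D) (at l)"
    using DERIV_radial[of x0 l \<theta>] z0 by (simp add: zl D_def)
  have D2: "((\<lambda>t. l\<^sup>2 / t) has_real_derivative -1) (at l)"
    using l by (auto intro!: derivative_eq_intros simp: power2_eq_square)
  \<comment> \<open>The map \<open>t \<mapsto> l\<^sup>2 / t\<close> fixes \<open>l\<close> with
    slope -1, so the reflected term contributes \<open>D\<close> a second time.\<close>
  have D3: "((\<lambda>t. u (x0 + (l\<^sup>2 / t) *\<^sub>R \<theta>)) has_real_derivative D * -1) (at l)"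
    by (rule DERIV_chain2[of "\<lambda>t. u (x0 + t *\<^sub>R \<theta>)" _ "\<lambda>t. l\<^sup>2 / t", OF _ D2])
       (use D1 l in \<open>simp add: power2_eq_square\<close>)
  have D4: "((\<lambda>t. l / t) has_real_derivative - (1 / l)) (at l)"
    using l by (auto intro!: derivative_eq_intros simp: power2_eq_square)
  have D5: "((\<lambda>t. (l / t) powr s) has_real_derivative - (s / l)) (at l)"
    using DERIV_powr[OF D4 _ DERIV_const[of s]] l by simp
  have D6: "((\<lambda>t. t powr (-s)) has_real_derivative (-s) * l powr (-s - 1)) (at l)"
    by (rule has_real_derivative_powr[OF l(1)])
  have "(F has_real_derivative D - (- (s / l) * u z + D * -1 * 1) - c * (0 - (-s) * l powr (-s - 1))) (at l)"
    unfolding F_def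
    by (rule DERIV_cong[OF DERIV_diff[OF DERIV_diff[OF D1 DERIV_mult[OF D5 D3]]
        DERIV_cmult[OF DERIV_diff[OF DERIV_const D6]]]])
       (use l in \<open>simp add: power2_eq_square zl\<close>)
  then have dF: "(F has_real_derivative 2 * D + s / l * u z - c * s * l powr (-s - 1)) (at l)"
    by (rule DERIV_cong) simp
  have "2 * D + s / l * u z - c * s * l powr (-s - 1) \<ge> 0"
  proof (rule ccontr)
    assume "\<not> ?thesis"
    then obtain d where d: "d > 0" "\<And>h. 0 < h \<Longrightarrow> h < d \<Longrightarrow> F (l + h) < F l"
      using DERIV_neg_dec_right[OF dF] by force
    define h where "h = min d (R - l) / 2"
    have "0 < h" "h < d" "l + h \<le> R" using d R by (auto simp: h_def min_def field_simps)
    then show False using d(2)[of h] Fnn[of "l + h"] F0 by simp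
  qed
  moreover have "c * s * l powr (-s - 1) > 0" using c s_pos l by simp
  ultimately have "2 * D + s / l * u z > 0" by simp
  then have "(l / 2) * (2 * D + s / l * u z) > 0" using l by (intro mult_pos_pos) auto
  then have "s / 2 * u z + l * D > 0" using l by (simp add: algebra_simps)
  moreover have "Q x0 z = s / 2 * u z + l * D" using Q_eq[of x0 l \<theta>] by (simp add: zl D_def)
  ultimately show ?thesis by simp
qed

text \<open>The points of a closed annulus at which \<open>Q\<close> is not positive form a compact
  set \<open>N\<close>. By \<open>hopf\<close> it misses the sphere, hence keeps a positive distance
  in radius.\<close>

lemma Q_pos_near_sphere:
  assumes l: "0 < l" "l < norm x0" and g: "good x0 l"
  obtains \<delta> where "\<delta> > 0" "\<delta> < l" "l + \<delta> < norm x0"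
    "\<And>z. l - \<delta> \<le> norm (z - x0) \<Longrightarrow> norm (z - x0) \<le> l + \<delta> \<Longrightarrow> z \<noteq> 0 \<and> Q x0 z > 0"
proof -
  define d0 where "d0 = min l (norm x0 - l) / 2"
  have d0: "d0 > 0" "d0 < l" "l + d0 < norm x0" using l by (auto simp: d0_def min_def field_simps)
  define A where "A = {z. \<bar>norm (z - x0) - l\<bar> \<le> d0}"
  have ne: "z \<noteq> 0" if "z \<in> A" for z using that d0 by (auto simp: A_def)
  have clA: "closed A" unfolding A_def by (intro closed_Collect_le continuous_intros)
  have bA: "bounded A"
  proof (rule boundedI)
    fix z assume "z \<in> A"
    then show "norm z \<le> l + d0 + norm x0" using norm_triangle_ineq2[of z x0] by (simp add: A_def)
  qed
  have contA: "continuous_on A (Q x0)" by (rule continuous_on_subset[OF cont_Q]) (use ne in auto)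
  define N where "N = {z \<in> A. Q x0 z \<in> {..0}}"
  have "closed N" unfolding N_def
    by (rule continuous_closed_preimage[OF contA clA, simplified vimage_def Int_def, simplified]) auto
  moreover have "bounded N" by (rule bounded_subset[OF bA]) (auto simp: N_def)
  ultimately have cN: "compact N" by (simp add: compact_eq_bounded_closed)
  have "\<exists>\<eta>>0. \<forall>z\<in>N. \<eta> \<le> \<bar>norm (z - x0) - l\<bar>"
  proof (cases "N = {}")
    case False
    have "continuous_on N (\<lambda>z. \<bar>norm (z - x0) - l\<bar>)" by (intro continuous_intros)
    then obtain z1 where z1: "z1 \<in> N" "\<And>z. z \<in> N \<Longrightarrow> \<bar>norm (z1 - x0) - l\<bar> \<le> \<bar>norm (z - x0) - l\<bar>"
      using continuous_attains_inf[OF cN False] by blast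
    have "norm (z1 - x0) \<noteq> l" using hopf[OF l g, of z1] z1(1) by (auto simp: N_def)
    then show ?thesis using z1 by (intro exI[of _ "\<bar>norm (z1 - x0) - l\<bar>"]) auto
  qed (auto intro: exI[of _ 1])
  then obtain \<eta> where \<eta>: "\<eta> > 0" "\<And>z. z \<in> N \<Longrightarrow> \<eta> \<le> \<bar>norm (z - x0) - l\<bar>" by blast
  show ?thesis
  proof (rule that[of "min d0 (\<eta> / 2)"])
    fix z assume z: "l - min d0 (\<eta> / 2) \<le> norm (z - x0)" "norm (z - x0) \<le> l + min d0 (\<eta> / 2)"
    then have "z \<in> A" "\<bar>norm (z - x0) - l\<bar> < \<eta>" using \<eta>(1) by (auto simp: A_def min_def split: if_splits)
    then show "z \<noteq> 0 \<and> Q x0 z > 0" using ne \<eta>(2)[of z] by (force simp: N_def)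
  qed (use d0 \<eta> in auto)
qed

text \<open>Close to the sphere, positivity of \<open>Q\<close> gives the comparison for every
  slightly larger radius. Far away, the reserve \<open>m * (R / norm (y - x0)) powr s\<close> left
  at radius \<open>l\<close> absorbs the change of the Kelvin transform with the radius.\<close>

lemma moving_spheres_step:
  assumes l: "0 < l" "l < norm x0" and g: "good x0 l"
  obtains \<epsilon> where "\<epsilon> > 0"
    "\<And>l' y. l \<le> l' \<Longrightarrow> l' < l + \<epsilon> \<Longrightarrow> l' \<le> norm (y - x0) \<Longrightarrow> y \<noteq> 0 \<Longrightarrow> kelvin x0 l' u y \<le> u y"
proof -
  obtain \<delta> where \<delta>: "\<delta> > 0" "\<delta> < l" "l + \<delta> < norm x0"
    "\<And>z. l - \<delta> \<le> norm (z - x0) \<Longrightarrow> norm (z - x0) \<le> l + \<delta> \<Longrightarrow> z \<noteq> 0 \<and> Q x0 z > 0"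
    using Q_pos_near_sphere[OF assms] by blast
  define R where "R = l + \<delta>"
  have R: "l < R" "R < norm x0" "R > 0" using \<delta> l by (auto simp: R_def)
  define w where "w y = u y - kelvin x0 l u y" for y
  have ne: "y \<noteq> 0" if "norm (y - x0) \<le> R" for y using that R by auto
  have contw: "continuous_on {y. R \<le> norm (y - x0) \<and> y \<noteq> 0} w"
    unfolding w_def
    by (intro continuous_intros continuous_on_subset[OF cont_u] continuous_on_subset[OF cont_kelvin[OF l]])
       (use R in auto)
  have "continuous_on (sphere x0 R) w"
    by (rule continuous_on_subset[OF contw]) (use R in \<open>auto simp: dist_norm norm_minus_commute\<close>)
  moreover have "w y > 0" if "norm (y - x0) = R" for y
    unfolding w_def by (rule good_strict[OF l g]) (use that R ne in auto)
  ultimately obtain m where m: "m > 0" "\<And>y. norm (y - x0) = R \<Longrightarrow> m \<le> w y"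
    using sphere_inf by blast
  have far: "m * (R / norm (y - x0)) powr s \<le> w y" if "R \<le> norm (y - x0)" "y \<noteq> 0" for y
    unfolding s_def
  proof (rule exterior_barrier[OF n3 R(3,2) _ contw])
    show "m \<ge> 0" using m by simp
    show "w y \<ge> 0" if "R \<le> norm (y - x0)" "y \<noteq> 0" for y
      using good_strict[OF l g, of y] that R by (simp add: w_def)
    show "\<exists>L<0. has_laplacian w y L" if "R < norm (y - x0)" "y \<noteq> 0" for y
      unfolding w_def[abs_def] by (rule good_superharmonic[OF l g]) (use that R in auto)
  qed (use m that in auto)
  \<comment> \<open>With \<open>\<zeta> = (y - x0) / (norm (y - x0))\<^sup>2\<close> the Kelvin
    transform is \<open>\<Psi> (t, \<zeta>)\<close> divided by \<open>norm (y - x0) powr s\<close>.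
    The unbounded exterior becomes the ball of radius \<open>1 / R\<close>, so the dependence on the
    radius is uniform by compactness.\<close>
  define \<Psi> where "\<Psi> p = fst p powr s * u (x0 + (fst p)\<^sup>2 *\<^sub>R snd p)" for p :: "real \<times> (real^'n)"
  define K where "K = {l..R} \<times> cball (0::real^'n) (1 / R)"
  have "continuous_on K (\<lambda>p. fst p powr s)"
    by (intro continuous_intros) (use l in \<open>auto simp: K_def\<close>)
  moreover have "continuous_on K (\<lambda>p. u (x0 + (fst p)\<^sup>2 *\<^sub>R snd p))"
  proof (rule continuous_on_compose2[OF cont_u])
    show "continuous_on K (\<lambda>p. x0 + (fst p)\<^sup>2 *\<^sub>R snd p)" by (intro continuous_intros)
    have "x0 + t\<^sup>2 *\<^sub>R \<zeta> \<noteq> 0" if tz: "(t, \<zeta>) \<in> K" for t \<zeta>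
    proof
      assume "x0 + t\<^sup>2 *\<^sub>R \<zeta> = 0"
      then have "norm x0 = norm (t\<^sup>2 *\<^sub>R \<zeta>)" by (metis add_eq_0_iff2 norm_minus_cancel)
      also have "\<dots> = t\<^sup>2 * norm \<zeta>" by simp
      also have "\<dots> \<le> R\<^sup>2 * (1 / R)" using tz l by (intro mult_mono power_mono) (auto simp: K_def)
      also have "\<dots> = R" using R by (simp add: power2_eq_square)
      finally show False using R by simp
    qed
    then show "(\<lambda>p. x0 + (fst p)\<^sup>2 *\<^sub>R snd p) ` K \<subseteq> UNIV - {0}" by auto
  qed
  ultimately have "continuous_on K \<Psi>" unfolding \<Psi>_def by (rule continuous_on_mult)
  moreover have "compact K" unfolding K_def by (intro compact_Times compact_cball) auto
  ultimately have "uniformly_continuous_on K \<Psi>" by (rule compact_uniformly_continuous)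
  moreover have "m * R powr s > 0" using m R by simp
  ultimately obtain e where e: "e > 0"
    "\<And>p p'. p \<in> K \<Longrightarrow> p' \<in> K \<Longrightarrow> dist p' p < e \<Longrightarrow> dist (\<Psi> p') (\<Psi> p) < m * R powr s"
    unfolding uniformly_continuous_on_def by metis
  show ?thesis
  proof (rule that[of "min e \<delta>"])
    show "min e \<delta> > 0" using e \<delta> by simp
    fix l' y assume l': "l \<le> l'" "l' < l + min e \<delta>" "l' \<le> norm (y - x0)" "y \<noteq> 0"
    define \<rho> where "\<rho> = norm (y - x0)"
    have \<rho>: "\<rho> > 0" "l' \<le> \<rho>" "l' > 0" using l' l by (auto simp: \<rho>_def)
    show "kelvin x0 l' u y \<le> u y"
    proof (cases "\<rho> \<le> R")
      case True
      show ?thesis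
      proof (rule kelvin_le_near)
        fix z assume z: "l'\<^sup>2 / norm (y - x0) \<le> norm (z - x0)" "norm (z - x0) \<le> norm (y - x0)"
        \<comment> \<open>The reflected radius \<open>l'\<^sup>2 / \<rho>\<close> stays above
          \<open>l - \<delta>\<close>, so the whole segment between \<open>y\<close> and its image
          lies where \<open>Q\<close> is positive.\<close>
        have "(l - \<delta>) * (l + \<delta>) = l\<^sup>2 - \<delta>\<^sup>2" by (simp add: algebra_simps power2_eq_square)
        also have "\<dots> \<le> l'\<^sup>2" using power_mono[of l l' 2] l l' zero_le_power2[of \<delta>] by linarith
        finally have "(l - \<delta>) * (l + \<delta>) \<le> l'\<^sup>2" .
        then have "l - \<delta> \<le> l'\<^sup>2 / R" using R by (simp add: R_def pos_le_divide_eq)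
        also have "\<dots> \<le> l'\<^sup>2 / \<rho>" using True \<rho> by (simp add: frac_le)
        finally show "z \<noteq> 0 \<and> Q x0 z > 0" using z True \<delta>(4)[of z] by (simp add: \<rho>_def R_def)
      qed (use l' l in auto)
    next
      case False
      define \<zeta> where "\<zeta> = (1 / \<rho>\<^sup>2) *\<^sub>R (y - x0)"
      have "norm \<zeta> = 1 / \<rho>" using \<rho> by (simp add: \<zeta>_def \<rho>_def power2_eq_square)
      then have n\<zeta>: "norm \<zeta> \<le> 1 / R" using False R by (simp add: frac_le)
      have k: "kelvin x0 t u y = \<Psi> (t, \<zeta>) / \<rho> powr s" if "t > 0" for t
        using that \<rho> by (simp add: kelvin_def \<Psi>_def \<zeta>_def s_def powr_divide power_divide flip: \<rho>_def)
      have "dist (\<Psi> (l', \<zeta>)) (\<Psi> (l, \<zeta>)) < m * R powr s"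
        by (rule e(2)) (use l' n\<zeta> R \<delta> in \<open>auto simp: K_def R_def dist_prod_def dist_real_def\<close>)
      then have "\<Psi> (l', \<zeta>) / \<rho> powr s \<le> (\<Psi> (l, \<zeta>) + m * R powr s) / \<rho> powr s"
        by (intro divide_right_mono) (auto simp: dist_real_def)
      also have "\<dots> = kelvin x0 l u y + m * (R / \<rho>) powr s"
        using \<rho> R by (simp add: k l add_divide_distrib powr_divide)
      also have "\<dots> \<le> u y" using far[of y] False l' by (simp add: \<rho>_def w_def)
      finally show ?thesis by (simp add: k \<rho>)
    qed
  qed
qed

text \<open>Continuity in the radius: at the supremum \<open>T\<close> goodness survives as a limit
  from the left, and if \<open>T\<close> were below \<open>norm x0\<close>, the steps for
  \<open>u\<close> and \<open>v\<close> would carry both comparisons past it.\<close>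

lemma good_all:
  assumes l: "0 < l" "l < norm x0"
  shows "good x0 l"
proof -
  interpret sw: coupled_system \<mu>2 \<mu>1 \<beta> q v u by (rule swap)
  have good_sw: "sw.good x0 l \<longleftrightarrow> good x0 l" for l by (auto simp: good_def sw.good_def)
  have x0: "x0 \<noteq> 0" using l by auto
  define P where "P t \<longleftrightarrow> (\<forall>l. 0 < l \<longrightarrow> l < t \<longrightarrow> good x0 l)" for t
  obtain l1 where l1: "0 < l1" "l1 < norm x0"
    "\<And>l y. 0 < l \<Longrightarrow> l < l1 \<Longrightarrow> l \<le> norm (y - x0) \<Longrightarrow> y \<noteq> 0 \<Longrightarrow> kelvin x0 l u y \<le> u y"
    using moving_spheres_start[OF x0] by blast
  obtain l2 where l2: "0 < l2" "l2 < norm x0"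
    "\<And>l y. 0 < l \<Longrightarrow> l < l2 \<Longrightarrow> l \<le> norm (y - x0) \<Longrightarrow> y \<noteq> 0 \<Longrightarrow> kelvin x0 l v y \<le> v y"
    using sw.moving_spheres_start[OF x0] by blast
  define T where "T = Sup {t. t \<le> norm x0 \<and> P t}"
  have P0: "P (min l1 l2)" using l1 l2 by (auto simp: P_def good_def)
  have bdd: "bdd_above {t. t \<le> norm x0 \<and> P t}" by (auto intro: bdd_aboveI[of _ "norm x0"])
  have "min l1 l2 \<le> T"
    unfolding T_def by (rule cSup_upper[OF _ bdd]) (use P0 l1 in auto)
  then have T0: "T > 0" using l1 l2 by simp
  have TP: "P T" unfolding P_def
  proof (intro allI impI)
    fix l assume "0 < l" "l < T"
    moreover have "{t. t \<le> norm x0 \<and> P t} \<noteq> {}" using P0 l1 by (auto intro!: exI[of _ "min l1 l2"])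
    ultimately obtain t where "l < t" "P t" using less_cSup_iff[OF _ bdd] by (auto simp: T_def)
    then show "good x0 l" using \<open>0 < l\<close> by (auto simp: P_def)
  qed
  have "T \<ge> norm x0"
  proof (rule ccontr)
    assume "\<not> T \<ge> norm x0"
    then have T: "T < norm x0" by simp
    have ev: "\<forall>\<^sub>F t in at_left T. t \<in> {0<..<T}"
      using T0 by (auto simp: eventually_at_left_field)
    have g: "good x0 T" unfolding good_def
    proof (intro allI impI conjI)
      fix y assume y: "T \<le> norm (y - x0)" "y \<noteq> 0"
      have *: "\<forall>\<^sub>F t in at_left T. kelvin x0 t u y \<le> u y \<and> kelvin x0 t v y \<le> v y"
        using ev by eventually_elim (use TP y in \<open>auto simp: P_def good_def\<close>)
      have "((\<lambda>t. kelvin x0 t u y) \<longlongrightarrow> kelvin x0 T u y) (at_left T)"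
        using cont_kelvin_radius[OF T0 T y(1)] unfolding isCont_def
        by (rule filterlim_mono) (auto simp: at_le)
      then show "kelvin x0 T u y \<le> u y"
        by (rule tendsto_upperbound) (use * in \<open>auto elim: eventually_mono\<close>)
      have "((\<lambda>t. kelvin x0 t v y) \<longlongrightarrow> kelvin x0 T v y) (at_left T)"
        using sw.cont_kelvin_radius[OF T0 T y(1)] unfolding isCont_def
        by (rule filterlim_mono) (auto simp: at_le)
      then show "kelvin x0 T v y \<le> v y"
        by (rule tendsto_upperbound) (use * in \<open>auto elim: eventually_mono\<close>)
    qed
    obtain e1 where e1: "e1 > 0"
      "\<And>l' y. T \<le> l' \<Longrightarrow> l' < T + e1 \<Longrightarrow> l' \<le> norm (y - x0) \<Longrightarrow> y \<noteq> 0 \<Longrightarrow> kelvin x0 l' u y \<le> u y"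
      using moving_spheres_step[OF T0 T g] by blast
    obtain e2 where e2: "e2 > 0"
      "\<And>l' y. T \<le> l' \<Longrightarrow> l' < T + e2 \<Longrightarrow> l' \<le> norm (y - x0) \<Longrightarrow> y \<noteq> 0 \<Longrightarrow> kelvin x0 l' v y \<le> v y"
      using sw.moving_spheres_step[OF T0 T] g good_sw by blast
    define t where "t = min (norm x0) (T + min e1 e2)"
    have "good x0 l" if "0 < l" "l < t" for l
    proof (cases "l < T")
      case True
      then show ?thesis using TP that by (simp add: P_def)
    next
      case False
      then show ?thesis using e1 e2 that unfolding good_def t_def by auto
    qed
    then have "P t" by (simp add: P_def)
    then have "t \<le> T" using cSup_upper[OF _ bdd, of t] by (simp add: T_def t_def)
    then show False using T e1 e2 by (simp add: t_def min_def split: if_splits)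
  qed
  then show ?thesis using TP l by (simp add: P_def)
qed

section \<open>Radial symmetry\<close>

lemma inner_reflect_pos:
  assumes e: "norm e = 1" and "y \<bullet> e < 2 * a"
  shows "y + (2 * (a - y \<bullet> e)) *\<^sub>R e \<noteq> (0::real^'n)"
proof
  assume "y + (2 * (a - y \<bullet> e)) *\<^sub>R e = 0"
  then have "(y + (2 * (a - y \<bullet> e)) *\<^sub>R e) \<bullet> e = 0" by simp
  moreover have "e \<bullet> e = 1" using e by (simp add: dot_square_norm)
  ultimately show False using assms by (simp add: inner_add_left)
qed

text \<open>The spheres with centre \<open>R *\<^sub>R e\<close> and radius \<open>R - a\<close> are
  admissible because \<open>a > 0\<close>, and tend to the hyperplane at height \<open>a\<close>.
  \<open>A R\<close> is the squared ratio of radius and distance; \<open>A R \<rightarrow> 1\<close>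
  and \<open>R * (1 - A R) \<rightarrow> 2 * (a - b)\<close> turn the inversion into the reflection
  and the weight into 1.\<close>

lemma reflect_le:
  assumes e: "norm e = 1" and a: "a > 0" and y: "y \<noteq> 0" "y \<bullet> e < a"
  shows "u (y + (2 * (a - y \<bullet> e)) *\<^sub>R e) \<le> u y"
proof -
  define b where "b = y \<bullet> e"
  define c where "c = (norm y)\<^sup>2"
  have ee: "e \<bullet> e = 1" using e by (simp add: dot_square_norm)
  have b: "b < a" using y by (simp add: b_def)
  define A where "A R = (R - a)\<^sup>2 / (R\<^sup>2 - 2 * R * b + c)" for R
  have nsq: "(norm (y - R *\<^sub>R e))\<^sup>2 = R\<^sup>2 - 2 * R * b + c" for R
    unfolding c_def b_def
    by (simp only: power2_norm_eq_inner inner_diff_left inner_diff_right inner_scaleR_left inner_scaleR_right ee inner_commute[of e y])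
       (simp add: power2_eq_square algebra_simps)
  have A1: "(A \<longlongrightarrow> 1) at_top" unfolding A_def by real_asymp
  have A2: "((\<lambda>R. R * (1 - A R)) \<longlongrightarrow> 2 * (a - b)) at_top" unfolding A_def by real_asymp
  define z where "z = y + (2 * (a - b)) *\<^sub>R e"
  have z0: "z \<noteq> 0" using inner_reflect_pos[OF e, of y a] y a by (simp add: z_def b_def)
  have "((\<lambda>R. A R *\<^sub>R y + (R * (1 - A R)) *\<^sub>R e) \<longlongrightarrow> 1 *\<^sub>R y + (2 * (a - b)) *\<^sub>R e) at_top"
    by (intro tendsto_intros A1 A2)
  then have "((\<lambda>R. A R *\<^sub>R y + (R * (1 - A R)) *\<^sub>R e) \<longlongrightarrow> z) at_top" by (simp add: z_def)
  from isCont_tendsto_compose[OF isCont_u[OF z0] this]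
  have "((\<lambda>R. A R powr (s/2) * u (A R *\<^sub>R y + (R * (1 - A R)) *\<^sub>R e)) \<longlongrightarrow> 1 powr (s/2) * u z) at_top"
    by (intro tendsto_intros A1) auto
  then have lim: "((\<lambda>R. A R powr (s/2) * u (A R *\<^sub>R y + (R * (1 - A R)) *\<^sub>R e)) \<longlongrightarrow> u z) at_top" by simp
  have "\<forall>\<^sub>F R in at_top. R > a \<and> (R - a)\<^sup>2 \<le> R\<^sup>2 - 2 * R * b + c"
  proof (intro eventually_conj)
    show "\<forall>\<^sub>F R in at_top. R > a" by (rule eventually_gt_at_top)
    have "\<forall>\<^sub>F R in at_top. R \<ge> \<bar>a\<^sup>2 - c\<bar> / (2 * (a - b))" by (rule eventually_ge_at_top)
    then show "\<forall>\<^sub>F R in at_top. (R - a)\<^sup>2 \<le> R\<^sup>2 - 2 * R * b + c"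
    proof eventually_elim
      case (elim R)
      then have "\<bar>a\<^sup>2 - c\<bar> \<le> R * (2 * (a - b))" using b by (simp add: divide_le_eq)
      then show ?case by (simp add: power2_eq_square algebra_simps abs_le_iff)
    qed
  qed
  then have "\<forall>\<^sub>F R in at_top. A R powr (s/2) * u (A R *\<^sub>R y + (R * (1 - A R)) *\<^sub>R e) \<le> u y"
  proof eventually_elim
    case (elim R)
    have R: "R > 0" "R - a > 0" using elim a by auto
    have "(R - a)\<^sup>2 \<le> (norm (y - R *\<^sub>R e))\<^sup>2" using elim by (simp add: nsq)
    then have le: "R - a \<le> norm (y - R *\<^sub>R e)" by (rule power2_le_imp_le) simp
    have "good (R *\<^sub>R e) (R - a)" by (rule good_all) (use R a e in auto)
    then have "kelvin (R *\<^sub>R e) (R - a) u y \<le> u y" using le y by (simp add: good_def)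
    moreover have "((R - a) / norm (y - R *\<^sub>R e))\<^sup>2 = A R" by (simp add: power_divide nsq A_def)
    moreover have "((R - a) / norm (y - R *\<^sub>R e)) powr s = (((R - a) / norm (y - R *\<^sub>R e))\<^sup>2) powr (s/2)"
      using R by (intro powr_half_sq[symmetric]) auto
    ultimately have "A R powr (s/2) * u (R *\<^sub>R e + A R *\<^sub>R (y - R *\<^sub>R e)) \<le> u y"
      by (simp add: kelvin_def s_def)
    moreover have "R *\<^sub>R e + A R *\<^sub>R (y - R *\<^sub>R e) = A R *\<^sub>R y + (R * (1 - A R)) *\<^sub>R e"
      by (simp add: algebra_simps)
    ultimately show ?case by simp
  qed
  then show ?thesis using tendsto_upperbound[OF lim] by (simp add: z_def b_def)
qed

text \<open>Equal norms put the bisecting hyperplane of \<open>y\<close> and \<open>z\<close>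
  through the origin, at height 0. Reflection is available at positive heights only, so the height
  tends to 0 from the right.\<close>

lemma radial_le:
  assumes "norm y = norm z" "y \<noteq> 0"
  shows "u z \<le> u y"
proof (cases "y = z")
  case False
  define e where "e = (1 / norm (z - y)) *\<^sub>R (z - y)"
  have e: "norm e = 1" using False by (simp add: e_def)
  have "(norm (z - y))\<^sup>2 = (norm z)\<^sup>2 + (norm y)\<^sup>2 - 2 * (y \<bullet> z)"
    by (simp add: power2_norm_eq_inner inner_diff_left inner_diff_right inner_commute[of z y])
  moreover have "y \<bullet> (z - y) = y \<bullet> z - (norm y)\<^sup>2" by (simp add: inner_diff_right power2_norm_eq_inner)
  ultimately have "y \<bullet> (z - y) = - (norm (z - y))\<^sup>2 / 2" using assms by simp
  then have b: "y \<bullet> e = - norm (z - y) / 2" using False by (simp add: e_def power2_eq_square)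
  have z: "y + (2 * (0 - y \<bullet> e)) *\<^sub>R e = z" unfolding b using False by (simp add: e_def)
  have z0: "z \<noteq> 0" using assms by auto
  have "((\<lambda>a. y + (2 * (a - y \<bullet> e)) *\<^sub>R e) \<longlongrightarrow> y + (2 * (0 - y \<bullet> e)) *\<^sub>R e) (at_right 0)"
    by (intro tendsto_intros)
  then have "((\<lambda>a. y + (2 * (a - y \<bullet> e)) *\<^sub>R e) \<longlongrightarrow> z) (at_right 0)" by (simp only: z)
  from isCont_tendsto_compose[OF isCont_u[OF z0] this]
  have lim: "((\<lambda>a. u (y + (2 * (a - y \<bullet> e)) *\<^sub>R e)) \<longlongrightarrow> u z) (at_right 0)" .
  have "y \<bullet> e < 0" using b False by simp
  have "\<forall>\<^sub>F a in at_right (0::real). a > 0" by (simp add: eventually_at_right_less)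
  then have "\<forall>\<^sub>F a in at_right 0. u (y + (2 * (a - y \<bullet> e)) *\<^sub>R e) \<le> u y"
  proof eventually_elim
    case (elim a)
    then show ?case using \<open>y \<bullet> e < 0\<close> assms(2) by (intro reflect_le[OF e]) auto
  qed
  then show ?thesis using tendsto_upperbound[OF lim] by simp
qed simp

section \<open>The radial profile and its differential equation\<close>

text \<open>\<open>undefined\<close> just selects some coordinate; along an axis the derivatives of
  the profile are partial derivatives of \<open>u\<close>.\<close>

definition dir :: "real^'n" where "dir = axis undefined 1"

definition U :: "real \<Rightarrow> real" where "U r = u (r *\<^sub>R dir)"
definition dU :: "real \<Rightarrow> real" where "dU r = partial_deriv undefined u (r *\<^sub>R dir)"
definition ddU :: "real \<Rightarrow> real" where "ddU r = partial_deriv undefined (partial_deriv undefined u) (r *\<^sub>R dir)"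

lemma norm_dir: "norm dir = 1" by (simp add: dir_def)

lemma u_eq_U: assumes "x \<noteq> 0" shows "u x = U (norm x)"
proof -
  have *: "norm x = norm (norm x *\<^sub>R dir)" "norm x *\<^sub>R dir \<noteq> 0"
    using norm_dir assms by auto
  show ?thesis unfolding U_def
    by (rule antisym) (use radial_le[OF *(1) assms] radial_le[OF *(1)[symmetric] *(2)] in simp_all)
qed

lemma dir_nonzero: "r > 0 \<Longrightarrow> r *\<^sub>R dir \<noteq> 0"
  using norm_dir by auto

lemma U_pos: "r > 0 \<Longrightarrow> U r > 0"
  using uv_pos dir_nonzero by (simp add: U_def)

text \<open>The reflection at height \<open>(r + t) / 2\<close> exchanges the points at radius
  \<open>r\<close> and \<open>t\<close> on the axis.\<close>

lemma U_antimono: "0 < r \<Longrightarrow> r \<le> t \<Longrightarrow> U t \<le> U r"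
proof (cases "r = t")
  case False
  assume *: "0 < r" "r \<le> t"
  have "dir \<bullet> dir = 1" using norm_dir by (simp add: dot_square_norm)
  moreover have "r + 2 * ((r + t) / 2 - r) = t" by (simp add: field_simps)
  ultimately have "(r *\<^sub>R dir) + (2 * ((r + t) / 2 - (r *\<^sub>R dir) \<bullet> dir)) *\<^sub>R dir = t *\<^sub>R dir"
    by (simp only: inner_scaleR_left mult_1_right flip: scaleR_add_left)
  then show ?thesis
    using reflect_le[OF norm_dir, of "(r + t) / 2" "r *\<^sub>R dir"] * False dir_nonzero \<open>dir \<bullet> dir = 1\<close>
    by (simp add: U_def)
qed simp

lemma DERIV_U: assumes "r > 0" shows "(U has_real_derivative dU r) (at r)"
proof -
  have "has_partial_at undefined u (0 + r *\<^sub>R axis undefined 1)"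
    using C2(1) dir_nonzero[OF assms] unfolding C2_on_def by (simp add: dir_def)
  from has_partial_at_DERIV[OF this] show ?thesis by (simp add: U_def[abs_def] dU_def dir_def)
qed

lemma DERIV_dU: assumes "r > 0" shows "(dU has_real_derivative ddU r) (at r)"
proof -
  have "has_partial_at undefined (partial_deriv undefined u) (0 + r *\<^sub>R axis undefined 1)"
    using C2(1) dir_nonzero[OF assms] unfolding C2_on_def by (simp add: dir_def)
  from has_partial_at_DERIV[OF this] show ?thesis by (simp add: dU_def[abs_def] ddU_def dir_def)
qed

lemma dU_nonpos: "r > 0 \<Longrightarrow> dU r \<le> 0"
proof (rule ccontr)
  assume r: "r > 0" and "\<not> dU r \<le> 0"
  then obtain d where "d > 0" "\<And>h. 0 < h \<Longrightarrow> h < d \<Longrightarrow> U r < U (r + h)"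
    using DERIV_pos_inc_right[OF DERIV_U[OF r]] by auto
  then have "U r < U (r + d / 2)" by auto
  then show False using U_antimono[of r "r + d / 2"] r \<open>d > 0\<close> by simp
qed

text \<open>Along each of the \<open>n - 1 = s + 1\<close> axes orthogonal to \<open>dir\<close> the
  norm has first derivative 0 and second derivative \<open>1 / r\<close>, so only the first
  derivative of the profile contributes there.\<close>

lemma laplacian_radial:
  assumes r: "r > 0"
  shows "laplacian u (r *\<^sub>R dir) = ddU r + (s + 1) * dU r / r"
proof -
  have other: "partial_deriv j (partial_deriv j u) (r *\<^sub>R dir) = dU r / r" if j: "j \<noteq> undefined" for j
  proof (rule D2_partial_deriv)
    let ?z = "r *\<^sub>R dir"
    have z: "?z \<noteq> 0" "norm ?z = r" "?z $ j = 0"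
      using dir_nonzero[OF r] norm_dir r j by (auto simp: dir_def axis_def)
    have "D2 (\<lambda>t. norm (?z + t *\<^sub>R axis j 1) powr 1) 0 (1 / r)"
      using D2_norm_powr[OF z(1), of j 1] z r by (simp add: powr_minus divide_inverse)
    then have F: "D2 (\<lambda>t. norm (?z + t *\<^sub>R axis j 1)) 0 (1 / r)" by simp
    have "\<forall>\<^sub>F x in nhds r. x \<in> {0<..}" using r by (intro eventually_nhds_in_open) auto
    then have ev: "\<forall>\<^sub>F x in nhds r. (U has_real_derivative dU x) (at x)"
      by eventually_elim (simp add: DERIV_U)
    have "D2 (\<lambda>t. U (norm (?z + t *\<^sub>R axis j 1))) 0 (dU r / r)"
      using D2_compose[OF F, of U dU "ddU r"] ev DERIV_dU[OF r] z by simp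
    moreover have "U (norm (?z + t *\<^sub>R axis j 1)) = u (?z + t *\<^sub>R axis j 1)" for t
    proof (rule u_eq_U[symmetric])
      show "?z + t *\<^sub>R axis j 1 \<noteq> 0"
      proof
        assume "?z + t *\<^sub>R axis j 1 = 0"
        then have "(?z + t *\<^sub>R axis j 1) $ undefined = 0" by simp
        then show False using r j by (simp add: dir_def axis_def)
      qed
    qed
    ultimately show "D2 (\<lambda>t. u (?z + t *\<^sub>R axis j 1)) 0 (dU r / r)" by simp
  qed
  have "laplacian u (r *\<^sub>R dir) = ddU r + (\<Sum>j\<in>UNIV - {undefined}. partial_deriv j (partial_deriv j u) (r *\<^sub>R dir))"
    unfolding laplacian_def ddU_def by (rule sum.remove) auto
  also have "(\<Sum>j\<in>UNIV - {undefined}. partial_deriv j (partial_deriv j u) (r *\<^sub>R dir)) =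
      (\<Sum>j\<in>UNIV - {undefined::'n}. dU r / r)"
    by (intro sum.cong other) auto
  also have "\<dots> = (s + 1) * dU r / r"
    using n3 by (simp add: card_Diff_singleton s_def)
  finally show ?thesis .
qed

lemma radial_ode:
  assumes r: "r > 0"
  shows "ddU r = - ((s + 1) * dU r / r) - (\<mu>1 * u (r *\<^sub>R dir) powr (2*q+1) +
     \<beta> * u (r *\<^sub>R dir) powr q * v (r *\<^sub>R dir) powr (q+1))"
  using laplacian_radial[OF r] eq_u[OF dir_nonzero[OF r]] by linarith

definition ef :: "real \<Rightarrow> real" where "ef t = exp (t / q) * U (exp t)"
definition ef' :: "real \<Rightarrow> real" where "ef' t = exp (t / q) * U (exp t) / q + exp ((1 / q + 1) * t) * dU (exp t)"

lemma DERIV_ef: "(ef has_real_derivative ef' t) (at t)"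
proof -
  have 1: "((\<lambda>t. U (exp t)) has_real_derivative dU (exp t) * exp t) (at t)"
    by (rule DERIV_chain2[OF DERIV_U DERIV_exp]) simp
  have 2: "((\<lambda>t. exp (t / q)) has_real_derivative exp (t / q) * (1 / q)) (at t)"
    using exponents(1) by (auto intro!: derivative_eq_intros)
  have 3: "exp ((1 / q + 1) * t) = exp (t / q) * exp t" by (simp add: distrib_right exp_add)
  show ?thesis unfolding ef_def[abs_def]
    by (rule DERIV_cong[OF DERIV_mult[OF 2 1]]) (simp add: ef'_def 3)
qed

end

section \<open>The Emden-Fowler system\<close>

text \<open>Replaces integration from minus infinity: it is applied to the value at \<open>t\<close>
  of a monotone quantity whose value at \<open>\<tau>\<close> is under a decaying
  exponential.\<close>

lemma at_bot_nonpos: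
  fixes x :: real
  assumes "c > 0" "\<And>\<tau>. \<tau> \<le> t \<Longrightarrow> x \<le> B * exp (c * \<tau>)"
  shows "x \<le> 0"
proof -
  have "filterlim (\<lambda>\<tau>. c * \<tau>) at_bot at_bot"
    using assms(1) by (simp add: filterlim_tendsto_pos_mult_at_bot[OF tendsto_const] filterlim_ident)
  then have "((\<lambda>\<tau>. B * exp (c * \<tau>)) \<longlongrightarrow> B * 0) at_bot"
    by (intro tendsto_intros filterlim_compose[OF exp_at_bot])
  then show ?thesis
    using assms(2) by (intro tendsto_lowerbound[of "\<lambda>\<tau>. B * exp (c * \<tau>)" 0 at_bot])
      (auto simp: eventually_at_bot_linorder)
qed

lemma exp_mult_exp_mult: "exp x * (exp y * z) = exp (x + y) * (z::real)"
  by (simp add: exp_add)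

lemma powr_add1: "(x::real) > 0 \<Longrightarrow> x powr (b + 1) = x * x powr b"
  by (simp add: powr_add)

lemma DERIV_square: "(g has_real_derivative d) (at x) \<Longrightarrow> ((\<lambda>x. (g x)\<^sup>2) has_real_derivative 2 * g x * d) (at x)"
  by (auto intro!: derivative_eq_intros)

text \<open>Instantiated with \<open>a = 1/q\<close> and \<open>\<kappa> = 2/q - s\<close>; the
  assumption \<open>decr\<close> expresses that the profiles are nonincreasing.\<close>

locale emden_fowler =
  fixes \<mu>1 \<mu>2 \<beta> q a \<kappa> :: real and X Y X' Y' :: "real \<Rightarrow> real"
  assumes pos: "\<mu>1 > 0" "\<mu>2 > 0" "\<beta> > 0" "q > 0" "\<kappa> > 0" "\<kappa> < a" "a * q = 1"
    and XY_pos: "X t > 0" "Y t > 0"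
    and dX: "(X has_real_derivative X' t) (at t)" and dY: "(Y has_real_derivative Y' t) (at t)"
    and dX': "(X' has_real_derivative \<kappa> * X' t + a * (a - \<kappa>) * X t -
        (\<mu>1 * X t powr (2*q+1) + \<beta> * X t powr q * Y t powr (q+1))) (at t)"
    and dY': "(Y' has_real_derivative \<kappa> * Y' t + a * (a - \<kappa>) * Y t -
        (\<mu>2 * Y t powr (2*q+1) + \<beta> * Y t powr q * X t powr (q+1))) (at t)"
    and decr: "X' t \<le> a * X t" "Y' t \<le> a * Y t"
begin

lemma swap: "emden_fowler \<mu>2 \<mu>1 \<beta> q a \<kappa> Y X Y' X'"
  using pos XY_pos dX dY dX' dY' decr by unfold_locales auto

definition f where "f t = \<mu>1 * X t powr (2*q+1) + \<beta> * X t powr q * Y t powr (q+1)"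
definition h where "h = a - \<kappa>"
definition l where "l = a * h"
text \<open>In the application, \<open>r powr (1/q + 1)\<close> times the derivative of the profile.
  Splitting off the root \<open>a\<close> leaves the first-order equation
  \<open>W' = - h * W - f\<close>, with \<open>- h\<close> the other root.\<close>

definition W where "W t = X' t - a * X t"

lemma h_pos: "h > 0" "a > 0" "l > 0" using pos by (auto simp: h_def l_def)

lemma f_pos: "f t > 0"
  using pos XY_pos[of t] unfolding f_def by (intro add_pos_pos mult_pos_pos) auto

lemma dX'f: "(X' has_real_derivative \<kappa> * X' t + l * X t - f t) (at t)"
  using dX'[of t] by (simp add: f_def l_def h_def)

lemma contX: "continuous_on S X"
  using dX by (auto intro!: continuous_at_imp_continuous_on DERIV_isCont)

lemma W_nonpos: "W t \<le> 0" using decr by (simp add: W_def)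

lemma dW: "(W has_real_derivative - h * W t - f t) (at t)"
  unfolding W_def[abs_def]
  by (rule DERIV_cong[OF DERIV_diff[OF dX'f DERIV_cmult[OF dX]]])
     (simp add: l_def h_def algebra_simps)

lemma dexpW: "((\<lambda>t. exp (h * t) * W t) has_real_derivative - exp (h * t) * f t) (at t)"
  by (auto intro!: derivative_eq_intros dW simp: algebra_simps)

lemma dU: "((\<lambda>t. exp (- a * t) * X t) has_real_derivative exp (- a * t) * W t) (at t)"
  by (auto intro!: derivative_eq_intros dX simp: W_def algebra_simps)

lemma U_antimono:
  assumes "\<tau> \<le> t"
  shows "exp (- a * t) * X t \<le> exp (- a * \<tau>) * X \<tau>"
proof (rule DERIV_nonpos_imp_nonincreasing[OF assms], intro exI conjI, rule dU)
  fix x show "exp (- a * x) * W x \<le> 0" by (simp add: mult_nonneg_nonpos W_nonpos)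
qed

lemma expW_antimono:
  assumes "\<tau> \<le> t"
  shows "exp (h * t) * W t \<le> exp (h * \<tau>) * W \<tau>"
proof (rule DERIV_nonpos_imp_nonincreasing[OF assms])
  fix x show "\<exists>y. ((\<lambda>t. exp (h * t) * W t) has_real_derivative y) (at x) \<and> y \<le> 0"
    using dexpW[of x] f_pos[of x] by (intro exI conjI) (auto intro: less_imp_le)
qed

section \<open>A priori bounds\<close>

text \<open>Since \<open>exp (- a * t) * X t\<close> is nonincreasing,
  \<open>X x \<ge> exp (a * (x - t)) * X t\<close> for \<open>x \<le> t\<close>. Inserting this
  lower bound for the source \<open>f\<close> and integrating the equation of
  \<open>exp (h * t) * W t\<close> from minus infinity gives the claim; \<open>G\<close> adds the
  integrated bound to that quantity.\<close>

lemma W_le: "W t \<le> - (\<mu>1 / (h + a * (2*q+1))) * X t powr (2*q+1)"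
proof -
  define p where "p = 2*q+1"
  have p: "p > 0" using pos by (simp add: p_def)
  define c where "c = \<mu>1 / (h + a * p)"
  have hap: "h + a * p > 0" using h_pos p by (simp add: add_pos_pos)
  define B where "B = c * X t powr p * exp (- (a * p * t))"
  define G where "G \<tau> = exp (h * \<tau>) * W \<tau> + B * exp ((h + a * p) * \<tau>)" for \<tau>
  have dG: "(G has_real_derivative - exp (h * \<tau>) * f \<tau> + B * ((h + a * p) * exp ((h + a * p) * \<tau>))) (at \<tau>)" for \<tau>
  proof -
    have "((\<lambda>\<tau>. B * exp ((h + a * p) * \<tau>)) has_real_derivative B * ((h + a * p) * exp ((h + a * p) * \<tau>))) (at \<tau>)"
      by (auto intro!: derivative_eq_intros)
    from DERIV_add[OF dexpW this] show ?thesis by (simp add: G_def[abs_def])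
  qed
  have "G t \<le> B * exp ((h + a * p) * \<tau>)" if "\<tau> \<le> t" for \<tau>
  proof -
    have "G t \<le> G \<tau>"
    proof (rule DERIV_nonpos_imp_nonincreasing[OF that], intro exI conjI, rule dG)
      fix x assume x: "\<tau> \<le> x" "x \<le> t"
      have "exp (a * (x - t)) * X t = exp (a * x) * (exp (- a * t) * X t)"
        by (simp add: algebra_simps flip: exp_add)
      also have "\<dots> \<le> exp (a * x) * (exp (- a * x) * X x)"
        using U_antimono[OF x(2)] by (intro mult_left_mono) auto
      also have "\<dots> = X x" by (simp flip: exp_add mult.assoc)
      finally have "(exp (a * (x - t)) * X t) powr p \<le> X x powr p"
        using p XY_pos(1)[of t] by (intro powr_mono2) auto
      then have "exp (a * (x - t) * p) * X t powr p \<le> X x powr p"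
        using XY_pos(1)[of t] by (simp add: powr_mult exp_powr_real)
      then have "\<mu>1 * (exp (a * (x - t) * p) * X t powr p) \<le> \<mu>1 * X x powr p"
        using pos by (intro mult_left_mono) auto
      also have "\<dots> \<le> f x" using pos by (simp add: f_def p_def)
      finally have "exp (h * x) * (\<mu>1 * (exp (a * (x - t) * p) * X t powr p)) \<le> exp (h * x) * f x"
        by (intro mult_left_mono) auto
      moreover have "B * ((h + a * p) * exp ((h + a * p) * x)) = exp (h * x) * (\<mu>1 * (exp (a * (x - t) * p) * X t powr p))"
      proof -
        have "B * (h + a * p) = \<mu>1 * X t powr p * exp (- (a * p * t))"
          using hap by (simp add: B_def c_def)
        moreover have "exp ((h + a * p) * x) * exp (- (a * p * t)) = exp (h * x) * exp (a * (x - t) * p)"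
          by (simp add: algebra_simps flip: exp_add)
        moreover have "B * ((h + a * p) * exp ((h + a * p) * x)) = (B * (h + a * p)) * exp ((h + a * p) * x)"
          by simp
        ultimately show ?thesis by (simp only: mult.assoc mult.left_commute mult.commute)
      qed
      ultimately show "- exp (h * x) * f x + B * ((h + a * p) * exp ((h + a * p) * x)) \<le> 0" by simp
    qed
    also have "\<dots> \<le> B * exp ((h + a * p) * \<tau>)"
      using W_nonpos by (simp add: G_def mult_nonneg_nonpos)
    finally show ?thesis .
  qed
  from at_bot_nonpos[OF hap this] have "G t \<le> 0" .
  moreover have "G t = exp (h * t) * (W t + c * X t powr p)"
    by (simp add: G_def B_def algebra_simps flip: exp_add)
  ultimately have "W t + c * X t powr p \<le> 0"
    by (simp add: mult_le_0_iff)
  then show ?thesis by (simp add: c_def p_def)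
qed

text \<open>With \<open>U = exp (- a * t) * X t\<close> one has
  \<open>exp (2 * t) * X t powr (- 2 * q) = U powr (- 2 * q)\<close>, and \<open>W_le\<close> says
  that its derivative is at least \<open>2 * q * c * exp (2 * t)\<close>. Integrating from minus
  infinity bounds \<open>X\<close> from above.\<close>

lemma X_bounded: "\<exists>C>0. \<forall>t. X t \<le> C"
proof -
  define c where "c = \<mu>1 / (h + a * (2*q+1))"
  have c: "c > 0" using pos h_pos by (simp add: c_def add_pos_pos)
  define Z where "Z t = exp (2 * t) * X t powr (- 2 * q) - q * c * exp (2 * t)" for t
  have dZ: "(Z has_real_derivative (- 2 * q) * exp (2 * t) * X t powr (- 2 * q - 1) * W t - 2 * q * c * exp (2 * t)) (at t)" for t
  proof -
    have 1: "((\<lambda>t. X t powr (- 2 * q)) has_real_derivative (- 2 * q) * X t powr (- 2 * q - 1) * X' t) (at t)"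
      by (rule DERIV_cong[OF DERIV_powr[OF dX[of t] XY_pos(1) DERIV_const[of "-2 * q"]]])
         (use XY_pos(1)[of t] in \<open>simp add: powr_diff\<close>)
    have 2: "((\<lambda>t. exp (2 * t)) has_real_derivative 2 * exp (2 * t)) (at t)"
      by (auto intro!: derivative_eq_intros)
    have 3: "X t powr (- 2 * q) = a * q * (X t powr (- 2 * q - 1) * X t)"
      using XY_pos(1)[of t] pos by (simp add: powr_diff)
    show ?thesis unfolding Z_def[abs_def]
      by (rule DERIV_cong[OF DERIV_diff[OF DERIV_mult[OF 2 1] DERIV_cmult[OF 2]]], subst 3)
         (simp add: W_def algebra_simps)
  qed
  have Z: "Z t \<ge> 0" for t
  proof -
    have "- Z t \<le> q * c * exp (2 * \<tau>)" if "\<tau> \<le> t" for \<tau>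
    proof -
      have "Z \<tau> \<le> Z t"
      proof (rule DERIV_nonneg_imp_nondecreasing[OF that], intro exI conjI, rule dZ)
        fix x
        have "c * X x powr (2*q+1) \<le> - W x" using W_le[of x] by (simp add: c_def)
        then have "2 * q * exp (2 * x) * X x powr (- 2 * q - 1) * (c * X x powr (2*q+1)) \<le>
           2 * q * exp (2 * x) * X x powr (- 2 * q - 1) * (- W x)"
          using pos by (intro mult_left_mono) auto
        moreover have "X x powr (- 2 * q - 1) = inverse (X x powr (2*q+1))"
          by (simp flip: powr_minus)
        then have "2 * q * exp (2 * x) * X x powr (- 2 * q - 1) * (c * X x powr (2*q+1)) = 2 * q * c * exp (2 * x)"
          using XY_pos(1)[of x] by simp
        ultimately show "0 \<le> (- 2 * q) * exp (2 * x) * X x powr (- 2 * q - 1) * W x - 2 * q * c * exp (2 * x)"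
          by linarith
      qed
      moreover have "Z \<tau> \<ge> - (q * c * exp (2 * \<tau>))" by (simp add: Z_def)
      ultimately show ?thesis by simp
    qed
    from at_bot_nonpos[OF _ this] show ?thesis by simp
  qed
  show ?thesis
  proof (intro exI[of _ "(1 / (q * c)) powr (1 / (2 * q))"] conjI allI)
    show "0 < (1 / (q * c)) powr (1 / (2 * q))" using pos c by simp
    fix t
    have "exp (2 * t) * (q * c) \<le> exp (2 * t) * X t powr (- 2 * q)" using Z[of t] by (simp add: Z_def mult_ac)
    then have "q * c \<le> X t powr (- 2 * q)" by simp
    then have "X t powr (2 * q) \<le> 1 / (q * c)"
      using XY_pos(1)[of t] pos c by (simp add: powr_minus field_simps)
    then have "(X t powr (2 * q)) powr (1 / (2 * q)) \<le> (1 / (q * c)) powr (1 / (2 * q))"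
      using pos by (intro powr_mono2) auto
    then show "X t \<le> (1 / (q * c)) powr (1 / (2 * q))"
      using XY_pos(1)[of t] pos by (simp add: powr_powr)
  qed
qed

text \<open>The mean value theorem for the positive function \<open>exp (- a * t) * X t\<close>
  bounds \<open>W\<close> at some point of the next unit interval; monotonicity of
  \<open>exp (h * t) * W t\<close> carries the bound back to \<open>t\<close>.\<close>

lemma X'_bounded: "\<exists>C>0. \<forall>t. X t \<le> C \<and> \<bar>X' t\<bar> \<le> C"
proof -
  obtain C where C: "C > 0" "\<And>t. X t \<le> C" using X_bounded by blast
  have W: "W t \<ge> - (exp h * (exp a * C))" for t
  proof -
    obtain \<xi> where \<xi>: "t < \<xi>" "\<xi> < t + 1"
      "exp (- a * (t + 1)) * X (t + 1) - exp (- a * t) * X t = (t + 1 - t) * (exp (- a * \<xi>) * W \<xi>)"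
      using MVT2[of t "t + 1", OF _ dU] by auto
    have "exp (- a * (t + 1)) * X (t + 1) > 0" using XY_pos by simp
    then have "- (exp (- a * \<xi>) * W \<xi>) \<le> exp (- a * t) * X t" using \<xi>(3) by simp
    then have "exp (a * \<xi>) * - (exp (- a * \<xi>) * W \<xi>) \<le> exp (a * \<xi>) * (exp (- a * t) * X t)"
      by (intro mult_left_mono) auto
    then have "- W \<xi> \<le> exp (a * (\<xi> - t)) * X t"
      by (simp add: exp_mult_exp_mult right_diff_distrib)
    also have "\<dots> \<le> exp a * C"
      using \<xi> C(2)[of t] h_pos XY_pos(1)[of t] by (intro mult_mono) (auto simp: less_imp_le)
    finally have 1: "- W \<xi> \<le> exp a * C" .
    have "exp (h * t) * - W t \<le> exp (h * \<xi>) * - W \<xi>" using expW_antimono[of t \<xi>] \<xi> by simp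
    then have "exp (- h * t) * (exp (h * t) * - W t) \<le> exp (- h * t) * (exp (h * \<xi>) * - W \<xi>)"
      by (intro mult_left_mono) auto
    then have "- W t \<le> exp (h * (\<xi> - t)) * - W \<xi>"
      by (simp add: exp_mult_exp_mult right_diff_distrib)
    also have "\<dots> \<le> exp h * (exp a * C)"
      using \<xi> 1 h_pos W_nonpos[of \<xi>] by (intro mult_mono) auto
    finally show ?thesis by simp
  qed
  define D where "D = C + a * C + exp h * (exp a * C)"
  have p: "a * C > 0" "exp h * (exp a * C) > 0" using C h_pos by auto
  have "X t \<le> D \<and> \<bar>X' t\<bar> \<le> D" for t
  proof -
    have "a * X t \<le> a * C" "0 \<le> a * X t" using C(2)[of t] h_pos XY_pos(1)[of t] by auto
    then show ?thesis using W[of t] W_nonpos[of t] C(2)[of t] C(1) p by (auto simp: W_def D_def abs_le_iff)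
  qed
  moreover have "D > 0" unfolding D_def using p C(1) by linarith
  ultimately show ?thesis by blast
qed

interpretation sw: emden_fowler \<mu>2 \<mu>1 \<beta> q a \<kappa> Y X Y' X'
  by (rule swap)

section \<open>Energy and the Pohozaev-type functional\<close>

text \<open>The potential of the nonlinearity, with partial derivatives \<open>f\<close> and
  \<open>sw.f\<close>; it exists because both equations share the same
  \<open>\<beta>\<close>.\<close>

definition F where "F t = (\<mu>1 * X t powr (2*q+2) + \<mu>2 * Y t powr (2*q+2) +
    2 * \<beta> * (X t powr (q+1) * Y t powr (q+1))) / (2*q+2)"

definition E where "E t = 1 / 2 * ((X' t)\<^sup>2 + (Y' t)\<^sup>2) - l / 2 * ((X t)\<^sup>2 + (Y t)\<^sup>2) + F t"

text \<open>The derivative of \<open>J\<close> is \<open>- 2 * E t - 2 * q * F t\<close>; since \<open>J\<close> is bounded, this excludes \<open>E > 0\<close>.\<close>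

definition J where "J t = X t * X' t + Y t * Y' t - \<kappa> / 2 * ((X t)\<^sup>2 + (Y t)\<^sup>2) - 2 / \<kappa> * E t"

lemma bounds: "\<exists>C>0. \<forall>t. X t \<le> C \<and> \<bar>X' t\<bar> \<le> C \<and> Y t \<le> C \<and> \<bar>Y' t\<bar> \<le> C"
proof -
  obtain C D where "C > 0" "D > 0" "\<And>t. X t \<le> C \<and> \<bar>X' t\<bar> \<le> C" "\<And>t. Y t \<le> D \<and> \<bar>Y' t\<bar> \<le> D"
    using X'_bounded sw.X'_bounded by blast
  then show ?thesis by (intro exI[of _ "max C D"]) (auto intro: le_max_iff_disj[THEN iffD2])
qed

lemma F_pos: "F t > 0"
  unfolding F_def using pos XY_pos[of t]
  by (intro divide_pos_pos add_pos_pos mult_pos_pos) auto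

text \<open>Euler's identity for a function homogeneous of degree \<open>2*q+2\<close>.\<close>

lemma euler: "X t * f t + Y t * sw.f t = (2*q+2) * F t"
proof -
  have "X t powr (2*q+2) = X t * X t powr (2*q+1)" "Y t powr (2*q+2) = Y t * Y t powr (2*q+1)"
    "X t powr (q+1) = X t * X t powr q" "Y t powr (q+1) = Y t * Y t powr q"
    using powr_add1[OF XY_pos(1)[of t], of "2*q+1"] powr_add1[OF XY_pos(2)[of t], of "2*q+1"]
       powr_add1[OF XY_pos(1)[of t], of q] powr_add1[OF XY_pos(2)[of t], of q] by (simp_all add: add.assoc)
  moreover have "(2*q+2) * F t = \<mu>1 * X t powr (2*q+2) + \<mu>2 * Y t powr (2*q+2) +
    2 * \<beta> * (X t powr (q+1) * Y t powr (q+1))"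
    using pos by (simp add: F_def)
  ultimately show ?thesis by (simp add: f_def sw.f_def algebra_simps)
qed

lemma dF: "(F has_real_derivative f t * X' t + sw.f t * Y' t) (at t)"
proof -
  have dp: "((\<lambda>t. Z t powr (b+1)) has_real_derivative (b+1) * (Z t powr b * Z' t)) (at t)"
    if "Z t > 0" "(Z has_real_derivative Z' t) (at t)" for b Z Z'
    by (rule DERIV_cong[OF DERIV_powr[OF that(2,1) DERIV_const[of "b+1"]]])
       (use that(1) in \<open>simp add: powr_add1\<close>)
  have 2: "2*q+2 = (2*q+1)+1" by simp
  note X1 = dp[where Z=X and Z'=X' and b="2*q+1", OF XY_pos(1) dX, folded 2]
    and Y1 = dp[where Z=Y and Z'=Y' and b="2*q+1", OF XY_pos(2) dY, folded 2]
    and X2 = dp[where Z=X and Z'=X' and b=q, OF XY_pos(1) dX]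
    and Y2 = dp[where Z=Y and Z'=Y' and b=q, OF XY_pos(2) dY]
  have "(F has_real_derivative (\<mu>1 * ((2*q+2) * (X t powr (2*q+1) * X' t)) + \<mu>2 * ((2*q+2) * (Y t powr (2*q+1) * Y' t))
     + 2 * \<beta> * ((q+1) * (X t powr q * X' t) * Y t powr (q+1) + (q+1) * (Y t powr q * Y' t) * X t powr (q+1))) / (2*q+2)) (at t)"
    unfolding F_def[abs_def]
    by (intro DERIV_cdivide DERIV_add DERIV_cmult DERIV_mult X1 Y1 X2 Y2)
  then show ?thesis
    by (rule DERIV_cong) (use pos in \<open>simp add: f_def sw.f_def field_simps\<close>)
qed

lemma dE: "(E has_real_derivative \<kappa> * ((X' t)\<^sup>2 + (Y' t)\<^sup>2)) (at t)"
proof -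
  have "(E has_real_derivative 1 / 2 * (2 * X' t * (\<kappa> * X' t + l * X t - f t) + 2 * Y' t * (\<kappa> * Y' t + l * Y t - sw.f t))
     - l / 2 * (2 * X t * X' t + 2 * Y t * Y' t) + (f t * X' t + sw.f t * Y' t)) (at t)"
    unfolding E_def[abs_def]
    by (intro DERIV_add DERIV_diff DERIV_cmult DERIV_square dX dY dX'f sw.dX'f dF)
  then show ?thesis
    by (rule DERIV_cong) (simp add: power2_eq_square algebra_simps)
qed

text \<open>The term \<open>- 2 / \<kappa> * E\<close> reverses the sign of the kinetic part, so
  that Euler's identity turns everything into \<open>E\<close> and \<open>F\<close>.\<close>

lemma dJ: "(J has_real_derivative - 2 * E t - 2 * q * F t) (at t)"
proof -
  have "(J has_real_derivative ((X' t) * X' t + (\<kappa> * X' t + l * X t - f t) * X t) + ((Y' t) * Y' t + (\<kappa> * Y' t + l * Y t - sw.f t) * Y t)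
     - \<kappa> / 2 * (2 * X t * X' t + 2 * Y t * Y' t) - 2 / \<kappa> * (\<kappa> * ((X' t)\<^sup>2 + (Y' t)\<^sup>2))) (at t)"
    unfolding J_def[abs_def]
    by (intro DERIV_add DERIV_diff DERIV_cmult DERIV_mult DERIV_square dX dY dX'f sw.dX'f dE)
  moreover have "2 / \<kappa> * (\<kappa> * ((X' t)\<^sup>2 + (Y' t)\<^sup>2)) = 2 * ((X' t)\<^sup>2 + (Y' t)\<^sup>2)" using pos by simp
  ultimately have "(J has_real_derivative ((X' t) * X' t + (\<kappa> * X' t + l * X t - f t) * X t) + ((Y' t) * Y' t + (\<kappa> * Y' t + l * Y t - sw.f t) * Y t)
     - \<kappa> / 2 * (2 * X t * X' t + 2 * Y t * Y' t) - 2 * ((X' t)\<^sup>2 + (Y' t)\<^sup>2)) (at t)" by simp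
  then show ?thesis
  proof (rule DERIV_cong)
    have "((X' t) * X' t + (\<kappa> * X' t + l * X t - f t) * X t) + ((Y' t) * Y' t + (\<kappa> * Y' t + l * Y t - sw.f t) * Y t)
      - \<kappa> / 2 * (2 * X t * X' t + 2 * Y t * Y' t) - 2 * ((X' t)\<^sup>2 + (Y' t)\<^sup>2)
      = - ((X' t)\<^sup>2 + (Y' t)\<^sup>2) + l * ((X t)\<^sup>2 + (Y t)\<^sup>2) - (X t * f t + Y t * sw.f t)"
      by (simp add: power2_eq_square algebra_simps)
    also have "\<dots> = - 2 * E t - 2 * q * F t"
      unfolding euler E_def by (simp add: algebra_simps)
    finally show "((X' t) * X' t + (\<kappa> * X' t + l * X t - f t) * X t) + ((Y' t) * Y' t + (\<kappa> * Y' t + l * Y t - sw.f t) * Y t)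
      - \<kappa> / 2 * (2 * X t * X' t + 2 * Y t * Y' t) - 2 * ((X' t)\<^sup>2 + (Y' t)\<^sup>2) = - 2 * E t - 2 * q * F t" .
  qed
qed

lemma E_mono: "\<tau> \<le> t \<Longrightarrow> E \<tau> \<le> E t"
  by (rule DERIV_nonneg_imp_nondecreasing) (use pos dE in \<open>auto intro!: exI mult_nonneg_nonneg add_nonneg_nonneg\<close>)

lemma E_lower: "\<exists>B. \<forall>t. E t \<ge> - B"
proof -
  obtain C where C: "C > 0" "\<And>t. X t \<le> C \<and> Y t \<le> C" using bounds by blast
  have "E t \<ge> - (l / 2 * (C\<^sup>2 + C\<^sup>2))" for t
  proof -
    have "(X t)\<^sup>2 \<le> C\<^sup>2" "(Y t)\<^sup>2 \<le> C\<^sup>2"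
      using C(2)[of t] XY_pos[of t] by (auto intro!: power_mono)
    then have "l / 2 * ((X t)\<^sup>2 + (Y t)\<^sup>2) \<le> l / 2 * (C\<^sup>2 + C\<^sup>2)"
      using h_pos by (intro mult_left_mono add_mono) auto
    moreover have "1 / 2 * ((X' t)\<^sup>2 + (Y' t)\<^sup>2) \<ge> 0" by simp
    ultimately show ?thesis using F_pos[of t] unfolding E_def by linarith
  qed
  then show ?thesis by blast
qed

lemma J_lower: "\<exists>B. \<forall>t. J t \<ge> - B"
proof -
  obtain C where C: "C > 0" "\<And>t. X t \<le> C \<and> \<bar>X' t\<bar> \<le> C \<and> Y t \<le> C \<and> \<bar>Y' t\<bar> \<le> C" using bounds by blast
  define B1 where "B1 = (\<mu>1 * C powr (2*q+2) + \<mu>2 * C powr (2*q+2) +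
    2 * \<beta> * (C powr (q+1) * C powr (q+1))) / (2*q+2)"
  define B2 where "B2 = (C\<^sup>2 + C\<^sup>2) / 2 + B1"
  have "J t \<ge> - (2 * C\<^sup>2 + \<kappa> / 2 * (C\<^sup>2 + C\<^sup>2) + 2 / \<kappa> * B2)" for t
  proof -
    have b: "0 \<le> X t" "X t \<le> C" "0 \<le> Y t" "Y t \<le> C" "\<bar>X' t\<bar> \<le> C" "\<bar>Y' t\<bar> \<le> C"
      using C(2)[of t] XY_pos[of t] by auto
    have sq: "(X t)\<^sup>2 \<le> C\<^sup>2" "(Y t)\<^sup>2 \<le> C\<^sup>2" "(X' t)\<^sup>2 \<le> C\<^sup>2" "(Y' t)\<^sup>2 \<le> C\<^sup>2"
      using b C(1) by (auto intro!: power_mono simp flip: abs_le_square_iff)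
    have "E t \<le> B2"
    proof -
      have "F t \<le> B1" unfolding F_def B1_def using pos b
        by (intro divide_right_mono add_mono mult_left_mono mult_mono powr_mono2) auto
      moreover have "l / 2 * ((X t)\<^sup>2 + (Y t)\<^sup>2) \<ge> 0" using h_pos by simp
      moreover have "1 / 2 * ((X' t)\<^sup>2 + (Y' t)\<^sup>2) \<le> (C\<^sup>2 + C\<^sup>2) / 2" using sq by simp
      ultimately show ?thesis unfolding E_def B2_def by linarith
    qed
    then have 1: "2 / \<kappa> * E t \<le> 2 / \<kappa> * B2" using pos by (intro mult_left_mono) auto
    have 2: "\<kappa> / 2 * ((X t)\<^sup>2 + (Y t)\<^sup>2) \<le> \<kappa> / 2 * (C\<^sup>2 + C\<^sup>2)"
      using pos sq by (intro mult_left_mono add_mono) auto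
    have "\<bar>X t * X' t\<bar> \<le> C * C" "\<bar>Y t * Y' t\<bar> \<le> C * C"
      using b C(1) by (auto simp: abs_mult intro!: mult_mono)
    then have "X t * X' t \<ge> - (C\<^sup>2)" "Y t * Y' t \<ge> - (C\<^sup>2)" by (auto simp: power2_eq_square abs_le_iff)
    then show ?thesis using 1 2 unfolding J_def by linarith
  qed
  then show ?thesis by blast
qed

lemma E_nonpos: "E t \<le> 0"
proof (rule ccontr)
  assume "\<not> E t \<le> 0"
  then have e: "E t > 0" by simp
  obtain B where B: "\<And>t. J t \<ge> - B" using J_lower by blast
  define T where "T = t + (\<bar>J t + B\<bar> + 1) / (2 * E t)"
  have T: "t < T" using e by (simp add: T_def add_pos_pos)
  obtain \<xi> where \<xi>: "t < \<xi>" "\<xi> < T" "J T - J t = (T - t) * (- 2 * E \<xi> - 2 * q * F \<xi>)"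
    using MVT2[OF T dJ] by blast
  have "- 2 * E \<xi> - 2 * q * F \<xi> \<le> - 2 * E t"
    using E_mono[of t \<xi>] \<xi> mult_pos_pos[OF pos(4) F_pos[of \<xi>]] by linarith
  then have "J T - J t \<le> (T - t) * (- 2 * E t)" unfolding \<xi>(3) using T by (intro mult_left_mono) auto
  also have "\<dots> = - (\<bar>J t + B\<bar> + 1)" using e by (simp add: T_def)
  finally show False using B[of T] by linarith
qed

text \<open>If \<open>E\<close> were identically 0, its derivative would force
  \<open>X' = Y' = 0\<close>. Then \<open>J\<close> would be constant, although its derivative is
  \<open>- 2 * q * F t < 0\<close>.\<close>

lemma E_neg: "\<exists>t. E t < 0"
proof (rule ccontr)
  assume "\<nexists>t. E t < 0"
  then have E0: "E t = 0" for t using E_nonpos[of t] by (metis less_eq_real_def)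
  then have "E = (\<lambda>t. 0)" by auto
  then have "(E has_real_derivative 0) (at t)" for t by simp
  from DERIV_unique[OF dE this] have "(X' t)\<^sup>2 + (Y' t)\<^sup>2 = 0" for t using pos by simp
  then have 0: "X' t = 0" "Y' t = 0" for t by (simp_all add: sum_power2_eq_zero_iff)
  have "J = (\<lambda>t. - \<kappa> / 2 * ((X t)\<^sup>2 + (Y t)\<^sup>2))" by (auto simp: J_def E0 0)
  moreover have "((\<lambda>t. - \<kappa> / 2 * ((X t)\<^sup>2 + (Y t)\<^sup>2)) has_real_derivative 0) (at 0)"
    by (rule derivative_eq_intros dX dY refl)+ (simp add: 0)
  ultimately have "(J has_real_derivative 0) (at 0)" by simp
  from DERIV_unique[OF dJ this] show False using F_pos[of 0] pos by (simp add: E0)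
qed

text \<open>Before \<open>T\<close> the energy is at most \<open>E T < 0\<close>, while its kinetic
  part and \<open>F\<close> are nonnegative; so the quadratic part must be large. \<open>c\<close>
  solves \<open>l * c\<^sup>2 = - E T\<close>.\<close>

lemma not_both_small: "\<exists>c>0. \<exists>T. \<forall>t\<le>T. X t \<ge> c \<or> Y t \<ge> c"
proof -
  obtain T where T: "E T < 0" using E_neg by blast
  define c where "c = sqrt (- E T / l)"
  have "- E T / l > 0" using T h_pos by (intro divide_pos_pos) auto
  then have c: "c > 0" "l * c\<^sup>2 = - E T" using h_pos by (auto simp: c_def)
  have "X t \<ge> c \<or> Y t \<ge> c" if "t \<le> T" for t
  proof (rule ccontr)
    assume "\<not> (X t \<ge> c \<or> Y t \<ge> c)"
    then have "(X t)\<^sup>2 < c\<^sup>2" "(Y t)\<^sup>2 < c\<^sup>2" using XY_pos[of t] by (auto intro!: power_strict_mono)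
    then have "l / 2 * ((X t)\<^sup>2 + (Y t)\<^sup>2) < l / 2 * (c\<^sup>2 + c\<^sup>2)"
      using h_pos by (intro mult_strict_left_mono) auto
    also have "\<dots> = - E T" using c by simp
    finally have "l / 2 * ((X t)\<^sup>2 + (Y t)\<^sup>2) < - E T" .
    moreover have "1 / 2 * ((X' t)\<^sup>2 + (Y' t)\<^sup>2) \<ge> 0" by simp
    ultimately have "E t > E T" using F_pos[of t] unfolding E_def[of t] by linarith
    then show False using E_mono[OF that] by simp
  qed
  then show ?thesis using c by blast
qed

section \<open>Lower bound or bounded profile, according to the coupling exponent\<close>

text \<open>Backwards in time, a solution that starts to decrease below \<open>\<epsilon>\<close> stays there and satisfies
  \<open>X'' - \<kappa> * X' + M * X \<le> 0\<close> with \<open>M\<close> too large for a positive solution to exist.\<close>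

lemma sublinear_lower_bound:
  assumes "q < 1"
  shows "\<exists>c>0. \<exists>T. \<forall>t\<le>T. X t \<ge> c"
proof -
  obtain c T where c: "c > 0" "\<And>t. t \<le> T \<Longrightarrow> X t \<ge> c \<or> Y t \<ge> c" using not_both_small by blast
  \<comment> \<open>\<open>M * exp (- \<kappa>)\<close> exceeds \<open>\<kappa>\<close> by exactly
    \<open>exp (- \<kappa>)\<close>, which is the contradiction that ends the proof of
    \<open>decreasing\<close>.\<close>
  define M where "M = \<kappa> * exp \<kappa> + 1"
  have M: "M > 0" using pos by (simp add: M_def add_pos_pos)
  define b where "b = \<beta> * c powr (q+1)"
  have b: "b > 0" using pos c by (simp add: b_def)
  \<comment> \<open>\<open>\<epsilon> \<le> c / 2\<close> forces \<open>Y \<ge> c\<close> where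
    \<open>X \<le> \<epsilon>\<close>. As \<open>q < 1\<close>, \<open>X powr (q - 1)\<close> is
    large there, and the coupling term alone exceeds \<open>(M + l) * X\<close>.\<close>
  obtain \<epsilon> where \<epsilon>: "0 < \<epsilon>" "\<epsilon> \<le> c / 2" "\<epsilon> powr (- (1 - q)) \<ge> (M + l) / b"
    using small_powr_large[of "1 - q" "c / 2" "(M + l) / b"] assms c by auto
  have big: "f t - l * X t \<ge> M * X t" if "t \<le> T" "X t \<le> \<epsilon>" for t
  proof -
    have "Y t \<ge> c" using c(2)[OF that(1)] that(2) \<epsilon> c(1) by auto
    then have "Y t powr (q+1) \<ge> c powr (q+1)" using c pos by (intro powr_mono2) auto
    then have "\<beta> * X t powr q * c powr (q+1) \<le> \<beta> * X t powr q * Y t powr (q+1)"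
      using pos by (intro mult_left_mono) auto
    moreover have "\<mu>1 * X t powr (2*q+1) \<ge> 0" using pos by simp
    ultimately have 1: "b * X t powr q \<le> f t" unfolding f_def b_def by (simp add: mult_ac)
    have "(M + l) / b \<le> \<epsilon> powr (q - 1)" using \<epsilon> by simp
    also have "\<dots> \<le> X t powr (q - 1)" using that XY_pos(1)[of t] assms by (intro powr_mono2') auto
    finally have "M + l \<le> b * X t powr (q - 1)" using b by (simp add: pos_divide_le_eq mult.commute)
    then have "(M + l) * X t \<le> b * X t powr (q - 1) * X t"
      using XY_pos(1)[of t] by (intro mult_right_mono) auto
    also have "\<dots> = b * X t powr q" using XY_pos(1)[of t] by (simp add: powr_diff)
    finally show ?thesis using 1 by (simp add: algebra_simps)
  qed
  have decreasing: "X' t0 < 0" if t0: "t0 \<le> T" "X t0 \<le> \<epsilon>" for t0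
  proof (rule ccontr)
    assume "\<not> X' t0 < 0"
    then have X't0: "X' t0 \<ge> 0" by simp
    \<comment> \<open>Otherwise the minimum \<open>m\<close> over \<open>{t..t0}\<close> would
      satisfy \<open>X' m = 0\<close>, also if it is the endpoint \<open>t0\<close>, and there the
      second derivative is negative, so \<open>X\<close> would be smaller just before
      \<open>m\<close>.\<close>
    have less: "X t \<le> X t0" if t: "t \<le> t0" for t
    proof (rule ccontr)
      assume "\<not> X t \<le> X t0"
      then have tt: "X t > X t0" "t < t0" using t by (auto simp: less_le)
      obtain m where m: "m \<in> {t..t0}" "\<And>\<tau>. \<tau> \<in> {t..t0} \<Longrightarrow> X m \<le> X \<tau>"
        using continuous_attains_inf[of "{t..t0}" X] contX t by (metis atLeastatMost_empty_iff compact_Icc)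
      have mX: "X m \<le> X t0" using m(2)[of t0] t by simp
      then have mt: "t < m" using tt m(1) by (cases "m = t") auto
      have "X' m \<ge> 0"
      proof (cases "m = t0")
        case False
        then have "X' m = 0"
          using DERIV_local_min[OF dX, of "min (m - t) (t0 - m)" m] m mt by (auto simp: abs_less_iff)
        then show ?thesis by simp
      qed (use X't0 in simp)
      moreover have "X' m \<le> 0"
      proof (rule ccontr)
        assume "\<not> X' m \<le> 0"
        then obtain d where d: "d > 0" "\<And>h. 0 < h \<Longrightarrow> h < d \<Longrightarrow> X (m - h) < X m"
          using DERIV_pos_inc_left[OF dX, of m] by auto
        define e where "e = min d (m - t) / 2"
        have "0 < e" "e < d" "e < m - t" using d mt by (auto simp: e_def min_def)
        then show False using d(2)[of e] m(2)[of "m - e"] m(1) by auto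
      qed
      ultimately have X'm: "X' m = 0" by simp
      have "M * X m > 0" using M XY_pos by simp
      then have "\<kappa> * X' m + l * X m - f m < 0"
        using big[of m] m(1) mX t0 X'm by auto
      then obtain d where d: "d > 0" "\<And>h. 0 < h \<Longrightarrow> h < d \<Longrightarrow> X' (m - h) > X' m"
        using DERIV_neg_dec_left[OF dX'f, of m] by auto
      define e where "e = min d (m - t) / 2"
      have e: "0 < e" "e < d" "e < m - t" using d mt by (auto simp: e_def min_def)
      obtain \<xi> where \<xi>: "m - e < \<xi>" "\<xi> < m" "X m - X (m - e) = (m - (m - e)) * X' \<xi>"
        using MVT2[of "m - e" m, OF _ dX] e by auto
      have "X' \<xi> > 0" using d(2)[of "m - \<xi>"] \<xi> e X'm by auto
      then have "e * X' \<xi> > 0" using e by simp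
      then have "X (m - e) < X m" using \<xi>(3) by simp
      then show False using m(2)[of "m - e"] m(1) e by auto
    qed
    define Z where "Z t = \<kappa> * X t - X' t" for t
    have dZ: "(Z has_real_derivative f t - l * X t) (at t)" for t
      unfolding Z_def[abs_def] by (rule DERIV_cong[OF DERIV_diff[OF DERIV_cmult[OF dX] dX'f]]) simp
    have Zbig: "f t - l * X t \<ge> M * X t" if "t \<le> t0" for t
      using big[of t] less[OF that] that t0 by auto
    have Zmono: "Z \<tau> \<le> Z t" if "\<tau> \<le> t" "t \<le> t0" for \<tau> t
    proof (rule DERIV_nonneg_imp_nondecreasing[OF that(1)], intro exI conjI, rule dZ)
      fix x assume "\<tau> \<le> x" "x \<le> t"
      then have "M * X x \<le> f x - l * X x" using Zbig[of x] that by simp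
      moreover have "M * X x > 0" using M XY_pos by simp
      ultimately show "0 \<le> f x - l * X x" by simp
    qed
    have Znn: "Z t \<ge> 0" if t: "t \<le> t0" for t
    proof (rule ccontr)
      assume "\<not> Z t \<ge> 0"
      \<comment> \<open>If \<open>Z t < 0\<close>, then \<open>X' \<ge> - Z t > 0\<close> at all
        earlier times, and \<open>\<tau>\<close> is when the line of this slope through
        \<open>(t, X t)\<close> reaches 0.\<close>
      define \<tau> where "\<tau> = t - X t / (- Z t)"
      have \<tau>: "\<tau> < t" using \<open>\<not> Z t \<ge> 0\<close> XY_pos(1)[of t] by (simp add: \<tau>_def divide_pos_neg)
      obtain \<xi> where \<xi>: "\<tau> < \<xi>" "\<xi> < t" "X t - X \<tau> = (t - \<tau>) * X' \<xi>"
        using MVT2[OF \<tau> dX] by blast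
      have "\<kappa> * X \<xi> > 0" using XY_pos pos by simp
      moreover have "Z \<xi> \<le> Z t" using Zmono[of \<xi> t] \<xi> t by simp
      ultimately have "X' \<xi> \<ge> - Z t" unfolding Z_def[of \<xi>] by linarith
      then have "(t - \<tau>) * (- Z t) \<le> X t - X \<tau>" unfolding \<xi>(3) using \<tau> by (intro mult_left_mono) auto
      moreover have "(t - \<tau>) * (- Z t) = X t" using \<open>\<not> Z t \<ge> 0\<close> by (simp add: \<tau>_def)
      ultimately show False using XY_pos(1)[of \<tau>] by linarith
    qed
    \<comment> \<open>\<open>Z\<close> is nonnegative and gains at least \<open>M * X \<xi>\<close>
      over a unit interval. Since \<open>Z \<ge> 0\<close> also makes
      \<open>exp (- \<kappa> * t) * X t\<close> nonincreasing, this gain exceeds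
      \<open>Z t0 \<le> \<kappa> * X t0\<close>.\<close>
    obtain \<xi> where \<xi>: "t0 - 1 < \<xi>" "\<xi> < t0" "Z t0 - Z (t0 - 1) = (t0 - (t0 - 1)) * (f \<xi> - l * X \<xi>)"
      using MVT2[of "t0 - 1" t0, OF _ dZ] by auto
    have "\<xi> \<le> t0" using \<xi> by simp
    then have "exp (- \<kappa> * t0) * X t0 \<le> exp (- \<kappa> * \<xi>) * X \<xi>"
    proof (rule DERIV_nonpos_imp_nonincreasing)
      fix x assume x: "\<xi> \<le> x" "x \<le> t0"
      have "((\<lambda>t. exp (- \<kappa> * t) * X t) has_real_derivative - exp (- \<kappa> * x) * Z x) (at x)"
        by (auto intro!: derivative_eq_intros dX simp: Z_def algebra_simps)
      moreover have "- exp (- \<kappa> * x) * Z x \<le> 0" using Znn[OF x(2)] by simp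
      ultimately show "\<exists>y. ((\<lambda>t. exp (- \<kappa> * t) * X t) has_real_derivative y) (at x) \<and> y \<le> 0" by blast
    qed
    then have "exp (\<kappa> * \<xi>) * (exp (- \<kappa> * t0) * X t0) \<le> exp (\<kappa> * \<xi>) * (exp (- \<kappa> * \<xi>) * X \<xi>)"
      by (intro mult_left_mono) auto
    then have "exp (- (\<kappa> * (t0 - \<xi>))) * X t0 \<le> X \<xi>"
      by (simp add: exp_mult_exp_mult right_diff_distrib)
    moreover have "exp (- \<kappa>) \<le> exp (- (\<kappa> * (t0 - \<xi>)))" using \<xi> pos by simp
    then have "exp (- \<kappa>) * X t0 \<le> exp (- (\<kappa> * (t0 - \<xi>))) * X t0"
      using XY_pos(1)[of t0] by (intro mult_right_mono) auto
    ultimately have "exp (- \<kappa>) * X t0 \<le> X \<xi>" by simp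
    then have "M * (exp (- \<kappa>) * X t0) \<le> M * X \<xi>" using M by (intro mult_left_mono) auto
    also have "\<dots> \<le> Z t0 - Z (t0 - 1)" using Zbig[of \<xi>] \<xi> by simp
    also have "\<dots> \<le> Z t0" using Znn[of "t0 - 1"] by simp
    also have "\<dots> \<le> \<kappa> * X t0" using X't0 by (simp add: Z_def)
    finally have "M * exp (- \<kappa>) \<le> \<kappa>"
      using XY_pos(1)[of t0] by (simp flip: mult.assoc)
    moreover have "M * exp (- \<kappa>) = \<kappa> + exp (- \<kappa>)"
      by (simp add: M_def exp_minus distrib_right)
    ultimately show False by simp
  qed
  have "X t \<ge> min (X T) \<epsilon>" if t: "t \<le> T" for t
  proof (rule ccontr)
    assume *: "\<not> X t \<ge> min (X T) \<epsilon>"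
    obtain m where m: "m \<in> {t..T}" "\<And>\<tau>. \<tau> \<in> {t..T} \<Longrightarrow> X m \<le> X \<tau>"
      using continuous_attains_inf[of "{t..T}" X] contX t by (metis atLeastatMost_empty_iff compact_Icc)
    have mX: "X m \<le> X t" using m(2)[of t] t by simp
    then have mT: "m < T" using * m(1) by (cases "m = T") auto
    have "X m \<le> \<epsilon>" using mX * by linarith
    then have "X' m < 0" by (intro decreasing) (use m in auto)
    then obtain d where d: "d > 0" "\<And>h. 0 < h \<Longrightarrow> h < d \<Longrightarrow> X (m + h) < X m"
      using DERIV_neg_dec_right[OF dX, of m] by auto
    define e where "e = min d (T - m) / 2"
    have "0 < e" "e < d" "e < T - m" using d mT by (auto simp: e_def min_def)
    then show False using d(2)[of e] m(2)[of "m + e"] m(1) by auto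
  qed
  moreover have "min (X T) \<epsilon> > 0" using \<epsilon> XY_pos by simp
  ultimately show ?thesis by blast
qed

text \<open>\<open>X''\<close> is bounded, so \<open>\<bar>X' t\<bar> \<ge> \<eta>\<close> keeps
  \<open>\<bar>X'\<bar> \<ge> \<eta> / 2\<close> on a whole interval of length
  \<open>\<delta>\<close> and costs the energy a fixed amount \<open>g\<close>. Near minus infinity
  the energy is within \<open>g\<close> of its infimum.\<close>

lemma X'_tendsto_0:
  assumes "\<eta> > 0"
  shows "\<exists>T. \<forall>t\<le>T. \<bar>X' t\<bar> < \<eta>"
proof (rule ccontr)
  assume "\<not> ?thesis"
  then have bad: "\<exists>t\<le>T. \<bar>X' t\<bar> \<ge> \<eta>" for T by (meson not_le)
  obtain C where C: "C > 0" "\<And>t. X t \<le> C \<and> \<bar>X' t\<bar> \<le> C \<and> Y t \<le> C" using bounds by blast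
  define D where "D = \<kappa> * C + l * C + (\<mu>1 * C powr (2*q+1) + \<beta> * C powr q * C powr (q+1)) + 1"
  have X'': "\<bar>\<kappa> * X' t + l * X t - f t\<bar> \<le> D" for t
  proof -
    have b: "0 \<le> X t" "X t \<le> C" "0 \<le> Y t" "Y t \<le> C" "\<bar>X' t\<bar> \<le> C"
      using C(2)[of t] XY_pos[of t] by auto
    have "\<bar>\<kappa> * X' t\<bar> \<le> \<kappa> * C" using pos b by (simp add: abs_mult mult_left_mono)
    moreover have "\<bar>l * X t\<bar> \<le> l * C" using h_pos b by (simp add: abs_mult mult_left_mono)
    moreover have "f t \<le> \<mu>1 * C powr (2*q+1) + \<beta> * C powr q * C powr (q+1)"
      unfolding f_def using pos b by (intro add_mono mult_left_mono mult_mono powr_mono2) auto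
    ultimately show ?thesis using f_pos[of t] unfolding D_def by linarith
  qed
  have "D > 0"
  proof -
    have "\<kappa> * C > 0" "l * C > 0" "\<mu>1 * C powr (2*q+1) > 0" "\<beta> * C powr q * C powr (q+1) > 0"
      using pos h_pos C by simp_all
    then show ?thesis unfolding D_def by linarith
  qed
  define \<delta> where "\<delta> = \<eta> / (2 * D)"
  have \<delta>: "\<delta> > 0" "D * \<delta> = \<eta> / 2" using assms \<open>D > 0\<close> by (auto simp: \<delta>_def)
  define g where "g = \<delta> * (\<kappa> * (\<eta> / 2)\<^sup>2)"
  have g: "g > 0" using \<delta> pos assms by (simp add: g_def)
  have drop: "E (t - \<delta>) \<le> E t - g" if t: "\<bar>X' t\<bar> \<ge> \<eta>" for t
  proof -
    have lt: "t - \<delta> < t" using \<delta> by simp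
    obtain \<xi> where \<xi>: "t - \<delta> < \<xi>" "\<xi> < t" "E t - E (t - \<delta>) = (t - (t - \<delta>)) * (\<kappa> * ((X' \<xi>)\<^sup>2 + (Y' \<xi>)\<^sup>2))"
      using MVT2[OF lt dE] by blast
    obtain \<zeta> where \<zeta>: "X' t - X' \<xi> = (t - \<xi>) * (\<kappa> * X' \<zeta> + l * X \<zeta> - f \<zeta>)"
      using MVT2[OF \<xi>(2) dX'f] by blast
    have "\<bar>X' t - X' \<xi>\<bar> = (t - \<xi>) * \<bar>\<kappa> * X' \<zeta> + l * X \<zeta> - f \<zeta>\<bar>" using \<xi> by (simp add: \<zeta> abs_mult)
    also have "\<dots> \<le> \<delta> * D" using \<xi> X''[of \<zeta>] \<delta> by (intro mult_mono) auto
    finally have "\<bar>X' t - X' \<xi>\<bar> \<le> \<eta> / 2" using \<delta> by (simp add: mult.commute)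
    then have "\<bar>X' \<xi>\<bar> \<ge> \<eta> / 2" using t by linarith
    then have "(\<eta> / 2)\<^sup>2 \<le> (X' \<xi>)\<^sup>2" using assms power_mono[of "\<eta> / 2" "\<bar>X' \<xi>\<bar>" 2] by simp
    then have "(\<eta> / 2)\<^sup>2 \<le> (X' \<xi>)\<^sup>2 + (Y' \<xi>)\<^sup>2" using zero_le_power2[of "Y' \<xi>"] by linarith
    then have "g \<le> E t - E (t - \<delta>)" unfolding \<xi>(3) g_def using pos \<delta> by (simp add: mult_left_mono)
    then show ?thesis by simp
  qed
  obtain B where B: "\<And>t. E t \<ge> - B" using E_lower by blast
  have bdd: "bdd_below (range E)" using B by (auto intro: bdd_belowI[of _ "- B"])
  obtain T where T: "E T < Inf (range E) + g"
    using cInf_lessD[of "range E" "Inf (range E) + g"] g by auto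
  obtain t where t: "t \<le> T" "\<bar>X' t\<bar> \<ge> \<eta>" using bad by blast
  have "E (t - \<delta>) \<le> E T - g" using drop[OF t(2)] E_mono[OF t(1)] by simp
  moreover have "Inf (range E) \<le> E (t - \<delta>)" using bdd by (intro cInf_lower) auto
  ultimately show False using T by simp
qed

text \<open>Here \<open>X\<close> cannot pass from \<open>\<epsilon>\<close> to \<open>\<epsilon> / 2\<close> infinitely often because \<open>X'\<close> tends to 0 while \<open>X' - \<kappa> * X\<close>
  increases as long as \<open>X \<le> \<epsilon>\<close>. If \<open>X \<le> \<epsilon>\<close> from some time on, then \<open>X t\<close> is at most a multiple of
  \<open>exp (\<theta> * t)\<close> with \<open>q * \<theta> > a\<close>, which is enough to integrate the equation of \<open>exp (- a * t) * X t\<close>.\<close>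

lemma superlinear_alternative:
  assumes "q > 1"
  shows "(\<exists>c>0. \<exists>T. \<forall>t\<le>T. X t \<ge> c) \<or> (\<exists>B T. \<forall>t\<le>T. exp (- a * t) * X t \<le> B)"
proof -
  obtain C where C: "C > 0" "\<And>t. X t \<le> C \<and> \<bar>X' t\<bar> \<le> C \<and> Y t \<le> C" using bounds by blast
  have "a / q < a" using assms h_pos by (simp add: divide_less_eq)
  \<comment> \<open>\<open>\<theta> > \<kappa>\<close> gives \<open>\<nu> > 0\<close> and
    \<open>\<theta> < a\<close> gives \<open>\<nu> < l\<close>, leaving the margin
    \<open>l - \<nu>\<close> for the nonlinearity; \<open>\<theta> > a / q\<close> is the
    integrability \<open>q * \<theta> > a\<close>.\<close>
  then obtain \<theta> where \<theta>: "max \<kappa> (a / q) < \<theta>" "\<theta> < a" using dense[of "max \<kappa> (a / q)" a] pos by auto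
  have \<theta>': "\<kappa> < \<theta>" "a < q * \<theta>" "\<theta> > 0"
    using \<theta> pos by (auto simp: pos_divide_less_eq mult.commute)
  define \<nu> where "\<nu> = \<theta> * (\<theta> - \<kappa>)"
  have \<nu>: "\<nu> > 0" "\<nu> < l" using \<theta> \<theta>' pos by (auto simp: \<nu>_def l_def h_def intro!: mult_strict_mono)
  \<comment> \<open>Each threshold lets one of the two terms of \<open>f\<close> use up at most half
    of \<open>(l - \<nu>) * X\<close>.\<close>
  define e1 where "e1 = ((l - \<nu>) / (2 * \<mu>1)) powr (1 / (2 * q))"
  define e2 where "e2 = ((l - \<nu>) / (2 * (\<beta> * C powr (q+1)))) powr (1 / (q - 1))"
  define \<epsilon> where "\<epsilon> = min e1 e2"
  have \<epsilon>: "\<epsilon> > 0" using \<nu> pos C by (simp add: \<epsilon>_def e1_def e2_def)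
  have fl: "f t \<le> (l - \<nu>) * X t" if t: "X t \<le> \<epsilon>" for t
  proof -
    have X: "X t > 0" "Y t > 0" by (rule XY_pos)+
    have "X t powr (2 * q) \<le> e1 powr (2 * q)" using t X pos by (intro powr_mono2) (auto simp: \<epsilon>_def)
    also have "\<dots> = (l - \<nu>) / (2 * \<mu>1)" using pos \<nu> by (simp add: e1_def powr_powr)
    finally have 1: "\<mu>1 * X t powr (2 * q) \<le> (l - \<nu>) / 2" using pos by (simp add: field_simps)
    have "X t powr (q - 1) \<le> e2 powr (q - 1)" using t X assms by (intro powr_mono2) (auto simp: \<epsilon>_def)
    also have "\<dots> = (l - \<nu>) / (2 * (\<beta> * C powr (q+1)))"
      using pos \<nu> assms C by (simp add: e2_def powr_powr)
    finally have "(\<beta> * C powr (q+1)) * X t powr (q - 1) \<le> (l - \<nu>) / 2"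
      using pos C by (simp add: field_simps)
    moreover have "\<beta> * Y t powr (q+1) \<le> \<beta> * C powr (q+1)"
      using C(2)[of t] X pos by (intro mult_left_mono powr_mono2) auto
    then have "(\<beta> * Y t powr (q+1)) * X t powr (q - 1) \<le> (\<beta> * C powr (q+1)) * X t powr (q - 1)"
      by (rule mult_right_mono) simp
    ultimately have 2: "(\<beta> * Y t powr (q+1)) * X t powr (q - 1) \<le> (l - \<nu>) / 2" by linarith
    have "f t = (\<mu>1 * X t powr (2 * q) + (\<beta> * Y t powr (q+1)) * X t powr (q - 1)) * X t"
      using X by (simp add: f_def powr_add powr_diff algebra_simps)
    also have "\<dots> \<le> (l - \<nu>) * X t" using 1 2 X by (intro mult_right_mono) auto
    finally show ?thesis .
  qed
  have X''nn: "\<kappa> * X' t + l * X t - f t - \<kappa> * X' t \<ge> \<nu> * X t" if "X t \<le> \<epsilon>" for t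
    using fl[OF that] by (simp add: algebra_simps)
  \<comment> \<open>Between the levels \<open>\<epsilon> / 2\<close> and \<open>\<epsilon>\<close>
    the quantity \<open>\<kappa> * X\<close> changes by at least
    \<open>\<kappa> * \<epsilon> / 2 = 2 * \<eta>\<close>, more than two values of \<open>X'\<close>
    below \<open>\<eta>\<close> can differ.\<close>
  define \<eta> where "\<eta> = \<kappa> * \<epsilon> / 4"
  have \<eta>: "\<eta> > 0" using pos \<epsilon> by (simp add: \<eta>_def)
  obtain T where T: "\<And>t. t \<le> T \<Longrightarrow> \<bar>X' t\<bar> < \<eta>" using X'_tendsto_0[OF \<eta>] by blast
  show ?thesis
  proof (cases "\<forall>t\<le>T. X t \<le> \<epsilon>")
    case False
    then obtain t1 where t1: "t1 \<le> T" "X t1 > \<epsilon>" by auto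
    have "X t \<ge> \<epsilon> / 2" if t: "t \<le> t1" for t
    proof (rule ccontr)
      assume *: "\<not> X t \<ge> \<epsilon> / 2"
      \<comment> \<open>Its least element \<open>m\<close> is the first time after \<open>t\<close>
        at which \<open>X\<close> is back at \<open>\<epsilon>\<close>; before it,
        \<open>X \<le> \<epsilon>\<close> and \<open>X' - \<kappa> * X\<close> increases.\<close>
      define S where "S = {\<tau> \<in> {t..t1}. X \<tau> \<in> {\<epsilon>..}}"
      have "closed S" unfolding S_def
        by (rule continuous_closed_preimage[OF contX, simplified vimage_def Int_def, simplified]) auto
      moreover have "bounded S" unfolding S_def by (rule bounded_subset[of "{t..t1}"]) auto
      ultimately have "compact S" by (simp add: compact_eq_bounded_closed)
      moreover have "S \<noteq> {}" using t1 t by (auto simp: S_def)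
      ultimately obtain m where m: "m \<in> S" "\<And>\<tau>. \<tau> \<in> S \<Longrightarrow> m \<le> \<tau>"
        using compact_attains_inf by metis
      have mX: "X m \<ge> \<epsilon>" "t \<le> m" "m \<le> t1" using m(1) by (auto simp: S_def)
      have tm: "t < m" using mX * \<epsilon> by (cases "t = m") auto
      have d: "((\<lambda>t. X' t - \<kappa> * X t) has_real_derivative \<kappa> * X' x + l * X x - f x - \<kappa> * X' x) (at x)" for x
        by (rule DERIV_diff[OF dX'f DERIV_cmult[OF dX]])
      obtain \<xi> where \<xi>: "t < \<xi>" "\<xi> < m" "X' m - \<kappa> * X m - (X' t - \<kappa> * X t) =
          (m - t) * (\<kappa> * X' \<xi> + l * X \<xi> - f \<xi> - \<kappa> * X' \<xi>)"
        using MVT2[OF tm d] by blast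
      have "X \<xi> \<le> \<epsilon>"
      proof (rule ccontr)
        assume "\<not> X \<xi> \<le> \<epsilon>"
        then have "\<xi> \<in> S" using \<xi> mX by (auto simp: S_def)
        then show False using m(2)[of \<xi>] \<xi> by simp
      qed
      from X''nn[OF this] have "\<kappa> * X' \<xi> + l * X \<xi> - f \<xi> - \<kappa> * X' \<xi> \<ge> 0"
        using \<nu> XY_pos(1)[of \<xi>] mult_pos_pos[of \<nu> "X \<xi>"] by linarith
      then have "X' m - \<kappa> * X m - (X' t - \<kappa> * X t) \<ge> 0" unfolding \<xi>(3) using tm by (intro mult_nonneg_nonneg) auto
      moreover have "\<bar>X' m\<bar> < \<eta>" "\<bar>X' t\<bar> < \<eta>" using T mX t t1 by auto
      ultimately have "\<kappa> * X m - \<kappa> * X t < 2 * \<eta>" by linarith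
      moreover have "\<kappa> * (\<epsilon> - \<epsilon> / 2) \<le> \<kappa> * (X m - X t)"
        using mX * pos by (intro mult_left_mono) auto
      ultimately show False by (simp add: \<eta>_def algebra_simps)
    qed
    then show ?thesis using \<epsilon> by (intro disjI1 exI[of _ "\<epsilon> / 2"]) auto
  next
    case True
    \<comment> \<open>\<open>\<theta>\<close> is a root of
      \<open>r * (r - \<kappa>) = \<nu>\<close>, so
      \<open>X'' - \<kappa> * X' \<ge> \<nu> * X\<close> makes
      \<open>exp ((\<theta> - \<kappa>) * t) * Z t\<close> nonincreasing. It vanishes at minus
      infinity, hence \<open>Z \<le> 0\<close>, and \<open>X\<close> decays at least like
      \<open>exp (\<theta> * t)\<close>.\<close>
    define Z where "Z t = \<theta> * X t - X' t" for t
    have dZ: "((\<lambda>t. exp ((\<theta> - \<kappa>) * t) * Z t) has_real_derivative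
       exp ((\<theta> - \<kappa>) * t) * (\<nu> * X t - (l * X t - f t))) (at t)" for t
      unfolding Z_def[abs_def]
      by (auto intro!: derivative_eq_intros dX dX'f simp: \<nu>_def algebra_simps)
    have Z_np: "Z t1 \<le> 0" if t1: "t1 \<le> T" for t1
    proof (rule ccontr)
      assume "\<not> Z t1 \<le> 0"
      have "exp ((\<theta> - \<kappa>) * t1) * Z t1 \<le> (\<theta> * C + C) * exp ((\<theta> - \<kappa>) * t)" if t: "t \<le> t1" for t
      proof -
        have "exp ((\<theta> - \<kappa>) * t1) * Z t1 \<le> exp ((\<theta> - \<kappa>) * t) * Z t"
        proof (rule DERIV_nonpos_imp_nonincreasing[OF t], intro exI conjI, rule dZ)
          fix x assume "t \<le> x" "x \<le> t1"
          then have "\<nu> * X x - (l * X x - f x) \<le> 0" using X''nn[of x] True t1 by simp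
          then show "exp ((\<theta> - \<kappa>) * x) * (\<nu> * X x - (l * X x - f x)) \<le> 0"
            by (simp add: mult_nonneg_nonpos)
        qed
        also have "\<theta> * X t \<le> \<theta> * C" using C(2)[of t] \<theta>' by simp
        then have "Z t \<le> \<theta> * C + C" using C(2)[of t] unfolding Z_def abs_le_iff by linarith
        then have "exp ((\<theta> - \<kappa>) * t) * Z t \<le> (\<theta> * C + C) * exp ((\<theta> - \<kappa>) * t)" by simp
        finally show ?thesis .
      qed
      from at_bot_nonpos[OF _ this] \<theta>' have "exp ((\<theta> - \<kappa>) * t1) * Z t1 \<le> 0" by simp
      then show False using \<open>\<not> Z t1 \<le> 0\<close> by (simp add: mult_le_0_iff)
    qed
    define D where "D = exp (- \<theta> * T) * X T"
    have XD: "X t \<le> D * exp (\<theta> * t)" if t: "t \<le> T" for t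
    proof -
      have "exp (- \<theta> * t) * X t \<le> D" unfolding D_def
      proof (rule DERIV_nonneg_imp_nondecreasing[OF t])
        fix x assume x: "t \<le> x" "x \<le> T"
        have "((\<lambda>t. exp (- \<theta> * t) * X t) has_real_derivative - exp (- \<theta> * x) * Z x) (at x)"
          by (auto intro!: derivative_eq_intros dX simp: Z_def algebra_simps)
        moreover have "- exp (- \<theta> * x) * Z x \<ge> 0" using Z_np[OF x(2)] by (simp add: mult_le_0_iff)
        ultimately show "\<exists>y. ((\<lambda>t. exp (- \<theta> * t) * X t) has_real_derivative y) (at x) \<and> 0 \<le> y" by blast
      qed
      then have "exp (\<theta> * t) * (exp (- \<theta> * t) * X t) \<le> exp (\<theta> * t) * D" by (intro mult_left_mono) auto
      moreover have "exp (\<theta> * t) * (exp (- \<theta> * t) * X t) = X t" by (simp add: exp_mult_exp_mult)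
      ultimately show ?thesis by (simp only: mult.commute[of D])
    qed
    have D: "D > 0" using XY_pos by (simp add: D_def)
    define K where "K = (\<mu>1 * C powr (q+1) + \<beta> * C powr (q+1)) * D powr q"
    have K: "K > 0" using pos C D by (simp add: K_def add_pos_pos)
    have fK: "f t \<le> K * exp (q * \<theta> * t)" if t: "t \<le> T" for t
    proof -
      have X: "X t > 0" "Y t > 0" by (rule XY_pos)+
      have "f t = (\<mu>1 * X t powr (q+1) + \<beta> * Y t powr (q+1)) * X t powr q"
        using X by (simp add: f_def algebra_simps flip: powr_add)
      also have "\<dots> \<le> (\<mu>1 * C powr (q+1) + \<beta> * C powr (q+1)) * (D * exp (\<theta> * t)) powr q"
        using C(2)[of t] X pos XD[OF t] C(1)
        by (intro mult_mono add_mono mult_left_mono powr_mono2 add_nonneg_nonneg) auto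
      also have "\<dots> = K * exp (q * \<theta> * t)"
        using D by (simp add: K_def powr_mult exp_powr_real mult_ac)
      finally show ?thesis .
    qed
    define r where "r = h + q * \<theta>"
    have r: "r > 0" using h_pos \<theta>' by (simp add: r_def)
    have WK: "- W t \<le> K / r * exp (q * \<theta> * t)" if t: "t \<le> T" for t
    proof -
      obtain C' where C': "\<And>t. \<bar>X' t\<bar> \<le> C'" using X'_bounded by blast
      define G where "G t = - (exp (h * t) * W t) - K / r * exp (r * t)" for t
      have dG: "(G has_real_derivative exp (h * x) * f x - K * exp (r * x)) (at x)" for x
      proof -
        have "((\<lambda>t. K / r * exp (r * t)) has_real_derivative K * exp (r * x)) (at x)"
          using r by (auto intro!: derivative_eq_intros)
        from DERIV_diff[OF DERIV_minus[OF dexpW] this] show ?thesis by (simp add: G_def[abs_def])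
      qed
      have "G t \<le> (C' + a * C) * exp (h * \<tau>)" if \<tau>: "\<tau> \<le> t" for \<tau>
      proof -
        have "G t \<le> G \<tau>"
        proof (rule DERIV_nonpos_imp_nonincreasing[OF \<tau>], intro exI conjI, rule dG)
          fix x assume "\<tau> \<le> x" "x \<le> t"
          then have "exp (h * x) * f x \<le> exp (h * x) * (K * exp (q * \<theta> * x))"
            using fK[of x] t by (intro mult_left_mono) auto
          also have "\<dots> = K * exp (r * x)" by (simp add: r_def distrib_right exp_add)
          finally show "exp (h * x) * f x - K * exp (r * x) \<le> 0" by simp
        qed
        also have "\<dots> \<le> exp (h * \<tau>) * (- W \<tau>)" using K r by (simp add: G_def)
        also have "a * X \<tau> \<le> a * C" using C(2)[of \<tau>] h_pos by simp
        then have "- W \<tau> \<le> C' + a * C" using C'[of \<tau>] unfolding W_def abs_le_iff by linarith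
        then have "exp (h * \<tau>) * (- W \<tau>) \<le> (C' + a * C) * exp (h * \<tau>)"
          by (subst mult.commute[of "C' + a * C"]) (intro mult_left_mono, auto)
        finally show ?thesis .
      qed
      from at_bot_nonpos[OF h_pos(1) this] have "G t \<le> 0" .
      moreover have "G t = exp (h * t) * (- W t - K / r * exp (q * \<theta> * t))"
        by (simp add: G_def r_def distrib_right exp_add algebra_simps)
      ultimately show ?thesis by (simp add: mult_le_0_iff)
    qed
    \<comment> \<open>The derivative \<open>exp (- a * t) * W t\<close> is of order
      \<open>exp (p * t)\<close>; because \<open>p > 0\<close>, its integral towards minus infinity
      stays finite.\<close>
    define p where "p = q * \<theta> - a"
    have p: "p > 0" using \<theta>' by (simp add: p_def)
    define L where "L = K / (r * p)"
    have L: "L > 0" using K r p by (simp add: L_def)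
    have "exp (- a * t) * X t \<le> exp (- a * T) * X T + L * exp (p * T)" if t: "t \<le> T" for t
    proof -
      have d: "((\<lambda>t. exp (- a * t) * X t + L * exp (p * t)) has_real_derivative
         exp (- a * x) * W x + L * (p * exp (p * x))) (at x)" for x
        by (rule DERIV_add[OF dU]) (auto intro!: derivative_eq_intros)
      have "exp (- a * t) * X t + L * exp (p * t) \<le> exp (- a * T) * X T + L * exp (p * T)"
      proof (rule DERIV_nonneg_imp_nondecreasing[OF t], intro exI conjI, rule d)
        fix x assume "t \<le> x" "x \<le> T"
        then have "exp (- a * x) * - W x \<le> exp (- a * x) * (K / r * exp (q * \<theta> * x))"
          using WK by (intro mult_left_mono) auto
        also have "\<dots> = L * (p * exp (p * x))"
          using p r by (simp add: L_def p_def left_diff_distrib exp_diff exp_minus field_simps)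
        finally show "0 \<le> exp (- a * x) * W x + L * (p * exp (p * x))" by simp
      qed
      moreover have "0 \<le> L * exp (p * t)" using L by simp
      ultimately show ?thesis by linarith
    qed
    then show ?thesis by blast
  qed
qed

text \<open>The times \<open>t \<le> 0\<close> are those of the unit ball; on the remaining compact
  interval continuity and positivity suffice.\<close>

lemma lower_bound_extend:
  assumes "c > 0" "\<And>t. t \<le> T \<Longrightarrow> X t \<ge> c"
  shows "\<exists>c>0. \<forall>t\<le>0. X t \<ge> c"
proof (cases "T \<ge> 0")
  case True
  then show ?thesis using assms by (intro exI[of _ c]) auto
next
  case False
  obtain m where m: "m \<in> {T..0}" "\<And>\<tau>. \<tau> \<in> {T..0} \<Longrightarrow> X m \<le> X \<tau>"
    using continuous_attains_inf[of "{T..0}" X] contX False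
    by (metis atLeastatMost_empty_iff compact_Icc linear)
  show ?thesis
  proof (intro exI[of _ "min c (X m)"] conjI allI impI)
    show "0 < min c (X m)" using assms XY_pos by simp
    fix t :: real assume "t \<le> 0"
    then show "min c (X m) \<le> X t" using assms(2)[of t] m(2)[of t] by (cases "t \<le> T") auto
  qed
qed

end

section \<open>Behaviour at the origin\<close>

context coupled_system begin

interpretation sw: coupled_system \<mu>2 \<mu>1 \<beta> q v u by (rule swap)

lemma ef_pos: "ef t > 0"
  using U_pos[of "exp t"] by (simp add: ef_def)

lemma ef'_le: "ef' t \<le> 1 / q * ef t"
  using dU_nonpos[of "exp t"] by (simp add: ef_def ef'_def mult_nonneg_nonpos)

text \<open>The exponent \<open>1/q\<close> is the scaling exponent:
  \<open>(1/q) * (2*q+1) = 1/q + 2\<close>, so the exponential factors of both nonlinear terms match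
  that of the second derivative and the system is autonomous.\<close>

lemma DERIV_ef':
  "(ef' has_real_derivative (2 / q - s) * ef' t + 1 / q * (1 / q - (2 / q - s)) * ef t -
     (\<mu>1 * ef t powr (2*q+1) + \<beta> * ef t powr q * sw.ef t powr (q+1))) (at t)"
proof -
  define P where "P = exp ((1 / q + 1) * t) * dU (exp t)"
  define N where "N = \<mu>1 * U (exp t) powr (2*q+1) + \<beta> * U (exp t) powr q * sw.U (exp t) powr (q+1)"
  have q: "q > 0" by (rule exponents)
  have P: "P = ef' t - 1 / q * ef t" by (simp add: P_def ef_def ef'_def)
  have N: "exp ((1 / q + 2) * t) * N = \<mu>1 * ef t powr (2*q+1) + \<beta> * ef t powr q * sw.ef t powr (q+1)"
  proof -
    have "exp (t / q) powr (2*q+1) = exp ((1 / q + 2) * t)"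
      using q by (simp add: exp_powr_real field_simps)
    moreover have "exp (t / q) powr q * exp (t / q) powr (q+1) = exp ((1 / q + 2) * t)"
      using q by (simp add: exp_powr_real field_simps flip: exp_add)
    moreover have "ef t powr (2*q+1) = exp (t / q) powr (2*q+1) * U (exp t) powr (2*q+1)"
      "ef t powr q = exp (t / q) powr q * U (exp t) powr q"
      "sw.ef t powr (q+1) = exp (t / q) powr (q+1) * sw.U (exp t) powr (q+1)"
      using U_pos[of "exp t"] sw.U_pos[of "exp t"] by (simp_all add: ef_def sw.ef_def powr_mult)
    ultimately show ?thesis unfolding N_def by (simp add: algebra_simps)
  qed
  have dd: "ddU (exp t) = - ((s + 1) * dU (exp t) / exp t) - N"
    using radial_ode[of "exp t"] by (simp add: N_def U_def sw.U_def)
  then have D0: "ddU (exp t) * exp t = - (s + 1) * dU (exp t) - N * exp t"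
    by (simp add: left_diff_distrib) (simp add: algebra_simps)
  have "exp ((1 / q + 2) * t) = exp ((1 / q + 1) * t) * exp t"
    by (simp add: algebra_simps flip: exp_add)
  then have D: "exp ((1 / q + 1) * t) * (ddU (exp t) * exp t) = - (s + 1) * P - exp ((1 / q + 2) * t) * N"
    unfolding P_def D0 by (simp add: algebra_simps)
  have 1: "((\<lambda>t. dU (exp t)) has_real_derivative ddU (exp t) * exp t) (at t)"
    by (rule DERIV_chain2[OF DERIV_dU DERIV_exp]) simp
  have 2: "((\<lambda>t. exp ((1 / q + 1) * t)) has_real_derivative (1 / q + 1) * exp ((1 / q + 1) * t)) (at t)"
    by (auto intro!: derivative_eq_intros)
  have "ef' = (\<lambda>t. ef t / q + exp ((1 / q + 1) * t) * dU (exp t))"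
    by (auto simp: ef_def ef'_def)
  moreover have "((\<lambda>t. ef t / q + exp ((1 / q + 1) * t) * dU (exp t)) has_real_derivative
      ef' t / q + ((1 / q + 1) * exp ((1 / q + 1) * t) * dU (exp t) + ddU (exp t) * exp t * exp ((1 / q + 1) * t))) (at t)"
    by (intro DERIV_add DERIV_cdivide DERIV_ef DERIV_mult 1 2)
  ultimately have "(ef' has_real_derivative
      ef' t / q + ((1 / q + 1) * exp ((1 / q + 1) * t) * dU (exp t) + ddU (exp t) * exp t * exp ((1 / q + 1) * t))) (at t)"
    by simp
  then show ?thesis
  proof (rule DERIV_cong)
    have "ef' t / q + ((1 / q + 1) * exp ((1 / q + 1) * t) * dU (exp t) + ddU (exp t) * exp t * exp ((1 / q + 1) * t))
      = ef' t / q + ((1 / q + 1) * P + exp ((1 / q + 1) * t) * (ddU (exp t) * exp t))"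
      by (simp add: P_def)
    also have "\<dots> = ef' t / q + ((1 / q - s) * P - exp ((1 / q + 2) * t) * N)"
      unfolding D by (simp add: algebra_simps)
    also have "\<dots> = (2 / q - s) * ef' t + 1 / q * (1 / q - (2 / q - s)) * ef t - exp ((1 / q + 2) * t) * N"
      unfolding P using q by (simp add: field_simps)
    finally show "ef' t / q + ((1 / q + 1) * exp ((1 / q + 1) * t) * dU (exp t) + ddU (exp t) * exp t * exp ((1 / q + 1) * t))
      = (2 / q - s) * ef' t + 1 / q * (1 / q - (2 / q - s)) * ef t -
        (\<mu>1 * ef t powr (2*q+1) + \<beta> * ef t powr q * sw.ef t powr (q+1))"
      unfolding N .
  qed
qed

end

context coupled_system begin

interpretation sw: coupled_system \<mu>2 \<mu>1 \<beta> q v u by (rule swap)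

text \<open>\<open>s * q < 2\<close> becomes \<open>2 / q - s > 0\<close>, and
  \<open>1 < s * q\<close> becomes \<open>2 / q - s < 1 / q\<close>.\<close>

lemma emden_fowler_ef: "emden_fowler \<mu>1 \<mu>2 \<beta> q (1 / q) (2 / q - s) ef sw.ef ef' sw.ef'"
proof
  show "\<mu>1 > 0" "\<mu>2 > 0" "\<beta> > 0" "q > 0" using pos exponents by auto
  then show "2 / q - s > 0" "2 / q - s < 1 / q" "1 / q * q = 1"
    using exponents by (auto simp: field_simps)
  fix t
  show "ef t > 0" "sw.ef t > 0" by (rule ef_pos sw.ef_pos)+
  show "(ef has_real_derivative ef' t) (at t)" by (rule DERIV_ef)
  show "(sw.ef has_real_derivative sw.ef' t) (at t)" by (rule sw.DERIV_ef)
  show "ef' t \<le> 1 / q * ef t" "sw.ef' t \<le> 1 / q * sw.ef t" by (rule ef'_le sw.ef'_le)+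
  show "(ef' has_real_derivative (2 / q - s) * ef' t + 1 / q * (1 / q - (2 / q - s)) * ef t -
     (\<mu>1 * ef t powr (2*q+1) + \<beta> * ef t powr q * sw.ef t powr (q+1))) (at t)"
    by (rule DERIV_ef')
  show "(sw.ef' has_real_derivative (2 / q - s) * sw.ef' t + 1 / q * (1 / q - (2 / q - s)) * sw.ef t -
     (\<mu>2 * sw.ef t powr (2*q+1) + \<beta> * sw.ef t powr q * ef t powr (q+1))) (at t)"
    by (rule sw.DERIV_ef')
qed

interpretation EF: emden_fowler \<mu>1 \<mu>2 \<beta> q "1 / q" "2 / q - s" ef sw.ef ef' sw.ef'
  by (rule emden_fowler_ef)

lemma u_eq_ef:
  assumes "x \<noteq> 0"
  shows "u x = norm x powr (- 1 / q) * ef (ln (norm x))"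
proof -
  have "ef (ln (norm x)) = norm x powr (1 / q) * U (norm x)"
    using assms by (simp add: ef_def powr_def)
  then show ?thesis using u_eq_U[OF assms] assms by (simp add: powr_minus flip: mult.assoc)
qed

section \<open>From the transformed system back to the solution\<close>

lemma singular_of_lower_bound:
  assumes c: "c > 0" "\<And>t. t \<le> T \<Longrightarrow> ef t \<ge> c"
  shows "filterlim u at_top (at 0)"
  unfolding filterlim_at_top
proof
  fix Z
  obtain \<rho> where \<rho>: "0 < \<rho>" "\<rho> \<le> exp T" "\<rho> powr (- (1 / q)) \<ge> Z / c"
    using small_powr_large[of "1 / q" "exp T" "Z / c"] exponents by auto
  show "\<forall>\<^sub>F x in at 0. Z \<le> u x"
    unfolding eventually_at
  proof (intro exI[of _ \<rho>] conjI \<rho>(1) ballI impI)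
    fix x :: "real^'n" assume x: "x \<noteq> 0 \<and> dist x 0 < \<rho>"
    then have "norm x \<le> exp T" "norm x > 0" using \<rho> by auto
    then have "ln (norm x) \<le> T" by (simp add: ln_le_cancel_iff[of _ "exp T", symmetric, simplified])
    then have 1: "c \<le> ef (ln (norm x))" by (rule c)
    have "Z / c \<le> norm x powr (- (1 / q))"
      using \<rho>(3) powr_mono2'[of "- (1 / q)" "norm x" \<rho>] x exponents by simp
    then have "Z \<le> norm x powr (- (1 / q)) * c" using c by (simp add: divide_le_eq)
    also have "\<dots> \<le> norm x powr (- (1 / q)) * ef (ln (norm x))" using 1 by (intro mult_left_mono) auto
    also have "\<dots> = u x" using u_eq_ef x by simp
    finally show "Z \<le> u x" .
  qed
qed

text \<open>A nonincreasing profile that is bounded near 0 is bounded throughout and tends to its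
  supremum at the origin.\<close>

lemma limit_of_U_bounded:
  assumes B: "\<And>t. t \<le> T \<Longrightarrow> exp (- (1 / q) * t) * ef t \<le> B"
  shows "\<exists>L. (u \<longlongrightarrow> L) (at 0)"
proof -
  have UB: "U r \<le> B" if r: "0 < r" "r \<le> exp T" for r
  proof -
    have "exp (- (1 / q) * ln r) * ef (ln r) = U r" using r by (simp add: ef_def flip: mult.assoc exp_add)
    moreover have "ln r \<le> T" using r by (metis ln_exp ln_le_cancel_iff exp_gt_zero)
    ultimately show ?thesis using B[of "ln r"] by simp
  qed
  have UB': "U r \<le> B" if r: "0 < r" for r
  proof (cases "r \<le> exp T")
    case False
    then show ?thesis using UB[of "exp T"] U_antimono[of "exp T" r] by simp
  qed (use UB r in simp)
  define L where "L = (SUP r\<in>{0<..}. U r)"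
  have bdd: "bdd_above (U ` {0<..})" using UB' by (auto intro!: bdd_aboveI[of _ B])
  have "(u \<longlongrightarrow> L) (at 0)"
  proof (rule order_tendstoI)
    fix a assume "a < L"
    then obtain r where r: "r > 0" "a < U r"
      using less_cSUP_iff[OF _ bdd, of a] by (auto simp: L_def)
    show "\<forall>\<^sub>F x in at 0. a < u x"
      unfolding eventually_at using r U_antimono u_eq_U by (intro exI[of _ r]) (force intro: less_le_trans)
  next
    fix a assume "L < a"
    have "u x < a" if "x \<noteq> 0" for x
      using cSUP_upper[OF _ bdd, of "norm x"] that \<open>L < a\<close> u_eq_U[OF that] by (simp add: L_def)
    then show "\<forall>\<^sub>F x in at 0. u x < a" unfolding eventually_at by (intro exI[of _ 1]) auto
  qed
  then show ?thesis by blast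
qed

end

context coupled_system begin

interpretation sw: coupled_system \<mu>2 \<mu>1 \<beta> q v u by (rule swap)

interpretation EF: emden_fowler \<mu>1 \<mu>2 \<beta> q "1 / q" "2 / q - s" ef sw.ef ef' sw.ef'
  by (rule emden_fowler_ef)

text \<open>In the second alternative the profile of \<open>u\<close> is bounded, so
  \<open>ef\<close> tends to 0 and, as both cannot be small, \<open>sw.ef\<close> stays above
  \<open>c\<close>: \<open>v\<close> blows up while \<open>u\<close> has a limit.\<close>

lemma lower_bound_or_semi_singular:
  assumes "q > 1"
  shows "(\<exists>c>0. \<forall>t\<le>0. ef t \<ge> c) \<or> semi_singular u v"
proof -
  consider c T where "c > 0" "\<And>t. t \<le> T \<Longrightarrow> ef t \<ge> c"
    | B T where "\<And>t. t \<le> T \<Longrightarrow> exp (- (1 / q) * t) * ef t \<le> B"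
    using EF.superlinear_alternative[OF assms] by blast
  then show ?thesis
  proof cases
    case 1
    then show ?thesis using EF.lower_bound_extend by blast
  next
    case (2 B T)
    obtain c T' where c: "c > 0" "\<And>t. t \<le> T' \<Longrightarrow> ef t \<ge> c \<or> sw.ef t \<ge> c"
      using EF.not_both_small by blast
    define B' where "B' = max B 0 + 1"
    have B': "B' > 0" by (simp add: B'_def)
    \<comment> \<open>The last entry makes \<open>exp (t / q) \<le> c / (2 * B')\<close>, so that
      \<open>ef t \<le> c / 2 < c\<close>.\<close>
    define T2 where "T2 = min (min T T') (q * ln (c / (2 * B')))"
    have "sw.ef t \<ge> c" if t: "t \<le> T2" for t
    proof -
      have "exp (- (1 / q) * t) * ef t \<le> B'" using 2[of t] t by (simp add: T2_def B'_def)
      then have "exp (1 / q * t) * (exp (- (1 / q) * t) * ef t) \<le> exp (1 / q * t) * B'"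
        by (intro mult_left_mono) auto
      then have "ef t \<le> exp (1 / q * t) * B'" by (simp add: exp_mult_exp_mult)
      also have "1 / q * t \<le> ln (c / (2 * B'))"
        using t exponents(1) by (simp add: T2_def divide_le_eq mult.commute)
      then have "exp (1 / q * t) \<le> exp (ln (c / (2 * B')))" by simp
      also have "exp (ln (c / (2 * B'))) = c / (2 * B')" using c by (simp add: B'_def)
      finally have "ef t \<le> c / (2 * B') * B'" by (simp add: B'_def mult_right_mono)
      moreover have "c / (2 * B') * B' = c / 2" using B' by simp
      ultimately have "ef t < c" using c by simp
      then show ?thesis using c(2)[of t] t by (simp add: T2_def)
    qed
    from sw.singular_of_lower_bound[OF c(1) this]
    show ?thesis using limit_of_U_bounded[OF 2] by (simp add: semi_singular_def)
  qed
qed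

text \<open>Dimension at least 4 means \<open>s \<ge> 2\<close>, and then \<open>s * q < 2\<close>
  puts \<open>q\<close> in the sublinear range.\<close>

lemma lower_bound_dim_ge_4:
  assumes "CARD('n) \<ge> 4"
  shows "\<exists>c>0. \<forall>t\<le>0. ef t \<ge> c"
proof -
  have "2 \<le> s" using assms by (simp add: s_def)
  then have "2 * q \<le> s * q" using exponents by (intro mult_right_mono) auto
  then have "q < 1" using exponents(3) by linarith
  from EF.sublinear_lower_bound[OF this] show ?thesis using EF.lower_bound_extend by blast
qed

lemma upper_bound: "\<exists>C>0. \<forall>t. ef t \<le> C"
  by (rule EF.X_bounded)

end

lemma coupled_system_two_sided:
  assumes "coupled_system \<mu>1 \<mu>2 \<beta> q u v"
    and lo: "\<exists>c>0. \<forall>t\<le>0. coupled_system.ef q u t \<ge> c"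
  shows "\<exists>c>0. \<exists>C. \<forall>x. 0 < norm x \<and> norm x < 1 \<longrightarrow>
     c * norm x powr (-1 / q) \<le> u x \<and> u x \<le> C * norm x powr (-1 / q)"
proof -
  interpret coupled_system \<mu>1 \<mu>2 \<beta> q u v by fact
  obtain c where c: "c > 0" "\<And>t. t \<le> 0 \<Longrightarrow> ef t \<ge> c" using lo by auto
  obtain C where C: "\<And>t. ef t \<le> C" using upper_bound by blast
  have "c * norm x powr (-1 / q) \<le> u x \<and> u x \<le> C * norm x powr (-1 / q)"
    if x: "0 < norm x" "norm x < 1" for x
  proof -
    have "x \<noteq> 0" using x by auto
    have "ln (norm x) \<le> 0" using x by simp
    then show ?thesis
      unfolding u_eq_ef[OF \<open>x \<noteq> 0\<close>] mult.commute[of "norm x powr _"]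
      using c(2) C by (intro conjI mult_right_mono) auto
  qed
  then show ?thesis using c by blast
qed

theorem theorem1p2:
  fixes \<mu>1 \<mu>2 \<beta> q :: real
  assumes n3: "CARD('n) \<ge> 3"
    and pos: "\<mu>1 > 0" "\<mu>2 > 0" "\<beta> > 0"
    and p_low: "real CARD('n) / (real CARD('n) - 2) < 2*q+1"
    and p_up: "2*q+1 < (real CARD('n) + 2) / (real CARD('n) - 2)"
  shows
    "(CARD('n) \<ge> 4 \<longrightarrow>
        \<not> (\<exists>u v :: real^'n \<Rightarrow> real. positive_solution \<mu>1 \<mu>2 \<beta> q u v \<and> semi_singular u v))
     \<and>
     ((CARD('n) \<ge> 4 \<or>
        (CARD('n) = 3 \<and>
          \<not> (\<exists>u v :: real^'n \<Rightarrow> real. positive_solution \<mu>1 \<mu>2 \<beta> q u v \<and> semi_singular u v)))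
      \<longrightarrow> (\<forall>u v :: real^'n \<Rightarrow> real. positive_solution \<mu>1 \<mu>2 \<beta> q u v \<longrightarrow>
            (\<exists>C1 C2. 0 < C1 \<and> C1 \<le> C2 \<and>
               (\<forall>x :: real^'n. 0 < norm x \<and> norm x < 1 \<longrightarrow>
                  C1 * norm x powr (-2/((2*q+1)-1)) \<le> u x \<and>
                  u x \<le> C2 * norm x powr (-2/((2*q+1)-1)) \<and>
                  C1 * norm x powr (-2/((2*q+1)-1)) \<le> v x \<and>
                  v x \<le> C2 * norm x powr (-2/((2*q+1)-1))))))"
proof -
  have cs: "coupled_system \<mu>1 \<mu>2 \<beta> q u v \<and> coupled_system \<mu>2 \<mu>1 \<beta> q v u"
    if "positive_solution \<mu>1 \<mu>2 \<beta> q u v" for u v :: "real^'n \<Rightarrow> real"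
  proof -
    have "coupled_system \<mu>1 \<mu>2 \<beta> q u v" by unfold_locales (fact n3 pos p_low p_up that)+
    then show ?thesis using coupled_system.swap by blast
  qed
  \<comment> \<open>In dimension at least 4 both components will tend to infinity; uniqueness of the
    limiting behaviour at the nontrivial filter \<open>at 0\<close> then excludes a finite
    limit.\<close>
  have no_limit: "\<not> ((\<exists>L. (u \<longlongrightarrow> L) (at 0)) \<and> filterlim u at_top (at 0))" for u :: "real^'n \<Rightarrow> real"
    using not_tendsto_and_filterlim_at_infinity[of "at (0::real^'n)" u] filterlim_at_top_imp_at_infinity
    by (metis trivial_limit_at)
  have part1: "\<not> semi_singular u v"
    if n4: "CARD('n) \<ge> 4" and sol: "positive_solution \<mu>1 \<mu>2 \<beta> q u v" for u v :: "real^'n \<Rightarrow> real"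
  proof -
    have "filterlim u at_top (at 0)" if "coupled_system \<mu>1 \<mu>2 \<beta> q u v" for \<mu>1 \<mu>2 and u v :: "real^'n \<Rightarrow> real"
    proof -
      interpret coupled_system \<mu>1 \<mu>2 \<beta> q u v by fact
      show ?thesis using lower_bound_dim_ge_4[OF n4] singular_of_lower_bound by blast
    qed
    then show ?thesis using cs[OF sol] no_limit unfolding semi_singular_def by blast
  qed
  have part2: "\<exists>C1 C2. 0 < C1 \<and> C1 \<le> C2 \<and>
               (\<forall>x :: real^'n. 0 < norm x \<and> norm x < 1 \<longrightarrow>
                  C1 * norm x powr (-2/((2*q+1)-1)) \<le> u x \<and>
                  u x \<le> C2 * norm x powr (-2/((2*q+1)-1)) \<and>
                  C1 * norm x powr (-2/((2*q+1)-1)) \<le> v x \<and>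
                  v x \<le> C2 * norm x powr (-2/((2*q+1)-1)))"
    if hyp: "CARD('n) \<ge> 4 \<or> (CARD('n) = 3 \<and>
          \<not> (\<exists>u v :: real^'n \<Rightarrow> real. positive_solution \<mu>1 \<mu>2 \<beta> q u v \<and> semi_singular u v))"
      and sol: "positive_solution \<mu>1 \<mu>2 \<beta> q u v" for u v :: "real^'n \<Rightarrow> real"
  proof -
    have nss: "\<not> semi_singular u v" using hyp part1 sol by blast
    then have nss': "\<not> semi_singular v u" by (auto simp: semi_singular_def)
    have lower: "\<exists>c>0. \<forall>t\<le>0. coupled_system.ef q u t \<ge> c"
      if "coupled_system \<mu>1 \<mu>2 \<beta> q u v" "\<not> semi_singular u v" for \<mu>1 \<mu>2 and u v :: "real^'n \<Rightarrow> real"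
    proof -
      interpret coupled_system \<mu>1 \<mu>2 \<beta> q u v by fact
      show ?thesis
      proof (cases "CARD('n) \<ge> 4")
        case False
        \<comment> \<open>In dimension 3 the bound \<open>1 < s * q\<close> reads
          \<open>1 < q\<close>, the superlinear case.\<close>
        then have "s = 1" using n3 by (simp add: s_def)
        then show ?thesis using lower_bound_or_semi_singular exponents that(2) by simp
      qed (rule lower_bound_dim_ge_4)
    qed
    obtain c C where u: "c > 0" "\<And>x. 0 < norm x \<and> norm x < 1 \<Longrightarrow>
       c * norm x powr (-1 / q) \<le> u x \<and> u x \<le> C * norm x powr (-1 / q)"
      using coupled_system_two_sided lower nss cs[OF sol] by metis
    obtain d D where v: "d > 0" "\<And>x. 0 < norm x \<and> norm x < 1 \<Longrightarrow>
       d * norm x powr (-1 / q) \<le> v x \<and> v x \<le> D * norm x powr (-1 / q)"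
      using coupled_system_two_sided lower nss' cs[OF sol] by metis
    have q: "-2/((2*q+1)-1) = -1 / q" by simp
    \<comment> \<open>Including \<open>min c d\<close> in the upper constant yields
      \<open>C1 \<le> C2\<close> without evaluating the bounds at a point.\<close>
    show ?thesis unfolding q
    proof (rule exI[of _ "min c d"], rule exI[of _ "max (max C D) (min c d)"], intro conjI allI impI)
      show "0 < min c d" "min c d \<le> max (max C D) (min c d)" using u v by auto
      fix x :: "real^'n" assume x: "0 < norm x \<and> norm x < 1"
      have m: "a * norm x powr (-1 / q) \<le> b * norm x powr (-1 / q)" if "a \<le> b" for a b
        using that by (intro mult_right_mono) auto
      show "min c d * norm x powr (-1 / q) \<le> u x" "min c d * norm x powr (-1 / q) \<le> v x"
        using u(2)[OF x] v(2)[OF x] m[of "min c d" c] m[of "min c d" d] by linarith+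
      show "u x \<le> max (max C D) (min c d) * norm x powr (-1 / q)"
        "v x \<le> max (max C D) (min c d) * norm x powr (-1 / q)"
        using u(2)[OF x] v(2)[OF x] m[of C "max (max C D) (min c d)"] m[of D "max (max C D) (min c d)"] by linarith+
    qed
  qed
  show ?thesis using part1 part2 by blast
qed

end
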